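(* Let $\mathcal{C}=(C_1,\dots,C_m)$, $m\ge 2$, be a collection of $m$ pinhole cameras with distinct centers. Then $$\mathcal{L}_{\mathcal{C}}= \left\{\ell \in (\mathbb P^2)^m \mid \mathrm{rank}\, M(\ell) \leq 2\right\}$$ if and only if no four cameras are collinear (that is, no four of the camera centers lie on a common line). Moreover, this is precisely when the variety on the right-hand side is irreducible and of dimension $4$.
   Context: All projective spaces are complex. A pinhole camera is a full-rank matrix $C\in\mathbb C^{3\times 4}$; its center is the point $c=\ker(C)\in\mathbb P^3$. Let $\mathbb G$ be the Grassmannian of lines in $\mathbb P^3$. A line in $\mathbb P^2$ is identified with its linear equation $\ell\in\mathbb P^2$: a point $x$ is on the line if and only if $x^T\ell=0$. For a line $L\subset\mathbb P^3$ through points $x,y$ and not through the center of $C$, $C\cdot L$ denotes the line in $\mathbb P^2$ through $Cx$ and $Cy$. The joint camera map is the rational map $\Upsilon_{\mathcal C}:\mathbb G\dashrightarrow(\mathbb P^2)^m$, $L\mapsto (C_1\cdot L,\dots,C_m\cdot L)$, defined at the lines that pass through no camera center $c_i=\ker(C_i)$; $\Upsilon_{\mathcal C}(\mathbb G)$ denotes its image. The line multiview variety is the Zariski closure $\mathcal L_{\mathcal C}:=\overline{\Upsilon_{\mathcal C}(\mathbb G)}\subseteq(\mathbb P^2)^m$. For $\ell=(\ell_1,\dots,\ell_m)\in(\mathbb P^2)^m$, $M(\ell)=\begin{bmatrix}C_1^T\ell_1&\cdots&C_m^T\ell_m\end{bmatrix}\in\mathbb C^{4\times m}$ (its rank does not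 depend on the choice of representatives of the $\ell_i$). *)

theory Defs
  imports "HOL-Analysis.Analysis" "HOL-Library.Poly_Mapping"
begin

text \<open>
  A point of the complex projective space of dimension \<open>CARD('n) - 1\<close> is a one-dimensional
  subspace of \<open>complex^'n\<close>. A point of a product of \<open>m\<close> projective spaces is a family of such
  points, indexed by a finite type \<open>'m\<close> with \<open>m = CARD('m)\<close>.
\<close>

definition proj_space :: "(complex^'n::finite) set set" where
  "proj_space = {V. vec.subspace V \<and> vec.dim V = 1}"

definition proj_product :: "('m::finite \<Rightarrow> (complex^'n::finite) set) set" where
  "proj_product = {l. \<forall>i. l i \<in> proj_space}"

definition rep :: "(complex^'n::finite) set \<Rightarrow> complex^'n" where
  "rep V = (SOME v. v \<in> V \<and> v \<noteq> 0)"

lemma rep_in_proj_space: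
  assumes "V \<in> proj_space"
  shows "rep V \<in> V" "rep V \<noteq> 0"
proof -
  have "\<exists>v. v \<in> V \<and> v \<noteq> 0"
  proof (rule ccontr)
    assume "\<not> ?thesis"
    then have "V \<subseteq> {0}" by auto
    then have "vec.dim V = 0" by (simp add: vec.dim_eq_0)
    with assms show False by (simp add: proj_space_def)
  qed
  from someI_ex[OF this] show "rep V \<in> V" "rep V \<noteq> 0"
    by (auto simp: rep_def)
qed

text \<open>
  Polynomials in the coordinates \<open>x\<^bsub>i,j\<^esub>\<close>, where \<open>i\<close> selects the factor and \<open>j\<close> the homogeneous
  coordinate in it, as finitely supported maps from exponent vectors to coefficients.
\<close>

type_synonym ('m, 'n) mpoly = "(('m \<times> 'n) \<Rightarrow>\<^sub>0 nat) \<Rightarrow>\<^sub>0 complex"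

definition mono_eval :: "(('m::finite \<times> 'n::finite) \<Rightarrow>\<^sub>0 nat) \<Rightarrow> ('m \<Rightarrow> complex^'n) \<Rightarrow> complex" where
  "mono_eval \<mu> x = (\<Prod>i\<in>UNIV. \<Prod>j\<in>UNIV. (x i $ j) ^ Poly_Mapping.lookup \<mu> (i, j))"

definition mpoly_eval :: "('m::finite, 'n::finite) mpoly \<Rightarrow> ('m \<Rightarrow> complex^'n) \<Rightarrow> complex" where
  "mpoly_eval p x = (\<Sum>\<mu>\<in>Poly_Mapping.keys p. Poly_Mapping.lookup p \<mu> * mono_eval \<mu> x)"

definition multihomogeneous :: "('m \<Rightarrow> nat) \<Rightarrow> ('m::finite, 'n::finite) mpoly \<Rightarrow> bool" where
  "multihomogeneous d p \<longleftrightarrow>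
     (\<forall>\<mu>\<in>Poly_Mapping.keys p. \<forall>i. (\<Sum>j\<in>UNIV. Poly_Mapping.lookup \<mu> (i, j)) = d i)"

text \<open>
  By the next lemma, the vanishing of a multihomogeneous polynomial does not depend on the representatives
  chosen in \<open>zero_locus\<close>.
\<close>

lemma mpoly_eval_scale:
  assumes "multihomogeneous d p"
  shows "mpoly_eval p (\<lambda>i. c i *s x i) = (\<Prod>i\<in>UNIV. c i ^ d i) * mpoly_eval p x"
proof -
  have "mono_eval \<mu> (\<lambda>i. c i *s x i) = (\<Prod>i\<in>UNIV. c i ^ d i) * mono_eval \<mu> x"
    if "\<mu> \<in> Poly_Mapping.keys p" for \<mu>
  proof -
    have "(\<Prod>i\<in>UNIV. c i ^ d i)
        = (\<Prod>i\<in>UNIV. \<Prod>j\<in>UNIV. c i ^ Poly_Mapping.lookup \<mu> (i, j))"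
      using assms that by (simp add: multihomogeneous_def flip: power_sum)
    then show ?thesis
      by (simp add: mono_eval_def power_mult_distrib prod.distrib)
  qed
  then show ?thesis
    by (simp add: mpoly_eval_def sum_distrib_left algebra_simps)
qed

definition zero_locus ::
    "('m::finite, 'n::finite) mpoly set \<Rightarrow> ('m \<Rightarrow> (complex^'n) set) set" where
  "zero_locus S = {l \<in> proj_product. \<forall>p\<in>S. mpoly_eval p (\<lambda>i. rep (l i)) = 0}"

definition zariski :: "('m::finite \<Rightarrow> (complex^'n::finite) set) topology" where
  "zariski = topology (\<lambda>U. \<exists>S. (\<forall>p\<in>S. \<exists>d. multihomogeneous d p) \<and> U = proj_product - zero_locus S)"

lemma mono_eval_add: "mono_eval (\<mu> + \<nu>) x = mono_eval \<mu> x * mono_eval \<nu> x"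
  by (simp add: mono_eval_def lookup_add power_add prod.distrib)

lemma mpoly_eval_superset:
  assumes "finite A" "Poly_Mapping.keys p \<subseteq> A"
  shows "mpoly_eval p x = (\<Sum>\<mu>\<in>A. Poly_Mapping.lookup p \<mu> * mono_eval \<mu> x)"
  unfolding mpoly_eval_def
  by (rule sum.mono_neutral_left) (use assms in \<open>auto simp: in_keys_iff\<close>)

lemma mpoly_eval_single [simp]:
  "mpoly_eval (Poly_Mapping.single \<mu> c) x = c * mono_eval \<mu> x"
  by (simp add: mpoly_eval_superset[of "{\<mu>}"])

lemma mpoly_eval_add: "mpoly_eval (p + q) x = mpoly_eval p x + mpoly_eval q x"
proof -
  let ?A = "Poly_Mapping.keys p \<union> Poly_Mapping.keys q"
  have "Poly_Mapping.keys (p + q) \<subseteq> ?A" by (rule keys_add)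
  then show ?thesis
    by (simp add: mpoly_eval_superset[of ?A] lookup_add distrib_right sum.distrib)
qed

lemma mpoly_eval_zero [simp]: "mpoly_eval 0 x = 0"
  by (simp add: mpoly_eval_def)

lemma mpoly_eval_sum: "mpoly_eval (sum f A) x = (\<Sum>a\<in>A. mpoly_eval (f a) x)"
  by (induction A rule: infinite_finite_induct) (auto simp: mpoly_eval_add)

lemma mpoly_sum_single:
  "p = (\<Sum>\<mu>\<in>Poly_Mapping.keys p. Poly_Mapping.single \<mu> (Poly_Mapping.lookup p \<mu>))"
  by (rule poly_mapping_eqI) (auto simp: lookup_sum lookup_single when_def in_keys_iff)

lemma mpoly_eval_mult: "mpoly_eval (p * q) x = mpoly_eval p x * mpoly_eval q x"
proof -
  have "p * q = (\<Sum>\<mu>\<in>Poly_Mapping.keys p. Poly_Mapping.single \<mu> (Poly_Mapping.lookup p \<mu>)) *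
                (\<Sum>\<nu>\<in>Poly_Mapping.keys q. Poly_Mapping.single \<nu> (Poly_Mapping.lookup q \<nu>))"
    using mpoly_sum_single[of p] mpoly_sum_single[of q] by metis
  also have "\<dots> = (\<Sum>\<mu>\<in>Poly_Mapping.keys p. \<Sum>\<nu>\<in>Poly_Mapping.keys q.
      Poly_Mapping.single (\<mu> + \<nu>) (Poly_Mapping.lookup p \<mu> * Poly_Mapping.lookup q \<nu>))"
    by (simp add: sum_product mult_single)
  finally have "mpoly_eval (p * q) x = (\<Sum>\<mu>\<in>Poly_Mapping.keys p. \<Sum>\<nu>\<in>Poly_Mapping.keys q.
      Poly_Mapping.lookup p \<mu> * Poly_Mapping.lookup q \<nu> * (mono_eval \<mu> x * mono_eval \<nu> x))"
    by (simp add: mpoly_eval_sum mono_eval_add)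
  also have "\<dots> = mpoly_eval p x * mpoly_eval q x"
    by (simp add: mpoly_eval_def sum_product ac_simps)
  finally show ?thesis .
qed

lemma multihomogeneous_mult:
  assumes "multihomogeneous d p" "multihomogeneous e q"
  shows "multihomogeneous (\<lambda>i. d i + e i) (p * q)"
  unfolding multihomogeneous_def
proof (intro ballI allI)
  fix \<mu> i assume "\<mu> \<in> Poly_Mapping.keys (p * q)"
  then obtain a b where "a \<in> Poly_Mapping.keys p" "b \<in> Poly_Mapping.keys q" "\<mu> = a + b"
    using keys_mult[of p q] by blast
  then show "(\<Sum>j\<in>UNIV. Poly_Mapping.lookup \<mu> (i, j)) = d i + e i"
    using assms by (simp add: multihomogeneous_def lookup_add sum.distrib)
qed

lemma zero_locus_Un:
  "zero_locus S \<union> zero_locus T = zero_locus {p * q |p q. p \<in> S \<and> q \<in> T}"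
proof (intro equalityI subsetI)
  fix l assume "l \<in> zero_locus S \<union> zero_locus T"
  then show "l \<in> zero_locus {p * q |p q. p \<in> S \<and> q \<in> T}"
    by (auto simp: zero_locus_def mpoly_eval_mult)
next
  fix l assume l: "l \<in> zero_locus {p * q |p q. p \<in> S \<and> q \<in> T}"
  show "l \<in> zero_locus S \<union> zero_locus T"
  proof (rule ccontr)
    assume "l \<notin> zero_locus S \<union> zero_locus T"
    with l obtain p q where "p \<in> S" "q \<in> T"
      "mpoly_eval p (\<lambda>i. rep (l i)) \<noteq> 0" "mpoly_eval q (\<lambda>i. rep (l i)) \<noteq> 0"
      by (auto simp: zero_locus_def)
    moreover from this l have "mpoly_eval (p * q) (\<lambda>i. rep (l i)) = 0"
      unfolding zero_locus_def by blast
    ultimately show False by (simp add: mpoly_eval_mult)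
  qed
qed

lemma istopology_zariski:
  "istopology (\<lambda>U. \<exists>S. (\<forall>p\<in>S. \<exists>d. multihomogeneous d p) \<and> U = proj_product - zero_locus S)"
    (is "istopology ?P")
  unfolding istopology_def
proof (intro conjI allI impI)
  fix U V assume "?P U" "?P V"
  then obtain S T where S: "\<forall>p\<in>S. \<exists>d. multihomogeneous d p" "U = proj_product - zero_locus S"
    and T: "\<forall>p\<in>T. \<exists>d. multihomogeneous d p" "V = proj_product - zero_locus T"
    by auto
  have "U \<inter> V = proj_product - zero_locus {p * q |p q. p \<in> S \<and> q \<in> T}"
    using S(2) T(2) by (auto simp flip: zero_locus_Un)
  moreover have "\<forall>r\<in>{p * q |p q. p \<in> S \<and> q \<in> T}. \<exists>d. multihomogeneous d r"
    using S(1) T(1) multihomogeneous_mult by blast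
  ultimately show "?P (U \<inter> V)" by blast
next
  fix K assume "\<forall>U\<in>K. ?P U"
  then obtain F where F: "\<And>U. U \<in> K \<Longrightarrow> (\<forall>p\<in>F U. \<exists>d. multihomogeneous d p)"
      "\<And>U. U \<in> K \<Longrightarrow> U = proj_product - zero_locus (F U)"
    by metis
  have "(\<Union>U\<in>K. U) = (\<Union>U\<in>K. proj_product - zero_locus (F U))"
    by (rule SUP_cong[OF refl F(2)])
  also have "\<dots> = proj_product - zero_locus (\<Union>U\<in>K. F U)"
    by (auto simp: zero_locus_def)
  finally have "\<Union>K = proj_product - zero_locus (\<Union>U\<in>K. F U)"
    by simp
  moreover have "\<forall>p\<in>(\<Union>U\<in>K. F U). \<exists>d. multihomogeneous d p"
    using F(1) by blast
  ultimately show "?P (\<Union>K)" by blast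
qed

lemma openin_zariski:
  "openin zariski U \<longleftrightarrow>
     (\<exists>S. (\<forall>p\<in>S. \<exists>d. multihomogeneous d p) \<and> U = proj_product - zero_locus S)"
  by (simp add: zariski_def topology_inverse'[OF istopology_zariski])

lemma topspace_zariski [simp]: "topspace zariski = proj_product"
proof -
  let ?P = "proj_product :: ('a::finite \<Rightarrow> (complex^'b::finite) set) set"
  have "multihomogeneous (\<lambda>_. 0) (1 :: ('a, 'b) mpoly)"
    by (simp add: multihomogeneous_def)
  moreover have "mpoly_eval 1 x = 1" for x :: "'a \<Rightarrow> complex^'b"
    using mpoly_eval_single[of 0 1 x] by (simp add: mono_eval_def)
  then have "?P = ?P - zero_locus {1}"
    by (auto simp: zero_locus_def)
  ultimately have "openin zariski ?P"
    unfolding openin_zariski by (intro exI[of _ "{1}"]) blast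
  then show "topspace zariski = ?P"
    by (auto simp: topspace_def openin_zariski)
qed

lemma closedin_zariski:
  "closedin zariski Z \<longleftrightarrow> (\<exists>S. (\<forall>p\<in>S. \<exists>d. multihomogeneous d p) \<and> Z = zero_locus S)"
proof -
  have "zero_locus S \<subseteq> proj_product" for S :: "('a, 'b) mpoly set"
    by (auto simp: zero_locus_def)
  then show ?thesis
    unfolding closedin_def openin_zariski topspace_zariski
    by (metis double_diff Diff_subset subset_refl)
qed

definition irreducible_space :: "'a topology \<Rightarrow> bool" where
  "irreducible_space T \<longleftrightarrow> topspace T \<noteq> {} \<and>
     (\<forall>A B. closedin T A \<and> closedin T B \<and> topspace T = A \<union> B \<longrightarrow> A = topspace T \<or> B = topspace T)"

text \<open>The length of a chain is its number of strict inclusions; the empty space gets dimension 0.\<close>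

definition krull_dim :: "'a topology \<Rightarrow> enat" where
  "krull_dim T = Sup {enat n |n. \<exists>Z :: nat \<Rightarrow> 'a set.
     (\<forall>i\<le>n. closedin T (Z i) \<and> irreducible_space (subtopology T (Z i))) \<and>
     (\<forall>i<n. Z i \<subset> Z (Suc i))}"

definition pinhole_camera :: "complex^4^3 \<Rightarrow> bool" where
  "pinhole_camera C \<longleftrightarrow> rank C = 3"

definition center :: "complex^4^3 \<Rightarrow> (complex^4) set" where
  "center C = {x. C *v x = 0}"

text \<open>The line in projective 3-space given by a two-dimensional subspace of \<open>complex^4\<close>.\<close>

definition grassmannian :: "(complex^4) set set" where
  "grassmannian = {L. vec.subspace L \<and> vec.dim L = 2}"

text \<open>
  The equation of the line in the projective plane whose points lie in \<open>W\<close>; the pairing is the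
  bilinear one, \<open>x\<^sup>T l\<close>.
\<close>

definition line_equation :: "(complex^3) set \<Rightarrow> (complex^3) set" where
  "line_equation W = {l. \<forall>x\<in>W. (\<Sum>j\<in>UNIV. x $ j * l $ j) = 0}"

text \<open>
  If \<open>L\<close> is spanned by \<open>x\<close> and \<open>y\<close>, then its image is spanned by \<open>C x\<close> and \<open>C y\<close>.
\<close>

definition camera_line :: "complex^4^3 \<Rightarrow> (complex^4) set \<Rightarrow> (complex^3) set" where
  "camera_line C L = line_equation ((\<lambda>x. C *v x) ` L)"

definition joint_camera_domain :: "('m::finite \<Rightarrow> complex^4^3) \<Rightarrow> (complex^4) set set" where
  "joint_camera_domain C = {L \<in> grassmannian. \<forall>i. \<not> center (C i) \<subseteq> L}"

definition joint_camera_map ::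
    "('m::finite \<Rightarrow> complex^4^3) \<Rightarrow> (complex^4) set \<Rightarrow> ('m \<Rightarrow> (complex^3) set)" where
  "joint_camera_map C L = (\<lambda>i. camera_line (C i) L)"

definition line_multiview_variety ::
    "('m::finite \<Rightarrow> complex^4^3) \<Rightarrow> ('m \<Rightarrow> (complex^3) set) set" where
  "line_multiview_variety C = zariski closure_of (joint_camera_map C ` joint_camera_domain C)"

text \<open>
  Another choice of representatives rescales the columns, which leaves the rank unchanged.
\<close>

definition multiview_matrix ::
    "('m::finite \<Rightarrow> complex^4^3) \<Rightarrow> ('m \<Rightarrow> (complex^3) set) \<Rightarrow> complex^'m^4" where
  "multiview_matrix C l = (\<chi> r i. (transpose (C i) *v rep (l i)) $ r)"

definition rank_locus ::
    "('m::finite \<Rightarrow> complex^4^3) \<Rightarrow> ('m \<Rightarrow> (complex^3) set) set" where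
  "rank_locus C = {l \<in> proj_product. rank (multiview_matrix C l) \<le> 2}"

definition no_four_collinear :: "('m::finite \<Rightarrow> complex^4^3) \<Rightarrow> bool" where
  "no_four_collinear C \<longleftrightarrow>
     \<not> (\<exists>I :: 'm set. card I = 4 \<and> (\<exists>L\<in>grassmannian. \<forall>i\<in>I. center (C i) \<subseteq> L))"

end

theory Submission
  imports Defs "HOL-Computational_Algebra.Polynomial" "HOL-Library.Function_Algebras"
begin

text \<open>
  Write \<open>Y\<close> for the line multiview variety and \<open>X\<close> for the rank locus. The point of the argument is
  that a family of image lines \<open>l i\<close> is the same thing as a family of back-projected planes
  \<open>h i\<close>, where \<open>h i\<close> (the vector \<open>transpose (C i) *v l i\<close>) contains the center \<open>c i\<close>, and that
  the rank of the matrix with columns \<open>h i\<close> is at most 2 exactly when all these planes contain a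
  common line \<open>L\<close>. If \<open>L\<close> misses all centers, then \<open>h i\<close> is the span of \<open>L\<close> and \<open>c i\<close>, so the
  point is the image of \<open>L\<close>. In particular \<open>Y\<close> is contained in \<open>X\<close>, because \<open>X\<close> is closed.

  If \<open>L\<close> contains some of the centers, the planes at these centers are arbitrary planes through
  \<open>L\<close>, and the question is which of them are limits. Let \<open>L\<close> be spanned by \<open>x\<close> and \<open>y\<close>, move it to
  the span of \<open>x + t u\<close> and \<open>y + t w\<close>, and let \<open>c i = \<alpha> i x + \<beta> i y\<close>. The plane spanned by \<open>c i\<close> and the
  moved line tends to the one spanned by \<open>L\<close> and \<open>\<alpha> i u + \<beta> i w\<close>. So the planes that appear in the
  limit at the centers on \<open>L\<close> are the values of one linear map, given by \<open>u\<close> and \<open>w\<close>, at the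
  points \<open>(\<alpha> i, \<beta> i)\<close> of a projective line. A projective transformation of a line can be prescribed at three
  points, but not at four, and this is where the condition on the cameras comes from. The
  prescribed values have to be distinct; families in which some of the planes coincide are
  reached by a second limit. These are lemmas \<open>interpolate_directions\<close>, \<open>first_order_limit\<close> and
  \<open>rank_locus_subset_variety\<close>.

  The variety \<open>Y\<close> is always irreducible of dimension 4. It is the closure of the image of a
  polynomial map on an affine space, so it is irreducible. For the upper bound, a chain of irreducible
  closed sets of length \<open>n\<close> yields \<open>(N + 1) ^ n\<close> forms of degree proportional to \<open>N\<close> that are
  linearly independent on the top member: if \<open>f\<close> vanishes on one member of the chain but not on the
  next, then a relation between products of powers of \<open>f\<close> with forms that are independent on the
  smaller set can be divided by \<open>f\<close>. Pulled back along a
  parametrization by 4 parameters, these forms lie in a space whose dimension is bounded by a multiple of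
  \<open>N ^ 4\<close>, so \<open>n \<le> 4\<close>. The lower bound is an explicit chain of families of lines.

  If four centers lie on a line \<open>L\<close>, then \<open>X\<close> contains all families of planes through \<open>L\<close> and
  the respective centers, in particular a product of four projective lines, which has a chain of length 4. The image of a
  line skew to \<open>L\<close> shows that this product is not all of \<open>X\<close>. Hence, if \<open>X\<close> is irreducible, its
  dimension is at least 5. This rules out \<open>X = Y\<close> too, because \<open>Y\<close> is irreducible of dimension 4.
\<close>

section \<open>Multihomogeneous forms and the Zariski topology\<close>

text \<open>
  Closure properties are easier to state for the polynomial functions than for the
  polynomials.
\<close>

definition form :: "('m \<Rightarrow> nat) \<Rightarrow> (('m::finite \<Rightarrow> complex^'n::finite) \<Rightarrow> complex) \<Rightarrow> bool" where
  "form d F \<longleftrightarrow> (\<exists>p. multihomogeneous d p \<and> F = mpoly_eval p)"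

definition reps :: "('m \<Rightarrow> (complex^'n::finite) set) \<Rightarrow> 'm \<Rightarrow> complex^'n" where
  "reps l = (\<lambda>i. rep (l i))"

definition vanishes_on ::
    "(('m \<Rightarrow> complex^'n::finite) \<Rightarrow> complex) \<Rightarrow> ('m \<Rightarrow> (complex^'n) set) set \<Rightarrow> bool" where
  "vanishes_on F Z \<longleftrightarrow> (\<forall>z\<in>Z. F (reps z) = 0)"

lemma form_zero: "form d (\<lambda>_. 0)"
  unfolding form_def multihomogeneous_def
  by (rule exI[of _ 0]) (simp add: fun_eq_iff)

lemma form_add: "form d F \<Longrightarrow> form d G \<Longrightarrow> form d (\<lambda>x. F x + G x)"
proof -
  assume "form d F" "form d G"
  then obtain p q where "multihomogeneous d p" "F = mpoly_eval p"
      "multihomogeneous d q" "G = mpoly_eval q"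
    by (auto simp: form_def)
  moreover from this have "multihomogeneous d (p + q)"
    using keys_add[of p q] unfolding multihomogeneous_def by blast
  ultimately show ?thesis
    unfolding form_def by (auto simp: mpoly_eval_add intro!: exI[of _ "p + q"])
qed

lemma form_mult: "form d F \<Longrightarrow> form e G \<Longrightarrow> form (\<lambda>i. d i + e i) (\<lambda>x. F x * G x)"
proof -
  assume "form d F" "form e G"
  then obtain p q where "multihomogeneous d p" "F = mpoly_eval p"
      "multihomogeneous e q" "G = mpoly_eval q"
    by (auto simp: form_def)
  then show ?thesis
    unfolding form_def
    by (intro exI[of _ "p * q"]) (auto simp: mpoly_eval_mult multihomogeneous_mult)
qed

lemma form_const: "form (\<lambda>_. 0) (\<lambda>_. c)"
  unfolding form_def multihomogeneous_def
  by (rule exI[of _ "Poly_Mapping.single 0 c"]) (simp add: fun_eq_iff mono_eval_def)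

lemma form_scale: "form d F \<Longrightarrow> form d (\<lambda>x. c * F x)"
  using form_mult[OF form_const, of d F c] by simp

lemma form_diff: "form d F \<Longrightarrow> form d G \<Longrightarrow> form d (\<lambda>x. F x - G x)"
  using form_add[OF _ form_scale[of d G "-1"], of F] by simp

lemma form_sum: "(\<And>a. a \<in> A \<Longrightarrow> form d (F a)) \<Longrightarrow> form d (\<lambda>x. \<Sum>a\<in>A. F a x)"
  by (induction A rule: infinite_finite_induct) (auto simp: form_zero intro: form_add)

lemma form_prod: "(\<And>a. a \<in> A \<Longrightarrow> form (d a) (F a)) \<Longrightarrow>
    form (\<lambda>i. \<Sum>a\<in>A. d a i) (\<lambda>x. \<Prod>a\<in>A. F a x)"
  by (induction A rule: infinite_finite_induct) (auto simp: form_const intro: form_mult)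

lemma form_power: "form d F \<Longrightarrow> form (\<lambda>i. n * d i) (\<lambda>x. F x ^ n)"
  using form_prod[of "{..<n}" "\<lambda>_. d" "\<lambda>_. F"] by simp

lemma form_coord: "form (\<lambda>k. if k = i then 1 else 0) (\<lambda>x. x i $ j)"
proof -
  let ?e = "Poly_Mapping.single (i, j) (1::nat)"
  have "mono_eval ?e x = x i $ j" for x
  proof -
    have "mono_eval ?e x = (\<Prod>a\<in>UNIV. \<Prod>b\<in>UNIV. if a = i \<and> b = j then x i $ j else 1)"
      unfolding mono_eval_def by (intro prod.cong refl) (auto simp: lookup_single when_def)
    also have "\<dots> = (\<Prod>a\<in>UNIV. if a = i then x i $ j else 1)"
      by (intro prod.cong refl) auto
    finally show ?thesis by simp
  qed
  moreover have "multihomogeneous (\<lambda>k. if k = i then 1 else 0) (Poly_Mapping.single ?e (1::complex))"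
    unfolding multihomogeneous_def by (auto simp: lookup_single when_def)
  ultimately show ?thesis
    unfolding form_def
    by (intro exI[of _ "Poly_Mapping.single ?e (1::complex)"]) (simp add: fun_eq_iff)
qed

lemma form_linear: "form (\<lambda>k. if k = i then 1 else 0) (\<lambda>x. \<Sum>j\<in>UNIV. a $ j * x i $ j)"
  by (intro form_sum form_scale form_coord)

lemma form_eq_0_scale:
  assumes "form d F" "\<And>i. c i \<noteq> 0"
  shows "F (\<lambda>i. c i *s x i) = 0 \<longleftrightarrow> F x = 0"
proof -
  obtain p where p: "multihomogeneous d p" "F = mpoly_eval p"
    using assms(1) by (auto simp: form_def)
  show ?thesis
    unfolding p(2) mpoly_eval_scale[OF p(1)] using assms(2) by simp
qed

text \<open>
  The point with homogeneous coordinates \<open>v\<close>; it is a point of the product of projective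
  spaces only if no \<open>v i\<close> is zero.
\<close>

definition pt :: "('m \<Rightarrow> complex^'n::finite) \<Rightarrow> 'm \<Rightarrow> (complex^'n) set" where
  "pt v = (\<lambda>i. vec.span {v i})"

lemma proj_space_span: "v \<noteq> 0 \<Longrightarrow> vec.span {v} \<in> proj_space"
  by (simp add: proj_space_def)

lemma pt_in_proj_product: "(\<And>i. v i \<noteq> 0) \<Longrightarrow> pt v \<in> proj_product"
  by (simp add: proj_product_def pt_def proj_space_span)

lemma proj_space_eq_span:
  assumes "V \<in> proj_space" "v \<in> V" "v \<noteq> 0"
  shows "V = vec.span {v}"
proof -
  have "vec.span {v} \<subseteq> V"
    using assms by (intro vec.span_minimal) (auto simp: proj_space_def)
  moreover have "vec.dim V \<le> vec.dim (vec.span {v})"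
    using assms by (simp add: proj_space_def)
  ultimately show ?thesis
    using assms(1) vec.subspace_dim_equal[of "vec.span {v}" V]
    by (auto simp: proj_space_def)
qed

lemma pt_reps:
  assumes "l \<in> proj_product"
  shows "pt (reps l) = l" "reps l i \<noteq> 0"
proof -
  have l: "l i \<in> proj_space" for i using assms by (simp add: proj_product_def)
  show "reps l i \<noteq> 0"
    unfolding reps_def by (rule rep_in_proj_space(2)[OF l])
  have "vec.span {rep (l i)} = l i" for i
    using proj_space_eq_span[OF l rep_in_proj_space[OF l]] by simp
  then show "pt (reps l) = l"
    unfolding pt_def reps_def by presburger
qed

lemma reps_pt:
  assumes "\<And>i. v i \<noteq> 0"
  obtains c where "\<And>i. c i \<noteq> 0" "reps (pt v) = (\<lambda>i. c i *s v i)"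
proof -
  have "\<exists>c. c \<noteq> 0 \<and> reps (pt v) i = c *s v i" for i
  proof -
    have "vec.span {v i} \<in> proj_space" using assms by (rule proj_space_span)
    from rep_in_proj_space[OF this] show ?thesis
      unfolding reps_def pt_def vec.span_singleton by auto
  qed
  then obtain c where "\<And>i. c i \<noteq> 0 \<and> reps (pt v) i = c i *s v i" by metis
  then show ?thesis by (intro that[of c]) auto
qed

text \<open>
  A vanishing statement about the chosen representatives of a point may be checked on any
  other homogeneous coordinates.
\<close>

lemma form_reps_pt:
  assumes "form d F" "\<And>i. v i \<noteq> 0"
  shows "F (reps (pt v)) = 0 \<longleftrightarrow> F v = 0"
proof -
  obtain c where c: "\<And>i. c i \<noteq> 0" "reps (pt v) = (\<lambda>i. c i *s v i)"
    using reps_pt[of v] assms(2) by blast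
  show ?thesis
    unfolding c(2) using form_eq_0_scale[OF assms(1), of c v] c(1) by simp
qed

lemma pt_scale:
  assumes "\<And>i. c i \<noteq> 0"
  shows "pt (\<lambda>i. c i *s v i) = pt v"
proof -
  have "vec.span {c i *s v i} = vec.span {v i}" for i
    using vec.span_image_scale[of "{v i}" "\<lambda>_. c i"] assms by simp
  then show ?thesis by (simp add: pt_def)
qed

lemma pt_eqI:
  assumes "\<And>i. \<exists>c. c \<noteq> 0 \<and> w i = c *s v i"
  shows "pt w = pt v"
proof -
  obtain c where "\<And>i. c i \<noteq> 0 \<and> w i = c i *s v i" using assms by metis
  moreover from this have "w = (\<lambda>i. c i *s v i)" by auto
  ultimately show ?thesis using pt_scale[of c v] by simp
qed

lemma closedin_zariski_forms:
  "closedin zariski Z \<longleftrightarrow>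
    (\<exists>S. (\<forall>F\<in>S. \<exists>d. form d F) \<and> Z = {l \<in> proj_product. \<forall>F\<in>S. F (reps l) = 0})"
proof
  assume "closedin zariski Z"
  then obtain S where S: "\<forall>p\<in>S. \<exists>d. multihomogeneous d p" "Z = zero_locus S"
    by (auto simp: closedin_zariski)
  then show "\<exists>S. (\<forall>F\<in>S. \<exists>d. form d F) \<and> Z = {l \<in> proj_product. \<forall>F\<in>S. F (reps l) = 0}"
    by (intro exI[of _ "mpoly_eval ` S"]) (fastforce simp: form_def zero_locus_def reps_def)
next
  assume "\<exists>S. (\<forall>F\<in>S. \<exists>d. form d F) \<and> Z = {l \<in> proj_product. \<forall>F\<in>S. F (reps l) = 0}"
  then obtain S where S: "\<forall>F\<in>S. \<exists>d. form d F" "Z = {l \<in> proj_product. \<forall>F\<in>S. F (reps l) = 0}"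
    by blast
  have "\<forall>F\<in>S. \<exists>p. (\<exists>d. multihomogeneous d p) \<and> F = mpoly_eval p"
    using S(1) unfolding form_def by blast
  then obtain P where "\<forall>F\<in>S. (\<exists>d. multihomogeneous d (P F)) \<and> F = mpoly_eval (P F)"
    by metis
  then show "closedin zariski Z"
    unfolding closedin_zariski S(2)
    by (intro exI[of _ "P ` S"]) (auto simp: zero_locus_def reps_def)
qed

lemma closedin_vanishing:
  assumes "form d F"
  shows "closedin zariski {l \<in> proj_product. F (reps l) = 0}"
  unfolding closedin_zariski_forms using assms by (intro exI[of _ "{F}"]) auto

lemma in_zariski_closure:
  assumes "S \<subseteq> proj_product"
  shows "z \<in> zariski closure_of S \<longleftrightarrow>
    z \<in> proj_product \<and> (\<forall>d F. form d F \<longrightarrow> vanishes_on F S \<longrightarrow> F (reps z) = 0)"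
proof (intro iffI conjI allI impI)
  assume z: "z \<in> zariski closure_of S"
  then show "z \<in> proj_product"
    using closure_of_subset_topspace[of zariski S] by auto
  fix d F assume F: "form d F" "vanishes_on F S"
  have "zariski closure_of S \<subseteq> {l \<in> proj_product. F (reps l) = 0}"
    using closedin_vanishing[OF F(1)] F(2) assms
    by (intro closure_of_minimal) (auto simp: vanishes_on_def)
  then show "F (reps z) = 0" using z by auto
next
  assume z: "z \<in> proj_product \<and> (\<forall>d F. form d F \<longrightarrow> vanishes_on F S \<longrightarrow> F (reps z) = 0)"
  obtain T where T: "\<forall>F\<in>T. \<exists>d. form d F"
      "zariski closure_of S = {l \<in> proj_product. \<forall>F\<in>T. F (reps l) = 0}"
    using closedin_closure_of[of zariski S] unfolding closedin_zariski_forms by blast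
  have "S \<subseteq> zariski closure_of S" using assms by (simp add: closure_of_subset)
  then have "vanishes_on F S" if "F \<in> T" for F
    using that T(2) by (auto simp: vanishes_on_def)
  then show "z \<in> zariski closure_of S"
    using z T by auto
qed

lemma vanishes_on_closure:
  assumes "S \<subseteq> proj_product" "form d F" "vanishes_on F S"
  shows "vanishes_on F (zariski closure_of S)"
  using assms by (auto simp: vanishes_on_def in_zariski_closure)

lemma separating_form:
  assumes "closedin (subtopology zariski X) A" "z \<in> X" "X \<subseteq> proj_product" "z \<notin> A"
  obtains d F where "form d F" "vanishes_on F A" "F (reps z) \<noteq> 0"
proof -
  obtain C where C: "closedin zariski C" "A = C \<inter> X"
    using assms(1) unfolding closedin_subtopology by blast
  then obtain S where S: "\<forall>F\<in>S. \<exists>d. form d F" "C = {l \<in> proj_product. \<forall>F\<in>S. F (reps l) = 0}"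
    unfolding closedin_zariski_forms by blast
  then obtain F where "F \<in> S" "F (reps z) \<noteq> 0" using assms C by blast
  moreover have "vanishes_on F A"
    using \<open>F \<in> S\<close> C(2) S(2) by (simp add: vanishes_on_def)
  ultimately show ?thesis using S(1) that by blast
qed

text \<open>
  Irreducibility is primality of the ideal of forms that vanish on the set. If two proper
  closed subsets cover the set, then each of them has a form that vanishes on it, but not on
  the whole set, and the product of the two forms vanishes everywhere.
\<close>

lemma irreducible_forms:
  assumes "Z \<subseteq> proj_product"
  shows "irreducible_space (subtopology zariski Z) \<longleftrightarrow> Z \<noteq> {} \<and>
    (\<forall>d e F G. form d F \<longrightarrow> form e G \<longrightarrow> vanishes_on (\<lambda>x. F x * G x) Z \<longrightarrow>
       vanishes_on F Z \<or> vanishes_on G Z)"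
    (is "?L \<longleftrightarrow> ?R")
proof
  have top: "topspace (subtopology zariski Z) = Z" using assms by auto
  {
    assume L: ?L
    show ?R
    proof (intro conjI allI impI)
      show "Z \<noteq> {}" using L top by (simp add: irreducible_space_def)
      fix d e F G assume FG: "form d F" "form e G" "vanishes_on (\<lambda>x. F x * G x) Z"
      define A where "A = (\<lambda>F :: ('a \<Rightarrow> complex^'b) \<Rightarrow> complex. {l \<in> Z. F (reps l) = 0})"
      have closed: "closedin (subtopology zariski Z) (A F)" if "form d F" for d F
      proof -
        have "A F = Z \<inter> {l \<in> proj_product. F (reps l) = 0}" using assms by (auto simp: A_def)
        then show ?thesis
          using closedin_subtopology_Int_closed[OF closedin_vanishing[OF that], of Z] by simp
      qed
      moreover have "Z = A F \<union> A G" using FG(3) by (auto simp: A_def vanishes_on_def)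
      moreover have "C = Z \<or> D = Z" if "closedin (subtopology zariski Z) C"
          "closedin (subtopology zariski Z) D" "Z = C \<union> D" for C D
        using L that unfolding irreducible_space_def top by simp
      ultimately have "A F = Z \<or> A G = Z"
        using FG(1,2) by metis
      then show "vanishes_on F Z \<or> vanishes_on G Z"
        by (auto simp: A_def vanishes_on_def)
    qed
  }
  assume R: ?R
  show ?L
    unfolding irreducible_space_def top
  proof (intro conjI allI impI)
    show "Z \<noteq> {}" using R by blast
    fix A B assume AB: "closedin (subtopology zariski Z) A \<and> closedin (subtopology zariski Z) B \<and> Z = A \<union> B"
    have sep: "\<exists>d F. form d F \<and> vanishes_on F A \<and> \<not> vanishes_on F Z"
      if A: "closedin (subtopology zariski Z) A" "A \<noteq> Z" for A
    proof -
      have "A \<subseteq> Z" using closedin_subset[OF A(1)] top by simp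
      then obtain z where "z \<in> Z" "z \<notin> A" using A(2) by blast
      with separating_form[OF A(1) _ assms] show ?thesis
        unfolding vanishes_on_def by metis
    qed
    show "A = Z \<or> B = Z"
    proof (rule ccontr)
      assume "\<not> (A = Z \<or> B = Z)"
      then obtain d e F G where "form d F" "vanishes_on F A" "\<not> vanishes_on F Z"
          "form e G" "vanishes_on G B" "\<not> vanishes_on G Z"
        using sep AB by meson
      moreover from this have "vanishes_on (\<lambda>x. F x * G x) Z"
        using AB by (auto simp: vanishes_on_def)
      ultimately show False using R by blast
    qed
  qed
qed

section \<open>Irreducibility of parametrized closed sets\<close>

text \<open>
  This weak notion of a polynomial function is closed under ring operations, and it suffices
  for what follows: if \<open>f\<close> is not zero at \<open>a\<close> and \<open>g\<close> is not zero at \<open>b\<close>, then on the line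
  through \<open>a\<close> and \<open>b\<close> both are nonzero univariate polynomials, so their product is not zero
  somewhere on it.
\<close>

definition polynomial_on_lines :: "(('i \<Rightarrow> complex^'k::finite) \<Rightarrow> complex) \<Rightarrow> bool" where
  "polynomial_on_lines f \<longleftrightarrow> (\<forall>a b. \<exists>p. \<forall>s. f (\<lambda>i. a i + s *s b i) = poly p s)"

lemma pol_const: "polynomial_on_lines (\<lambda>_. c)"
  unfolding polynomial_on_lines_def by (intro allI exI[of _ "[:c:]"]) simp

lemma pol_coord: "polynomial_on_lines (\<lambda>t. t i $ j)"
  unfolding polynomial_on_lines_def
proof (intro allI)
  fix a b :: "'a \<Rightarrow> complex^'b"
  show "\<exists>p. \<forall>s. (a i + s *s b i) $ j = poly p s"
    by (intro exI[of _ "[:a i $ j, b i $ j:]"]) simp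
qed

lemma pol_add:
  assumes "polynomial_on_lines f" "polynomial_on_lines g"
  shows "polynomial_on_lines (\<lambda>t. f t + g t)"
  unfolding polynomial_on_lines_def
proof (intro allI)
  fix a b
  obtain p q where "\<forall>s. f (\<lambda>i. a i + s *s b i) = poly p s" "\<forall>s. g (\<lambda>i. a i + s *s b i) = poly q s"
    using assms unfolding polynomial_on_lines_def by meson
  then show "\<exists>p. \<forall>s. f (\<lambda>i. a i + s *s b i) + g (\<lambda>i. a i + s *s b i) = poly p s"
    by (intro exI[of _ "p + q"]) simp
qed

lemma pol_mult:
  assumes "polynomial_on_lines f" "polynomial_on_lines g"
  shows "polynomial_on_lines (\<lambda>t. f t * g t)"
  unfolding polynomial_on_lines_def
proof (intro allI)
  fix a b
  obtain p q where "\<forall>s. f (\<lambda>i. a i + s *s b i) = poly p s" "\<forall>s. g (\<lambda>i. a i + s *s b i) = poly q s"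
    using assms unfolding polynomial_on_lines_def by meson
  then show "\<exists>p. \<forall>s. f (\<lambda>i. a i + s *s b i) * g (\<lambda>i. a i + s *s b i) = poly p s"
    by (intro exI[of _ "p * q"]) simp
qed

lemma pol_diff:
  assumes "polynomial_on_lines f" "polynomial_on_lines g"
  shows "polynomial_on_lines (\<lambda>t. f t - g t)"
  using pol_add[OF assms(1) pol_mult[OF pol_const[of "-1"] assms(2)]] by simp

lemma pol_sum: "(\<And>a. a \<in> A \<Longrightarrow> polynomial_on_lines (f a)) \<Longrightarrow> polynomial_on_lines (\<lambda>t. \<Sum>a\<in>A. f a t)"
  by (induction A rule: infinite_finite_induct) (auto simp: pol_const intro: pol_add)

lemma pol_prod: "(\<And>a. a \<in> A \<Longrightarrow> polynomial_on_lines (f a)) \<Longrightarrow> polynomial_on_lines (\<lambda>t. \<Prod>a\<in>A. f a t)"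
  by (induction A rule: infinite_finite_induct) (auto simp: pol_const intro: pol_mult)

lemma pol_power: "polynomial_on_lines f \<Longrightarrow> polynomial_on_lines (\<lambda>t. f t ^ n)"
  using pol_prod[of "{..<n}" "\<lambda>_. f"] by simp

lemma pol_form:
  assumes "form d F" "\<And>i j. polynomial_on_lines (\<lambda>t. \<psi> t i $ j)"
  shows "polynomial_on_lines (\<lambda>t. F (\<psi> t))"
proof -
  obtain p where "F = mpoly_eval p" using assms(1) by (auto simp: form_def)
  then show ?thesis
    unfolding mpoly_eval_def mono_eval_def
    by (auto intro!: pol_sum pol_mult pol_const pol_prod pol_power assms(2))
qed

definition affine_closed :: "('i \<Rightarrow> complex^'k::finite) set \<Rightarrow> bool" where
  "affine_closed T \<longleftrightarrow> (\<forall>a\<in>T. \<forall>b\<in>T. \<forall>s. (\<lambda>i. a i + s *s (b i - a i)) \<in> T)"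

lemma pol_common_nonzero2:
  assumes "affine_closed T" "polynomial_on_lines f" "polynomial_on_lines g"
    "a \<in> T" "f a \<noteq> 0" "b \<in> T" "g b \<noteq> 0"
  obtains t where "t \<in> T" "f t \<noteq> 0" "g t \<noteq> 0"
proof -
  let ?l = "\<lambda>s i. a i + s *s (b i - a i)"
  obtain p q where pq: "\<forall>s. f (?l s) = poly p s" "\<forall>s. g (?l s) = poly q s"
    using assms(2,3)[unfolded polynomial_on_lines_def, THEN spec[of _ a], THEN spec[of _ "\<lambda>i. b i - a i"]]
    by blast
  have "poly p 0 \<noteq> 0" "poly q 1 \<noteq> 0"
    using assms(5,7) pq[THEN spec, of 0] pq[THEN spec, of 1] by simp_all
  then have "p * q \<noteq> 0" by auto
  then have "finite {s. poly (p * q) s = 0}" by (rule poly_roots_finite)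
  then obtain s where "poly (p * q) s \<noteq> 0"
    using ex_new_if_finite[OF infinite_UNIV_char_0] by blast
  then show ?thesis
    using that[of "?l s"] pq assms(1,4,6) by (auto simp: affine_closed_def)
qed

lemma pol_common_nonzero:
  assumes "finite A" "affine_closed T" "T \<noteq> {}"
    "\<And>a. a \<in> A \<Longrightarrow> polynomial_on_lines (f a)" "\<And>a. a \<in> A \<Longrightarrow> \<exists>t\<in>T. f a t \<noteq> 0"
  obtains t where "t \<in> T" "\<And>a. a \<in> A \<Longrightarrow> f a t \<noteq> 0"
proof -
  have "\<exists>t\<in>T. (\<Prod>a\<in>A. f a t) \<noteq> 0"
    using assms(1,4,5)
  proof (induction A rule: finite_induct)
    case empty
    then show ?case using assms(3) by auto
  next
    case (insert x F)
    have "\<exists>t\<in>T. f x t \<noteq> 0" "\<exists>u\<in>T. (\<Prod>a\<in>F. f a u) \<noteq> 0"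
      using insert.prems insert.IH by blast+
    then obtain t u where tu: "t \<in> T" "f x t \<noteq> 0" "u \<in> T" "(\<Prod>a\<in>F. f a u) \<noteq> 0" by blast
    have "polynomial_on_lines (f x)" "polynomial_on_lines (\<lambda>t. \<Prod>a\<in>F. f a t)"
      using insert.prems(1) by (auto intro: pol_prod)
    from pol_common_nonzero2[OF assms(2) this tu]
    show ?case using insert.hyps by (metis mult_eq_0_iff prod.insert)
  qed
  then show ?thesis using that assms(1) by (metis prod_zero)
qed

text \<open>
  The parameters at which some coordinate vector vanishes do not define a point and are left
  out.
\<close>

definition param_set ::
    "(('i \<Rightarrow> complex^'k::finite) \<Rightarrow> 'm \<Rightarrow> complex^'n::finite) \<Rightarrow> ('i \<Rightarrow> complex^'k) set
      \<Rightarrow> ('m \<Rightarrow> (complex^'n) set) set" where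
  "param_set \<psi> T = pt ` {\<psi> t |t. t \<in> T \<and> (\<forall>i. \<psi> t i \<noteq> 0)}"

lemma param_set_proj: "param_set \<psi> T \<subseteq> proj_product"
  by (auto simp: param_set_def intro: pt_in_proj_product)

lemma param_set_mono: "S \<subseteq> T \<Longrightarrow> param_set \<psi> S \<subseteq> param_set \<psi> T"
  unfolding param_set_def by blast

lemma vanishes_on_param_set:
  assumes "form d F"
  shows "vanishes_on F (param_set \<psi> T) \<longleftrightarrow> (\<forall>t\<in>T. (\<forall>i. \<psi> t i \<noteq> 0) \<longrightarrow> F (\<psi> t) = 0)"
  unfolding vanishes_on_def param_set_def using form_reps_pt[OF assms] by fastforce

lemma nonzero_coordinates:
  assumes "\<And>i. v i \<noteq> 0"
  obtains J where "\<And>i. v i $ J i \<noteq> 0"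
proof -
  have "\<forall>i. \<exists>j. v i $ j \<noteq> 0" using assms by (simp add: vec_eq_iff)
  then obtain J where "\<forall>i. v i $ J i \<noteq> 0" by (rule choice[THEN exE])
  then show ?thesis using that by blast
qed

text \<open>
  A polynomial function that vanishes wherever the parametrization is defined and a further
  nonzero polynomial does not vanish is zero everywhere, by density of the complement of a
  hypersurface.
\<close>

lemma vanishes_on_generic:
  fixes \<psi> :: "('i \<Rightarrow> complex^'k::finite) \<Rightarrow> 'm::finite \<Rightarrow> complex^'n::finite"
  assumes "affine_closed T" "\<And>i j. polynomial_on_lines (\<lambda>t. \<psi> t i $ j)"
    "t0 \<in> T" "\<And>i. \<psi> t0 i \<noteq> 0" "polynomial_on_lines f" "t1 \<in> T" "f t1 \<noteq> 0"
    "polynomial_on_lines g" "\<And>t. t \<in> T \<Longrightarrow> (\<And>i. \<psi> t i \<noteq> 0) \<Longrightarrow> f t \<noteq> 0 \<Longrightarrow> g t = 0"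
    "t \<in> T"
  shows "g t = 0"
proof (rule ccontr)
  assume gt: "g t \<noteq> 0"
  obtain J where J: "\<And>i. \<psi> t0 i $ J i \<noteq> 0"
    using nonzero_coordinates[of "\<psi> t0"] assms(4) by blast
  define h where "h = (\<lambda>a :: 'm option option. case a of None \<Rightarrow> f | Some None \<Rightarrow> g
      | Some (Some i) \<Rightarrow> (\<lambda>t. \<psi> t i $ J i))"
  have "\<exists>t\<in>T. \<psi> t i $ J i \<noteq> 0" for i using J assms(3) by blast
  then have "\<exists>t\<in>T. h a t \<noteq> 0" for a
    using assms(6,7,10) gt unfolding h_def by (auto split: option.split)
  moreover have "polynomial_on_lines (h a)" for a
    using assms by (auto simp: h_def split: option.split)
  ultimately obtain u where u: "u \<in> T" "\<And>a. h a u \<noteq> 0"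
    using pol_common_nonzero[of UNIV T h] assms(1,3) by auto
  have "\<psi> u i \<noteq> 0" for i using u(2)[of "Some (Some i)"] by (auto simp: h_def)
  moreover have "f u \<noteq> 0" "g u \<noteq> 0"
    using u(2)[of None] u(2)[of "Some None"] by (auto simp: h_def)
  ultimately show False using assms(9) u(1) by blast
qed

lemma common_nonvanishing:
  fixes \<psi> :: "('i \<Rightarrow> complex^'k::finite) \<Rightarrow> 'm::finite \<Rightarrow> complex^'n::finite"
  assumes "affine_closed T" "\<And>i j. polynomial_on_lines (\<lambda>t. \<psi> t i $ j)"
    "\<And>i. \<exists>t\<in>T. \<psi> t i \<noteq> 0" "polynomial_on_lines f" "u \<in> T" "f u \<noteq> 0"
  shows "\<exists>t\<in>T. (\<forall>i. \<psi> t i \<noteq> 0) \<and> f t \<noteq> 0"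
proof -
  define s where "s = (\<lambda>i. SOME t. t \<in> T \<and> \<psi> t i \<noteq> 0)"
  have s: "s i \<in> T \<and> \<psi> (s i) i \<noteq> 0" for i
    using someI_ex[of "\<lambda>t. t \<in> T \<and> \<psi> t i \<noteq> 0"] assms(3)[of i] unfolding s_def by blast
  then obtain J where J: "\<And>i. \<psi> (s i) i $ J i \<noteq> 0"
    using nonzero_coordinates[of "\<lambda>i. \<psi> (s i) i"] by blast
  define h where "h = (\<lambda>a :: 'm option. case a of None \<Rightarrow> f | Some i \<Rightarrow> (\<lambda>t. \<psi> t i $ J i))"
  have "\<exists>t\<in>T. \<psi> t i $ J i \<noteq> 0" for i using J[of i] s[of i] by blast
  then have "\<exists>t\<in>T. h a t \<noteq> 0" for a
    using assms(5,6) by (cases a) (auto simp: h_def)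
  moreover have "polynomial_on_lines (h a)" for a
    using assms(2,4) by (cases a) (simp_all add: h_def)
  ultimately obtain t where t: "t \<in> T" "\<And>a. h a t \<noteq> 0"
    using pol_common_nonzero[of UNIV T h] assms(1,5) by auto
  have "\<psi> t i \<noteq> 0" for i using t(2)[of "Some i"] by (auto simp: h_def)
  moreover have "f t \<noteq> 0" using t(2)[of None] by (simp add: h_def)
  ultimately show ?thesis using t(1) by blast
qed

text \<open>
  If a product of two forms vanishes on the image, then so does the product of the pulled back
  polynomials on the parameter space, and one of the two factors is zero there.
\<close>

lemma irreducible_param_closure:
  fixes \<psi> :: "('i \<Rightarrow> complex^'k::finite) \<Rightarrow> 'm::finite \<Rightarrow> complex^'n::finite"
  assumes T: "affine_closed T" and \<psi>: "\<And>i j. polynomial_on_lines (\<lambda>t. \<psi> t i $ j)"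
    and t0: "t0 \<in> T" "\<And>i. \<psi> t0 i \<noteq> 0"
  shows "irreducible_space (subtopology zariski (zariski closure_of (param_set \<psi> T)))"
proof -
  let ?P = "param_set \<psi> T" and ?Z = "zariski closure_of (param_set \<psi> T)"
  have sub: "?P \<subseteq> ?Z" by (simp add: closure_of_subset param_set_proj)
  have "pt (\<psi> t0) \<in> ?P" using t0 by (auto simp: param_set_def)
  moreover have "vanishes_on F ?Z \<or> vanishes_on G ?Z"
    if F: "form d F" and G: "form e G" and FG: "vanishes_on (\<lambda>x. F x * G x) ?Z" for d e F G
  proof (rule disjCI)
    assume "\<not> vanishes_on G ?Z"
    then have "\<not> vanishes_on G ?P" using vanishes_on_closure[OF param_set_proj G] by blast
    then obtain t1 where t1: "t1 \<in> T" "\<And>i. \<psi> t1 i \<noteq> 0" "G (\<psi> t1) \<noteq> 0"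
      using vanishes_on_param_set[OF G] by blast
    have "vanishes_on (\<lambda>x. F x * G x) ?P" using FG sub by (auto simp: vanishes_on_def)
    then have "\<forall>t\<in>T. (\<forall>i. \<psi> t i \<noteq> 0) \<longrightarrow> F (\<psi> t) * G (\<psi> t) = 0"
      using vanishes_on_param_set[OF form_mult[OF F G]] by blast
    then have FG0: "F (\<psi> t) = 0" if "t \<in> T" "\<And>i. \<psi> t i \<noteq> 0" "G (\<psi> t) \<noteq> 0" for t
      using that by auto
    have "F (\<psi> t) = 0" if "t \<in> T" for t
    proof (rule vanishes_on_generic[OF T \<psi> t0 pol_form[OF G \<psi>] t1(1,3) pol_form[OF F \<psi>] _ that])
      show "F (\<psi> t) = 0" if "t \<in> T" "\<And>i. \<psi> t i \<noteq> 0" "G (\<psi> t) \<noteq> 0" for t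
        by (rule FG0) fact+
    qed
    then show "vanishes_on F ?Z"
      by (intro vanishes_on_closure[OF param_set_proj F]) (simp add: vanishes_on_param_set[OF F])
  qed
  moreover have "?Z \<subseteq> proj_product"
    using closure_of_subset_topspace[of zariski ?P] by simp
  ultimately show ?thesis
    using sub by (subst irreducible_forms) blast+
qed

text \<open>
  A closed set contains the limits of polynomial curves: a form restricted to the curve is a
  univariate polynomial with infinitely many zeros, hence zero. The finite set \<open>B\<close> collects
  the parameters at which nothing is known.
\<close>

lemma closed_limit:
  fixes \<psi> :: "complex \<Rightarrow> 'm::finite \<Rightarrow> complex^'n::finite"
  assumes "closedin zariski K" "\<And>i j. \<exists>p. \<forall>s. \<psi> s i $ j = poly p s" "\<And>i. \<psi> 0 i \<noteq> 0"
    "finite B" "\<And>s. s \<notin> B \<Longrightarrow> (\<And>i. \<psi> s i \<noteq> 0) \<Longrightarrow> pt (\<psi> s) \<in> K"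
  shows "pt (\<psi> 0) \<in> K"
proof -
  obtain S where S: "\<forall>F\<in>S. \<exists>d. form d F" "K = {l \<in> proj_product. \<forall>F\<in>S. F (reps l) = 0}"
    using assms(1) unfolding closedin_zariski_forms by blast
  define P where "P = (\<lambda>i j. SOME p. \<forall>s. \<psi> s i $ j = poly p s)"
  have P: "\<psi> s i $ j = poly (P i j) s" for i j s
    unfolding P_def by (rule someI_ex[OF assms(2), THEN spec])
  have "F (reps (pt (\<psi> 0))) = 0" if FS: "F \<in> S" for F
  proof -
    obtain d where d: "form d F" using S(1) FS by blast
    obtain q where q: "F = mpoly_eval q" using d by (auto simp: form_def)
    define Q where "Q = (\<Sum>\<mu>\<in>Poly_Mapping.keys q. [:Poly_Mapping.lookup q \<mu>:] *
        (\<Prod>i\<in>UNIV. \<Prod>j\<in>UNIV. P i j ^ Poly_Mapping.lookup \<mu> (i, j)))"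
    have Q: "F (\<psi> s) = poly Q s" for s
      by (simp add: Q_def q mpoly_eval_def mono_eval_def P poly_sum poly_prod)
    obtain J where J: "\<And>i. \<psi> 0 i $ J i \<noteq> 0"
      using nonzero_coordinates[of "\<psi> 0"] assms(3) by blast
    define R where "R = (\<Prod>i\<in>UNIV. P i (J i))"
    have "poly R 0 \<noteq> 0" using J by (simp add: R_def poly_prod P)
    then have "R \<noteq> 0" by auto
    have "Q = 0"
    proof (rule ccontr)
      assume "Q \<noteq> 0"
      with \<open>R \<noteq> 0\<close> have "finite ({s. poly (R * Q) s = 0} \<union> B)"
        using assms(4) by (simp add: poly_roots_finite del: poly_mult)
      then obtain s where s: "poly (R * Q) s \<noteq> 0" "s \<notin> B"
        using ex_new_if_finite[OF infinite_UNIV_char_0] by blast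
      then have "\<psi> s i \<noteq> 0" for i
        by (auto simp: R_def poly_prod vec_eq_iff P)
      moreover from this s have "pt (\<psi> s) \<in> K" by (intro assms(5)) auto
      ultimately have "F (\<psi> s) = 0"
        using S(2) FS form_reps_pt[OF d, of "\<psi> s"] by simp
      with s Q show False by simp
    qed
    then show ?thesis using form_reps_pt[OF d, of "\<psi> 0"] assms(3) Q by simp
  qed
  then show ?thesis using S(2) assms(3) by (auto intro: pt_in_proj_product)
qed

section \<open>Chains of irreducible closed sets and linearly independent forms\<close>

interpretation fun_vs: vector_space "\<lambda>(c::complex) f (x::'a). c * f x"
  by unfold_locales (auto simp: fun_eq_iff algebra_simps)

text \<open>
  Bounding each exponent separately, instead of the total degree, makes the monomials easy to
  count.
\<close>

definition monomials :: "nat \<Rightarrow> ((complex^'r::finite) \<Rightarrow> complex) set" where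
  "monomials B = (\<lambda>e t. \<Prod>r\<in>UNIV. (t $ r) ^ e r) ` {e. \<forall>r. e r \<le> B}"

abbreviation bounded_polys :: "nat \<Rightarrow> ((complex^'r::finite) \<Rightarrow> complex) set" where
  "bounded_polys B \<equiv> fun_vs.span (monomials B)"

lemma monomials_card:
  "finite (monomials B :: ((complex^'r::finite) \<Rightarrow> complex) set)"
  "card (monomials B :: ((complex^'r::finite) \<Rightarrow> complex) set) \<le> (B + 1) ^ CARD('r)"
proof -
  have eq: "{e :: 'r \<Rightarrow> nat. \<forall>r. e r \<le> B} = PiE UNIV (\<lambda>_. {..B})" by auto
  then have fin: "finite {e :: 'r \<Rightarrow> nat. \<forall>r. e r \<le> B}" by (simp add: finite_PiE)
  have "card {e :: 'r \<Rightarrow> nat. \<forall>r. e r \<le> B} = (B + 1) ^ CARD('r)"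
    unfolding eq by (simp add: card_PiE)
  then show "finite (monomials B :: ((complex^'r) \<Rightarrow> complex) set)"
    "card (monomials B :: ((complex^'r) \<Rightarrow> complex) set) \<le> (B + 1) ^ CARD('r)"
    using fin card_image_le[OF fin] by (auto simp: monomials_def)
qed

lemma bounded_polys_add:
  "f \<in> bounded_polys B \<Longrightarrow> g \<in> bounded_polys B \<Longrightarrow> (\<lambda>t. f t + g t) \<in> bounded_polys B"
  using fun_vs.span_add[of f "monomials B" g] by (simp add: plus_fun_def)

lemma bounded_polys_scale:
  "f \<in> bounded_polys B \<Longrightarrow> (\<lambda>t. c * f t) \<in> bounded_polys B"
  by (rule fun_vs.span_scale)

lemma bounded_polys_zero: "(\<lambda>_. 0) \<in> bounded_polys B"
  using fun_vs.span_zero[of "monomials B"] by (simp add: zero_fun_def)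

lemma bounded_polys_sum:
  "(\<And>a. a \<in> A \<Longrightarrow> f a \<in> bounded_polys B) \<Longrightarrow> (\<lambda>t. \<Sum>a\<in>A. f a t) \<in> bounded_polys B"
  by (induction A rule: infinite_finite_induct) (auto simp: bounded_polys_zero bounded_polys_add)

lemma bounded_polys_const: "(\<lambda>_. c) \<in> bounded_polys B"
proof -
  have "(\<lambda>_. 1) \<in> monomials B"
    unfolding monomials_def by (rule image_eqI[of _ _ "\<lambda>_. 0"]) auto
  then have "(\<lambda>_. 1) \<in> bounded_polys B" by (rule fun_vs.span_base)
  from bounded_polys_scale[OF this, of c] show ?thesis by simp
qed

lemma bounded_polys_coord: "(\<lambda>t. t $ r) \<in> bounded_polys 1"
proof -
  have "t $ r = (\<Prod>s\<in>UNIV. (t $ s) ^ (if s = r then 1 else 0))" for t :: "complex^'a"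
    by (simp add: if_distrib[of "power _"] cong: if_cong)
  then have "(\<lambda>t. t $ r) \<in> monomials 1"
    unfolding monomials_def
    by (intro image_eqI[of _ _ "\<lambda>s. if s = r then 1 else 0"]) (auto simp: fun_eq_iff)
  then show ?thesis by (rule fun_vs.span_base)
qed

lemma bounded_polys_mult:
  assumes "f \<in> bounded_polys A" "g \<in> bounded_polys B"
  shows "(\<lambda>t. f t * g t) \<in> bounded_polys (A + B)"
  using assms(1)
proof (induction rule: fun_vs.span_induct_alt)
  case base
  then show ?case by (simp add: bounded_polys_zero)
next
  case (step c m f)
  have "(\<lambda>t. m t * g t) \<in> bounded_polys (A + B)"
    using assms(2)
  proof (induction rule: fun_vs.span_induct_alt)
    case base
    then show ?case by (simp add: bounded_polys_zero)
  next
    case (step d l h)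
    obtain e e' where "\<forall>r. e r \<le> A" "m = (\<lambda>t. \<Prod>r\<in>UNIV. (t $ r) ^ e r)"
        "\<forall>r. e' r \<le> B" "l = (\<lambda>t. \<Prod>r\<in>UNIV. (t $ r) ^ e' r)"
      using \<open>m \<in> monomials A\<close> \<open>l \<in> monomials B\<close> by (auto simp: monomials_def)
    then have "(\<lambda>t. m t * l t) \<in> monomials (A + B)"
      unfolding monomials_def
      by (intro image_eqI[of _ _ "\<lambda>r. e r + e' r"])
        (auto simp: power_add prod.distrib intro: add_mono)
    then have "(\<lambda>t. m t * l t) \<in> bounded_polys (A + B)" by (rule fun_vs.span_base)
    from bounded_polys_add[OF bounded_polys_scale[OF this, of d] step.IH]
    show ?case by (simp add: algebra_simps)
  qed
  from bounded_polys_add[OF bounded_polys_scale[OF this, of c] step.IH]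
  show ?case by (simp add: algebra_simps)
qed

lemma bounded_polys_prod:
  "(\<And>a. a \<in> A \<Longrightarrow> f a \<in> bounded_polys (b a)) \<Longrightarrow>
    (\<lambda>t. \<Prod>a\<in>A. f a t) \<in> bounded_polys (\<Sum>a\<in>A. b a)"
  by (induction A rule: infinite_finite_induct) (auto simp: bounded_polys_const bounded_polys_mult)

lemma bounded_polys_form:
  fixes \<psi> :: "complex^'r::finite \<Rightarrow> 'm::finite \<Rightarrow> complex^'n::finite"
  assumes "form d F" "\<And>i j. (\<lambda>t. \<psi> t i $ j) \<in> bounded_polys b"
  shows "(\<lambda>t. F (\<psi> t)) \<in> bounded_polys (b * (\<Sum>i\<in>UNIV. d i))"
proof -
  obtain p where p: "multihomogeneous d p" "F = mpoly_eval p" using assms(1) by (auto simp: form_def)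
  have "(\<lambda>t. mono_eval \<mu> (\<psi> t)) \<in> bounded_polys (b * (\<Sum>i\<in>UNIV. d i))"
    if "\<mu> \<in> Poly_Mapping.keys p" for \<mu>
  proof -
    have pow: "(\<lambda>t. (\<psi> t i $ j) ^ n) \<in> bounded_polys (n * b)" for i j n
      using bounded_polys_prod[of "{..<n}" "\<lambda>_ t. \<psi> t i $ j" "\<lambda>_. b"] assms(2) by simp
    have "(\<lambda>t. mono_eval \<mu> (\<psi> t)) \<in>
        bounded_polys (\<Sum>i\<in>UNIV. \<Sum>j\<in>UNIV. Poly_Mapping.lookup \<mu> (i, j) * b)"
      unfolding mono_eval_def by (intro bounded_polys_prod pow)
    moreover have "(\<Sum>j\<in>UNIV. Poly_Mapping.lookup \<mu> (i, j)) = d i" for i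
      using p(1) that by (auto simp: multihomogeneous_def)
    ultimately show ?thesis
      by (simp add: mult.commute[of b] flip: sum_distrib_right)
  qed
  then show ?thesis
    unfolding p(2) mpoly_eval_def by (intro bounded_polys_sum bounded_polys_scale)
qed

lemma sum_fun_apply: "(\<Sum>k\<in>K. f k) x = (\<Sum>k\<in>K. f k x)"
  by (induction K rule: infinite_finite_induct) auto

lemma linear_dependence_in_span:
  fixes g :: "'k \<Rightarrow> 'a \<Rightarrow> complex"
  assumes "finite K" "finite M" "card K > card M" "\<And>k. k \<in> K \<Longrightarrow> g k \<in> fun_vs.span M"
  obtains c where "\<exists>k\<in>K. c k \<noteq> 0" "\<And>x. (\<Sum>k\<in>K. c k * g k x) = 0"
proof (cases "inj_on g K")
  case True
  then have "\<not> fun_vs.independent (g ` K)"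
    using fun_vs.independent_span_bound[OF assms(2), of "g ` K"] assms(3,4)
    by (auto simp: card_image)
  then obtain u where u: "\<exists>v\<in>g ` K. u v \<noteq> 0" "(\<Sum>v\<in>g ` K. (\<lambda>x. u v * v x)) = 0"
    using fun_vs.dependent_finite[of "g ` K"] assms(1) by auto
  have "(\<Sum>k\<in>K. u (g k) * g k x) = 0" for x
  proof -
    have "(\<Sum>k\<in>K. (\<lambda>x. u (g k) * g k x)) = 0"
      using u(2) by (simp add: sum.reindex[OF True])
    from fun_cong[OF this, of x] show ?thesis by (simp add: sum_fun_apply)
  qed
  then show ?thesis using u(1) that[of "\<lambda>k. u (g k)"] by auto
next
  case False
  then obtain a b where ab: "a \<in> K" "b \<in> K" "a \<noteq> b" "g a = g b" by (auto simp: inj_on_def)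
  have "(\<Sum>k\<in>K. (if k = a then 1 else if k = b then - 1 else 0) * g k x) = 0" for x
  proof -
    have "(\<Sum>k\<in>K. (if k = a then 1 else if k = b then - 1 else 0) * g k x) =
        (\<Sum>k\<in>K. (if k = a then g a x else 0) - (if k = b then g a x else 0))"
      using ab by (intro sum.cong) auto
    then show ?thesis using ab assms(1) by (simp add: sum_subtractf)
  qed
  moreover have "\<exists>k\<in>K. (if k = a then 1 else if k = b then - 1 else 0 :: complex) \<noteq> 0"
    using ab(1) by (intro bexI[of _ a]) auto
  ultimately show ?thesis by (rule that[rotated])
qed

definition independent_on ::
    "('m \<Rightarrow> (complex^'n::finite) set) set \<Rightarrow> 'k set \<Rightarrow> ('k \<Rightarrow> ('m \<Rightarrow> complex^'n) \<Rightarrow> complex) \<Rightarrow> bool" where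
  "independent_on Z K g \<longleftrightarrow>
    (\<forall>c. vanishes_on (\<lambda>x. \<Sum>k\<in>K. c k * g k x) Z \<longrightarrow> (\<forall>k\<in>K. c k = 0))"

lemma form_nonzero_at:
  fixes z :: "'m::finite \<Rightarrow> (complex^'n::finite) set"
  assumes "z \<in> proj_product"
  obtains h where "form d h" "h (reps z) \<noteq> 0"
proof -
  obtain J where J: "\<And>i. reps z i $ J i \<noteq> 0"
    using nonzero_coordinates[of "reps z"] pt_reps(2)[OF assms] by blast
  have eq: "(\<lambda>i. \<Sum>a\<in>UNIV. d a * (if i = a then 1 else 0)) = d"
    by (simp add: fun_eq_iff if_distrib cong: if_cong)
  have "form (\<lambda>i. \<Sum>a\<in>UNIV. d a * (if i = a then 1 else 0)) (\<lambda>x :: 'm \<Rightarrow> complex^'n. \<Prod>i\<in>UNIV. (x i $ J i) ^ d i)"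
    by (intro form_prod form_power form_coord)
  then show ?thesis using that[of "\<lambda>x. \<Prod>i\<in>UNIV. (x i $ J i) ^ d i"] J eq by simp
qed

lemma irreducibleD:
  assumes "irreducible_space (subtopology zariski Z)" "Z \<subseteq> proj_product"
    "form d F" "form e G" "\<And>z. z \<in> Z \<Longrightarrow> F (reps z) * G (reps z) = 0" "\<not> vanishes_on F Z"
  shows "vanishes_on G Z"
  using assms irreducible_forms[OF assms(2)] unfolding vanishes_on_def by blast

text \<open>
  The key step for the dimension bound. Let a relation between the products \<open>f ^ j * h ^ (N -
  j) * g k\<close> hold on \<open>Z'\<close>. On \<open>Z\<close>, where \<open>f\<close> vanishes, only the terms with \<open>j = 0\<close> survive; \<open>h\<close>
  can be cancelled since \<open>Z\<close> is irreducible, and the independence of the \<open>g k\<close> on \<open>Z\<close> shows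
  that the coefficients of these terms are zero. Then \<open>f\<close> can be cancelled on the irreducible
  set \<open>Z'\<close>, and the argument is repeated with \<open>j = 1\<close> and so on. The factors \<open>h ^ (N - j)\<close>
  only make the degrees equal.
\<close>

lemma independent_forms_step:
  fixes Z Z' :: "('m::finite \<Rightarrow> (complex^'n::finite) set) set"
  assumes irr: "irreducible_space (subtopology zariski Z)" "irreducible_space (subtopology zariski Z')"
    and sub: "Z \<subseteq> Z'" "Z' \<subseteq> proj_product"
    and f: "form d f" "vanishes_on f Z" "\<not> vanishes_on f Z'"
    and h: "form d h" "\<not> vanishes_on h Z"
    and g: "\<And>k. k \<in> K \<Longrightarrow> form e (g k)" "independent_on Z K g"
  shows "independent_on Z' ({..N} \<times> K) (\<lambda>(j, k) x. f x ^ j * h x ^ (N - j) * g k x)"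
  unfolding independent_on_def
proof (intro allI impI)
  fix c
  assume van: "vanishes_on (\<lambda>x. \<Sum>q\<in>{..N} \<times> K. c q * (case q of (j, k) \<Rightarrow> \<lambda>x. f x ^ j * h x ^ (N - j) * g k x) x) Z'"
  define S where "S = (\<lambda>j x. \<Sum>k\<in>K. c (j, k) * g k x)"
  have formS: "form e (S j)" for j
    unfolding S_def by (intro form_sum form_scale g(1))
  have eq: "(\<Sum>q\<in>{..N} \<times> K. c q * (case q of (j, k) \<Rightarrow> \<lambda>x. f x ^ j * h x ^ (N - j) * g k x) x) =
      (\<Sum>j\<le>N. f x ^ j * (h x ^ (N - j) * S j x))" for x
    by (simp add: S_def sum_distrib_left sum.cartesian_product algebra_simps split_def)
  have total: "(\<Sum>j\<le>N. f (reps z) ^ j * (h (reps z) ^ (N - j) * S j (reps z))) = 0" if "z \<in> Z'" for z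
    using van that unfolding vanishes_on_def eq by blast
  have "\<forall>k\<in>K. c (j, k) = 0" if "j \<le> N" for j
    using that
  proof (induction j rule: less_induct)
    case (less j)
    have S0: "S i x = 0" if "i < j" for i x
      using less that by (simp add: S_def)
    \<comment> \<open>The cofactor of \<open>f ^ j\<close> in the relation, once the coefficients of lower index are known to be zero.\<close>
    define G where "G = (\<lambda>x. \<Sum>i\<in>{j..N}. f x ^ (i - j) * (h x ^ (N - i) * S i x))"
    have factor: "(\<Sum>i\<le>N. f x ^ i * (h x ^ (N - i) * S i x)) = f x ^ j * G x" for x
    proof -
      have "(\<Sum>i\<le>N. f x ^ i * (h x ^ (N - i) * S i x)) = (\<Sum>i\<in>{j..N}. f x ^ i * (h x ^ (N - i) * S i x))"
        by (rule sum.mono_neutral_right) (auto simp: S0)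
      also have "\<dots> = f x ^ j * G x"
        unfolding G_def sum_distrib_left
        by (intro sum.cong refl) (simp add: mult.assoc[symmetric] flip: power_add)
      finally show ?thesis .
    qed
    have formG: "form (\<lambda>i. (N - j) * d i + e i) G"
      unfolding G_def
    proof (rule form_sum)
      fix i assume "i \<in> {j..N}"
      then have "(\<lambda>k. (i - j) * d k + ((N - i) * d k + e k)) = (\<lambda>k. (N - j) * d k + e k)"
        by (simp add: fun_eq_iff flip: add.assoc add_mult_distrib)
      then show "form (\<lambda>k. (N - j) * d k + e k) (\<lambda>x. f x ^ (i - j) * (h x ^ (N - i) * S i x))"
        using form_mult[OF form_power[OF f(1), of "i - j"] form_mult[OF form_power[OF h(1), of "N - i"] formS[of i]]]
        by metis
    qed
    have "vanishes_on G Z'"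
    proof (rule irreducibleD[OF irr(2) sub(2) form_power[OF f(1), of j] formG])
      show "f (reps z) ^ j * G (reps z) = 0" if "z \<in> Z'" for z
        using total[OF that] by (simp add: factor)
      show "\<not> vanishes_on (\<lambda>x. f x ^ j) Z'"
        using f(3) by (auto simp: vanishes_on_def)
    qed
    then have GZ: "G (reps z) = 0" if "z \<in> Z" for z using that sub(1) by (auto simp: vanishes_on_def)
    have "vanishes_on (S j) Z"
    proof (rule irreducibleD[OF irr(1) _ form_power[OF h(1), of "N - j"] formS])
      show "Z \<subseteq> proj_product" using sub by blast
      show "\<not> vanishes_on (\<lambda>x. h x ^ (N - j)) Z"
        using h(2) by (auto simp: vanishes_on_def)
      fix z assume z: "z \<in> Z"
      then have fz: "f (reps z) = 0" using f(2) by (simp add: vanishes_on_def)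
      have "G (reps z) = (\<Sum>i\<in>{j..N}. if i = j then h (reps z) ^ (N - j) * S j (reps z) else 0)"
        unfolding G_def fz by (intro sum.cong refl) auto
      also have "\<dots> = h (reps z) ^ (N - j) * S j (reps z)" using less.prems by simp
      finally show "h (reps z) ^ (N - j) * S j (reps z) = 0" using GZ[OF z] by simp
    qed
    then show ?case
      using g(2)[unfolded independent_on_def, THEN spec[of _ "\<lambda>k. c (j, k)"]]
      unfolding S_def by blast
  qed
  then show "\<forall>q\<in>{..N} \<times> K. c q = 0" by auto
qed

lemma independent_on_reindex:
  assumes "independent_on Z K g" "bij_betw \<phi> L K"
  shows "independent_on Z L (\<lambda>l. g (\<phi> l))"
  unfolding independent_on_def
proof (intro allI impI ballI)
  fix c l assume van: "vanishes_on (\<lambda>x. \<Sum>k\<in>L. c k * g (\<phi> k) x) Z" and l: "l \<in> L"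
  let ?c = "\<lambda>k. c (inv_into L \<phi> k)"
  have "(\<Sum>k\<in>L. c k * g (\<phi> k) x) = (\<Sum>k\<in>K. ?c k * g k x)" for x
    unfolding sum.reindex_bij_betw[OF assms(2), symmetric]
    using assms(2) by (intro sum.cong refl) (simp add: bij_betw_def)
  then have "vanishes_on (\<lambda>x. \<Sum>k\<in>K. ?c k * g k x) Z" using van by simp
  then have "\<forall>k\<in>K. ?c k = 0"
    using assms(1)[unfolded independent_on_def, THEN spec[of _ ?c]] by blast
  then show "c l = 0" using l assms(2) by (auto simp: bij_betw_def)
qed

text \<open>
  Lists of exponents serve as indices, so that one index type works for every length of the
  chain.
\<close>

lemma many_independent_forms:
  fixes Z :: "nat \<Rightarrow> ('m::finite \<Rightarrow> (complex^'n::finite) set) set"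
  assumes "\<And>i. i \<le> n \<Longrightarrow> irreducible_space (subtopology zariski (Z i))"
    "\<And>i. i \<le> n \<Longrightarrow> Z i \<subseteq> proj_product"
    "\<And>i. i < n \<Longrightarrow> Z i \<subseteq> Z (Suc i)"
    "\<And>i. i < n \<Longrightarrow> \<exists>d F. form d F \<and> vanishes_on F (Z i) \<and> \<not> vanishes_on F (Z (Suc i))"
  shows "\<exists>e. \<forall>N. \<exists>(K :: nat list set) g. finite K \<and> card K = (N + 1) ^ n \<and>
    (\<forall>k\<in>K. form (\<lambda>i. N * e i) (g k)) \<and> independent_on (Z n) K g"
  using assms
proof (induction n)
  case 0
  then obtain z where z: "z \<in> Z 0"
    using irreducible_forms[of "Z 0"] by blast
  show ?case
  proof (intro exI[of _ "\<lambda>_. 0"] allI)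
    fix N :: nat
    have "independent_on (Z 0) {[] :: nat list} (\<lambda>_ _. 1)"
      using z unfolding independent_on_def vanishes_on_def by auto
    then show "\<exists>(K :: nat list set) g. finite K \<and> card K = (N + 1) ^ 0 \<and>
        (\<forall>k\<in>K. form (\<lambda>i. N * 0) (g k)) \<and> independent_on (Z 0) K g"
      using form_const[of 1] by (intro exI[of _ "{[]}"] exI[of _ "\<lambda>_ _. 1"]) simp
  qed
next
  case (Suc n)
  have "\<exists>e. \<forall>N. \<exists>(K :: nat list set) g. finite K \<and> card K = (N + 1) ^ n \<and>
    (\<forall>k\<in>K. form (\<lambda>i. N * e i) (g k)) \<and> independent_on (Z n) K g"
    by (rule Suc.IH) (simp_all add: Suc.prems)
  then obtain e where e: "\<And>N. \<exists>(K :: nat list set) g. finite K \<and> card K = (N + 1) ^ n \<and>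
    (\<forall>k\<in>K. form (\<lambda>i. N * e i) (g k)) \<and> independent_on (Z n) K g"
    by blast
  obtain d f where f: "form d f" "vanishes_on f (Z n)" "\<not> vanishes_on f (Z (Suc n))"
    using Suc.prems(4) by blast
  have Zn: "Z n \<subseteq> proj_product" "Z n \<subseteq> Z (Suc n)" "Z (Suc n) \<subseteq> proj_product"
    "irreducible_space (subtopology zariski (Z n))"
    "irreducible_space (subtopology zariski (Z (Suc n)))"
    using Suc.prems by auto
  then obtain z where z: "z \<in> Z n" using irreducible_forms[of "Z n"] by blast
  then obtain h where h: "form d h" "h (reps z) \<noteq> 0"
    using form_nonzero_at[of z d] Zn(1) by blast
  then have h': "\<not> vanishes_on h (Z n)" using z by (auto simp: vanishes_on_def)
  show ?case
  proof (intro exI[of _ "\<lambda>i. d i + e i"] allI)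
    fix N
    obtain K :: "nat list set" and g where K: "finite K" "card K = (N + 1) ^ n"
        "\<And>k. k \<in> K \<Longrightarrow> form (\<lambda>i. N * e i) (g k)" "independent_on (Z n) K g"
      using e[of N] by blast
    let ?L = "(\<lambda>(j, k). j # k) ` ({..N} \<times> K)"
    let ?G = "\<lambda>(j, k) x. f x ^ j * h x ^ (N - j) * g k x"
    have inj: "inj_on (\<lambda>(j, k). j # k) ({..N} \<times> K)" by (auto simp: inj_on_def)
    have bij: "bij_betw (\<lambda>l. (hd l, tl l)) ?L ({..N} \<times> K)"
      by (rule bij_betw_byWitness[where f' = "\<lambda>(j, k). j # k"]) auto
    have "form (\<lambda>i. N * (d i + e i)) (?G (hd l, tl l))" if l: "l \<in> ?L" for l
    proof -
      obtain j k where jk: "j \<le> N" "k \<in> K" "l = j # k" using l by auto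
      then have "j * m + (N - j) * m + N * q = N * (m + q)" for m q :: nat
        by (simp add: distrib_left flip: add_mult_distrib)
      then show ?thesis
        using form_mult[OF form_mult[OF form_power[OF f(1), of j] form_power[OF h(1), of "N - j"]] K(3)[OF jk(2)]]
        by (simp add: jk(3))
    qed
    moreover have "independent_on (Z (Suc n)) ?L (\<lambda>l. ?G (hd l, tl l))"
      by (rule independent_on_reindex[OF _ bij])
        (rule independent_forms_step[OF Zn(4,5,2,3) f h(1) h' K(3,4)])
    moreover have "card ?L = (N + 1) ^ Suc n" using K(2) by (simp add: card_image[OF inj] card_cartesian_product)
    ultimately show "\<exists>(K :: nat list set) g. finite K \<and> card K = (N + 1) ^ Suc n \<and>
        (\<forall>k\<in>K. form (\<lambda>i. N * (d i + e i)) (g k)) \<and> independent_on (Z (Suc n)) K g"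
      using K(1) by (intro exI[of _ ?L] exI[of _ "\<lambda>l. ?G (hd l, tl l)"]) blast
  qed
qed

text \<open>
  On \<open>Y\<close>, forms of degree \<open>N * e\<close> are determined by their pullbacks, which are polynomials in
  \<open>CARD('r)\<close> variables with exponents bounded by a multiple of \<open>N\<close>. For large \<open>N\<close> there are
  fewer such monomials than the independent forms that a chain longer than \<open>CARD('r)\<close>
  provides.
\<close>

lemma chain_length_bound:
  fixes \<psi> :: "complex^'r::finite \<Rightarrow> 'm::finite \<Rightarrow> complex^'n::finite"
  assumes \<psi>: "\<And>i j. (\<lambda>t. \<psi> t i $ j) \<in> bounded_polys b"
    and Y: "\<And>d F. form d F \<Longrightarrow> (\<And>t. F (\<psi> t) = 0) \<Longrightarrow> vanishes_on F Y" "Y \<subseteq> proj_product"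
    and Z: "\<And>i. i \<le> n \<Longrightarrow> irreducible_space (subtopology zariski (Z i))"
      "\<And>i. i \<le> n \<Longrightarrow> Z i \<subseteq> Y" "\<And>i. i < n \<Longrightarrow> Z i \<subseteq> Z (Suc i)"
      "\<And>i. i < n \<Longrightarrow> \<exists>d F. form d F \<and> vanishes_on F (Z i) \<and> \<not> vanishes_on F (Z (Suc i))"
  shows "n \<le> CARD('r)"
proof (rule ccontr)
  let ?r = "CARD('r)"
  assume "\<not> n \<le> ?r"
  then have n: "Suc ?r \<le> n" by simp
  have "Z i \<subseteq> proj_product" if "i \<le> n" for i using Z(2)[OF that] Y(2) by blast
  then obtain e where e: "\<And>N. \<exists>(K :: nat list set) g. finite K \<and> card K = (N + 1) ^ n \<and>
    (\<forall>k\<in>K. form (\<lambda>i. N * e i) (g k)) \<and> independent_on (Z n) K g"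
    using many_independent_forms[of n Z] Z(1,3,4) by blast
  define E where "E = (\<Sum>i\<in>UNIV. e i)"
  \<comment> \<open>Chosen so that \<open>((b * E + 1) * (N + 1)) ^ ?r\<close>, a bound for the number of monomials,
    is less than \<open>(N + 1) ^ Suc ?r\<close>.\<close>
  define N where "N = (b * E + 1) ^ ?r"
  obtain K :: "nat list set" and g where K: "finite K" "card K = (N + 1) ^ n"
      "\<And>k. k \<in> K \<Longrightarrow> form (\<lambda>i. N * e i) (g k)" "independent_on (Z n) K g"
    using e[of N] by blast
  let ?B = "b * (\<Sum>i\<in>UNIV. N * e i)"
  have "(\<Sum>i\<in>UNIV. N * e i) = N * E" by (simp add: E_def sum_distrib_left)
  then have "?B + 1 \<le> (b * E + 1) * (N + 1)" by (simp add: algebra_simps)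
  then have "(?B + 1) ^ ?r \<le> ((b * E + 1) * (N + 1)) ^ ?r" by (rule power_mono) simp
  also have "\<dots> = N * (N + 1) ^ ?r" by (simp only: power_mult_distrib N_def)
  also have "\<dots> < (N + 1) ^ Suc ?r" by simp
  also have "\<dots> \<le> (N + 1) ^ n" using n by (intro power_increasing) auto
  finally have "card (monomials ?B :: ((complex^'r) \<Rightarrow> complex) set) < card K"
    using monomials_card(2)[of ?B, where 'r = 'r] K(2) by linarith
  moreover have "(\<lambda>t. g k (\<psi> t)) \<in> bounded_polys ?B" if "k \<in> K" for k
    by (rule bounded_polys_form[OF K(3)[OF that] \<psi>])
  ultimately obtain c where c: "\<exists>k\<in>K. c k \<noteq> 0" "\<And>t. (\<Sum>k\<in>K. c k * g k (\<psi> t)) = 0"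
    using linear_dependence_in_span[OF K(1) monomials_card(1)[of ?B], of "\<lambda>k t. g k (\<psi> t)"] by blast
  have "form (\<lambda>i. N * e i) (\<lambda>x. \<Sum>k\<in>K. c k * g k x)"
    by (intro form_sum form_scale K(3))
  from Y(1)[OF this c(2)] have "vanishes_on (\<lambda>x. \<Sum>k\<in>K. c k * g k x) (Z n)"
    using Z(2)[of n] unfolding vanishes_on_def by blast
  then show False using K(4) c(1) unfolding independent_on_def by blast
qed

section \<open>Linear algebra in three and four dimensions\<close>

text \<open>
  The bilinear pairing between points and equations, without complex conjugation; in
  particular a nonzero vector may be orthogonal to itself.
\<close>

definition dot :: "complex^'n::finite \<Rightarrow> complex^'n \<Rightarrow> complex" where
  "dot x h = (\<Sum>j\<in>UNIV. x $ j * h $ j)"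

lemma dot_add_left [simp]: "dot (x + y) h = dot x h + dot y h"
  by (simp add: dot_def distrib_right sum.distrib)

lemma dot_add_right [simp]: "dot x (h + k) = dot x h + dot x k"
  by (simp add: dot_def distrib_left sum.distrib)

lemma dot_diff_left [simp]: "dot (x - y) h = dot x h - dot y h"
  by (simp add: dot_def left_diff_distrib sum_subtractf)

lemma dot_scale_left [simp]: "dot (c *s x) h = c * dot x h"
  by (simp add: dot_def sum_distrib_left mult.assoc)

lemma dot_scale_right [simp]: "dot x (c *s h) = c * dot x h"
  by (simp add: dot_def sum_distrib_left mult.left_commute)

lemma dot_zero [simp]: "dot 0 h = 0" "dot x 0 = 0"
  by (simp_all add: dot_def)

lemma dot_transpose: "dot x (transpose A *v v) = dot (A *v x) v"
proof -
  have "dot x (transpose A *v v) = (\<Sum>j\<in>UNIV. \<Sum>i\<in>UNIV. x $ j * (A $ i $ j * v $ i))"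
    unfolding dot_def matrix_vector_mult_def transpose_def by (simp only: vec_lambda_beta sum_distrib_left)
  also have "\<dots> = (\<Sum>i\<in>UNIV. \<Sum>j\<in>UNIV. x $ j * (A $ i $ j * v $ i))" by (rule sum.swap)
  also have "\<dots> = dot (A *v x) v"
    unfolding dot_def matrix_vector_mult_def
    by (simp only: vec_lambda_beta sum_distrib_right) (simp only: mult_ac)
  finally show ?thesis .
qed

lemma dot_eq_all:
  assumes "\<And>x. dot x h = dot x k"
  shows "h = k"
proof -
  have "dot (axis j 1) h = h $ j" for h :: "complex^'a" and j
    by (simp add: dot_def axis_def if_distrib[of "\<lambda>x. x * _"] cong: if_cong)
  then show ?thesis using assms by (metis vec_eq_iff)
qed

definition cross_product :: "complex^3 \<Rightarrow> complex^3 \<Rightarrow> complex^3" where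
  "cross_product a b = vector [a$2 * b$3 - a$3 * b$2, a$3 * b$1 - a$1 * b$3, a$1 * b$2 - a$2 * b$1]"

lemma cross_product_nth:
  "cross_product a b $ 1 = a$2 * b$3 - a$3 * b$2"
  "cross_product a b $ 2 = a$3 * b$1 - a$1 * b$3"
  "cross_product a b $ 3 = a$1 * b$2 - a$2 * b$1"
  by (simp_all add: cross_product_def)

lemmas cross_simps = vec_eq_iff forall_3 cross_product_nth

lemma cross_product_bilinear:
  "cross_product (a + b) c = cross_product a c + cross_product b c"
  "cross_product a (b + c) = cross_product a b + cross_product a c"
  "cross_product (k *s a) b = k *s cross_product a b"
  "cross_product a (k *s b) = k *s cross_product a b"
  by (simp_all add: cross_simps algebra_simps)

lemma cross_product_self [simp]: "cross_product a a = 0"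
  by (simp add: cross_simps)

lemma cross_product_zero [simp]: "cross_product 0 a = 0" "cross_product a 0 = 0"
  by (simp_all add: cross_simps)

lemma dot_cross_product [simp]: "dot a (cross_product a b) = 0" "dot b (cross_product a b) = 0"
  by (simp_all add: dot_def sum_3 cross_product_nth algebra_simps)

lemma cross_product_eq_0:
  assumes "cross_product a b = 0" "a \<noteq> 0"
  shows "\<exists>k. b = k *s a"
proof -
  from assms(2) consider "a$1 \<noteq> 0" | "a$2 \<noteq> 0" | "a$3 \<noteq> 0" by (auto simp: cross_simps)
  then show ?thesis
  proof cases
    case 1
    then show ?thesis using assms(1)
      by (intro exI[of _ "b$1 / a$1"]) (auto simp: cross_simps field_simps)
  next
    case 2
    then show ?thesis using assms(1)
      by (intro exI[of _ "b$2 / a$2"]) (auto simp: cross_simps field_simps)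
  next
    case 3
    then show ?thesis using assms(1)
      by (intro exI[of _ "b$3 / a$3"]) (auto simp: cross_simps field_simps)
  qed
qed

text \<open>
  The cross product of \<open>a\<close> and \<open>b\<close> is the equation of the line through the two points of the
  plane. The reason is the identity that expresses the double cross product with \<open>v\<close> by the
  two pairings.
\<close>

lemma orthogonal_to_both:
  assumes "cross_product a b \<noteq> 0" "dot a v = 0" "dot b v = 0"
  shows "\<exists>k. v = k *s cross_product a b"
proof (rule cross_product_eq_0[OF _ assms(1)])
  have "cross_product (cross_product a b) v = dot a v *s b - dot b v *s a"
    by (simp add: cross_simps dot_def sum_3 algebra_simps)
  then show "cross_product (cross_product a b) v = 0" using assms by simp
qed

text \<open>
  Cramer's rule, with a nonzero coordinate of the cross product as the minor that serves as
  denominator.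
\<close>

lemma triple_product_eq_0:
  assumes n: "cross_product a b \<noteq> 0" and d: "dot d (cross_product a b) = 0"
  shows "\<exists>k l. d = k *s a + l *s b"
proof -
  have d': "d$1 * (a$2 * b$3 - a$3 * b$2) + d$2 * (a$3 * b$1 - a$1 * b$3) + d$3 * (a$1 * b$2 - a$2 * b$1) = 0"
    using d by (simp add: dot_def sum_3 cross_product_nth)
  have solve: "\<exists>k l. d = k *s a + l *s b"
    if "m \<noteq> 0" "\<forall>i. d $ i * m = p * a $ i + q * b $ i" for m p q
    using that by (intro exI[of _ "p / m"] exI[of _ "q / m"]) (simp add: vec_eq_iff field_simps)
  from n consider "(a$2 * b$3 - a$3 * b$2) \<noteq> 0" | "(a$3 * b$1 - a$1 * b$3) \<noteq> 0" | "(a$1 * b$2 - a$2 * b$1) \<noteq> 0"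
    by (auto simp: cross_simps)
  then show ?thesis
  proof cases
    case 1
    show ?thesis
    proof (rule solve[OF 1])
      let ?n = "(a$2 * b$3 - a$3 * b$2)"
      have "d$1 * ?n = (d$2 * b$3 - d$3 * b$2) * a$1 + (a$2 * d$3 - a$3 * d$2) * b$1"
        using d' by algebra
      moreover have "d$2 * ?n = (d$2 * b$3 - d$3 * b$2) * a$2 + (a$2 * d$3 - a$3 * d$2) * b$2"
        by (simp add: algebra_simps)
      moreover have "d$3 * ?n = (d$2 * b$3 - d$3 * b$2) * a$3 + (a$2 * d$3 - a$3 * d$2) * b$3"
        by (simp add: algebra_simps)
      ultimately show "\<forall>i. d $ i * ?n = (d$2 * b$3 - d$3 * b$2) * a $ i + (a$2 * d$3 - a$3 * d$2) * b $ i"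
        by (simp add: forall_3)
    qed
  next
    case 2
    show ?thesis
    proof (rule solve[OF 2])
      let ?n = "(a$3 * b$1 - a$1 * b$3)"
      have "d$1 * ?n = (d$3 * b$1 - d$1 * b$3) * a$1 + (a$3 * d$1 - a$1 * d$3) * b$1"
        by (simp add: algebra_simps)
      moreover have "d$2 * ?n = (d$3 * b$1 - d$1 * b$3) * a$2 + (a$3 * d$1 - a$1 * d$3) * b$2"
        using d' by algebra
      moreover have "d$3 * ?n = (d$3 * b$1 - d$1 * b$3) * a$3 + (a$3 * d$1 - a$1 * d$3) * b$3"
        by (simp add: algebra_simps)
      ultimately show "\<forall>i. d $ i * ?n = (d$3 * b$1 - d$1 * b$3) * a $ i + (a$3 * d$1 - a$1 * d$3) * b $ i"
        by (simp add: forall_3)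
    qed
  next
    case 3
    show ?thesis
    proof (rule solve[OF 3])
      let ?n = "(a$1 * b$2 - a$2 * b$1)"
      have "d$1 * ?n = (d$1 * b$2 - d$2 * b$1) * a$1 + (a$1 * d$2 - a$2 * d$1) * b$1"
        by (simp add: algebra_simps)
      moreover have "d$2 * ?n = (d$1 * b$2 - d$2 * b$1) * a$2 + (a$1 * d$2 - a$2 * d$1) * b$2"
        by (simp add: algebra_simps)
      moreover have "d$3 * ?n = (d$1 * b$2 - d$2 * b$1) * a$3 + (a$1 * d$2 - a$2 * d$1) * b$3"
        using d' by algebra
      ultimately show "\<forall>i. d $ i * ?n = (d$1 * b$2 - d$2 * b$1) * a $ i + (a$1 * d$2 - a$2 * d$1) * b $ i"
        by (simp add: forall_3)
    qed
  qed
qed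

definition indep2 :: "complex^'n::finite \<Rightarrow> complex^'n \<Rightarrow> bool" where
  "indep2 x y \<longleftrightarrow> (\<forall>a b. a *s x + b *s y = 0 \<longrightarrow> a = 0 \<and> b = 0)"

lemma dual_basis:
  fixes b :: "'n::finite \<Rightarrow> complex^'n"
  assumes "\<And>k. (\<Sum>i\<in>UNIV. k i *s b i) = 0 \<Longrightarrow> \<forall>i. k i = 0"
  shows "\<exists>\<beta>. (\<forall>i j. dot (b i) (\<beta> j) = (if i = j then 1 else 0)) \<and>
    (\<forall>v. v = (\<Sum>i\<in>UNIV. dot v (\<beta> i) *s b i))"
proof -
  define A :: "complex^'n^'n" where "A = (\<chi> r k. b k $ r)"
  have col: "column k A = b k" for k by (simp add: A_def column_def vec_eq_iff)
  obtain B where BA: "B ** A = mat 1"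
    using matrix_left_invertible_independent_columns[of A] assms unfolding col by blast
  then have AB: "A ** B = mat 1" using matrix_left_right_inverse by blast
  have dotB: "dot v (B $ i) = (B *v v) $ i" for v i
    by (simp add: dot_def matrix_vector_mult_def mult.commute)
  show ?thesis
  proof (intro exI[of _ "\<lambda>i. B $ i"] conjI allI)
    fix i j
    have "dot (b i) (B $ j) = (B ** A) $ j $ i"
      by (simp add: dot_def matrix_matrix_mult_def A_def mult.commute)
    then show "dot (b i) (B $ j) = (if i = j then 1 else 0)"
      unfolding BA by (auto simp: mat_def)
  next
    fix v
    have "v = A *v (B *v v)" using AB by (simp add: matrix_vector_mul_assoc)
    then show "v = (\<Sum>i\<in>UNIV. dot v (B $ i) *s b i)"
      unfolding dotB using matrix_mult_sum[of A "B *v v"] col by simp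
  qed
qed

lemma ex_outside_span:
  fixes S :: "(complex^'n::finite) set"
  assumes "finite S" "card S < CARD('n)"
  obtains r where "r \<notin> vec.span S"
proof -
  have "vec.span S \<noteq> UNIV"
    using assms vec.dim_le_card[of "UNIV :: (complex^'n) set" S] unfolding vec_dim_card by auto
  then show ?thesis using that by blast
qed

lemma outside_span_coeff:
  assumes "r \<notin> vec.span S" "u \<in> vec.span S" "k *s r + u = (0 :: complex^'n::finite)"
  shows "k = 0"
proof (rule ccontr)
  assume k: "k \<noteq> 0"
  have "k *s r = - u" using assms(3) by (simp add: eq_neg_iff_add_eq_0)
  then have "(1 / k) *s (k *s r) = (1 / k) *s (- u)" by simp
  then have "r = (1 / k) *s (- u)" using k by simp
  then show False using assms(1,2) by (metis vec.span_neg vec.span_scale)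
qed

lemma indep2_extend:
  fixes x y :: "complex^4"
  assumes "indep2 x y"
  obtains b :: "4 \<Rightarrow> complex^4" where "b 1 = x" "b 2 = y"
    "\<And>k. (\<Sum>i\<in>UNIV. k i *s b i) = 0 \<Longrightarrow> \<forall>i. k i = 0"
proof -
  have "card {x, y} < CARD(4)" using card_length[of "[x, y]"] by simp
  then obtain r where r: "r \<notin> vec.span {x, y}"
    using ex_outside_span[of "{x, y}"] by blast
  have "card {x, y, r} < CARD(4)" using card_length[of "[x, y, r]"] by simp
  then obtain s where s: "s \<notin> vec.span {x, y, r}"
    using ex_outside_span[of "{x, y, r}"] by blast
  define b :: "4 \<Rightarrow> complex^4" where "b = (\<lambda>i. if i = 1 then x else if i = 2 then y else if i = 3 then r else s)"
  have "\<forall>i. k i = 0" if k: "(\<Sum>i\<in>UNIV. k i *s b i) = 0" for k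
  proof -
    have sum: "k 1 *s x + k 2 *s y + k 3 *s r + k 4 *s s = 0"
      using k by (simp add: sum_4 b_def)
    have "k 1 *s x + k 2 *s y + k 3 *s r \<in> vec.span {x, y, r}"
      by (intro vec.span_add vec.span_scale vec.span_base) auto
    from outside_span_coeff[OF s this] have k4: "k 4 = 0" using sum by (simp add: add.commute)
    have "k 1 *s x + k 2 *s y \<in> vec.span {x, y}"
      by (intro vec.span_add vec.span_scale vec.span_base) auto
    from outside_span_coeff[OF r this] have k3: "k 3 = 0" using sum k4 by (simp add: add.commute)
    show ?thesis using assms sum k3 k4 by (simp add: forall_4 indep2_def)
  qed
  then show ?thesis by (intro that[of b]) (auto simp: b_def)
qed

text \<open>
  A basis of four-space that starts with a given basis of a line, with its dual basis; \<open>f\<close> and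
  \<open>g\<close> are equations of the line, and the span of \<open>r\<close> and \<open>s\<close> is a complement.
\<close>

lemma adapted_basis:
  fixes x y :: "complex^4"
  assumes "indep2 x y"
  obtains r s \<phi> \<eta> f g where
    "dot x \<phi> = 1" "dot x \<eta> = 0" "dot x f = 0" "dot x g = 0"
    "dot y \<phi> = 0" "dot y \<eta> = 1" "dot y f = 0" "dot y g = 0"
    "dot r \<phi> = 0" "dot r \<eta> = 0" "dot r f = 1" "dot r g = 0"
    "dot s \<phi> = 0" "dot s \<eta> = 0" "dot s f = 0" "dot s g = 1"
    "\<And>v. v = dot v \<phi> *s x + dot v \<eta> *s y + dot v f *s r + dot v g *s s"
    "\<And>h. h = dot x h *s \<phi> + dot y h *s \<eta> + dot r h *s f + dot s h *s g"
proof -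
  obtain b :: "4 \<Rightarrow> complex^4" where b: "b 1 = x" "b 2 = y"
    "\<And>k. (\<Sum>i\<in>UNIV. k i *s b i) = 0 \<Longrightarrow> \<forall>i. k i = 0"
    using indep2_extend[OF assms] by blast
  obtain \<beta> where \<beta>: "\<And>i j. dot (b i) (\<beta> j) = (if i = j then 1 else 0)"
    "\<And>v. v = (\<Sum>i\<in>UNIV. dot v (\<beta> i) *s b i)"
    using dual_basis[OF b(3)] by blast
  have v: "v = dot v (\<beta> 1) *s x + dot v (\<beta> 2) *s y + dot v (\<beta> 3) *s b 3 + dot v (\<beta> 4) *s b 4" for v
    using \<beta>(2)[of v] by (simp add: sum_4 b(1,2))
  have h: "h = dot x h *s \<beta> 1 + dot y h *s \<beta> 2 + dot (b 3) h *s \<beta> 3 + dot (b 4) h *s \<beta> 4" for h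
  proof (rule dot_eq_all)
    fix v
    have "dot v h = dot (dot v (\<beta> 1) *s x + dot v (\<beta> 2) *s y + dot v (\<beta> 3) *s b 3 + dot v (\<beta> 4) *s b 4) h"
      using v[of v] by simp
    then show "dot v h = dot v (dot x h *s \<beta> 1 + dot y h *s \<beta> 2 + dot (b 3) h *s \<beta> 3 + dot (b 4) h *s \<beta> 4)"
      by (simp add: mult.commute)
  qed
  show ?thesis
    by (rule that[of "\<beta> 1" "\<beta> 2" "\<beta> 3" "\<beta> 4" "b 3" "b 4"])
      (use \<beta>(1)[of 1] \<beta>(1)[of 2] \<beta>(1)[of 3] \<beta>(1)[of 4] b(1,2) v h in auto)
qed

text \<open>
  If \<open>p\<close> and \<open>q\<close> are dependent, they are multiples of one vector, which is completed to an
  independent pair. The line is then spanned by the last two vectors of the dual basis.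
\<close>

lemma two_equations_in_four_unknowns:
  fixes p q :: "complex^4"
  obtains x y where "indep2 x y" "dot x p = 0" "dot x q = 0" "dot y p = 0" "dot y q = 0"
proof -
  obtain p' q' a b c d where pq: "indep2 p' q'" "p = a *s p' + b *s q'" "q = c *s p' + d *s q'"
  proof (cases "indep2 p q")
    case True
    show ?thesis by (rule that[OF True, of 1 0 0 1]) auto
  next
    case False
    then obtain k l where kl: "k *s p + l *s q = 0" "k \<noteq> 0 \<or> l \<noteq> 0" by (auto simp: indep2_def)
    obtain v e f where v: "p = e *s v" "q = f *s v" "v \<noteq> 0"
    proof (cases "p = 0")
      case True
      show ?thesis
      proof (cases "q = 0")
        case True
        show ?thesis using \<open>p = 0\<close> True by (intro that[of 0 "axis 1 1" 0]) (auto simp: axis_eq_0_iff)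
      next
        case False
        show ?thesis using \<open>p = 0\<close> False by (intro that[of 0 q 1]) auto
      qed
    next
      case False
      have "l \<noteq> 0" using kl False by auto
      have "l *s q = - (k *s p)" using kl(1) by (simp add: eq_neg_iff_add_eq_0 add.commute)
      then have "(1 / l) *s (l *s q) = (1 / l) *s (- (k *s p))" by simp
      then have "q = (- k / l) *s p" using \<open>l \<noteq> 0\<close> by (simp add: vec_eq_iff)
      then show ?thesis using False by (intro that[of 1 p "- k / l"]) auto
    qed
    obtain w where w: "w \<notin> vec.span {v}"
      using ex_outside_span[of "{v}"] by auto
    have "indep2 v w"
      unfolding indep2_def
    proof (intro allI impI)
      fix a b assume ab: "a *s v + b *s w = 0"
      have "a *s v \<in> vec.span {v}" by (intro vec.span_scale vec.span_base) auto
      from outside_span_coeff[OF w this] have "b = 0" using ab by (simp add: add.commute)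
      then show "a = 0 \<and> b = 0" using ab v(3) by simp
    qed
    then show ?thesis using v by (intro that[of v w e 0 f 0]) auto
  qed
  obtain r s \<phi> \<eta> f g where fr: "dot p' f = 0" "dot p' g = 0" "dot q' f = 0" "dot q' g = 0"
      "dot r f = 1" "dot r g = 0" "dot s f = 0" "dot s g = 1"
    using adapted_basis[OF pq(1)] by metis
  have "indep2 f g"
    unfolding indep2_def
  proof (intro allI impI)
    fix a b assume "a *s f + b *s g = 0"
    then have "dot r (a *s f + b *s g) = 0" "dot s (a *s f + b *s g) = 0" by simp_all
    then show "a = 0 \<and> b = 0" using fr by simp
  qed
  moreover have comm: "dot u v = dot v u" for u v :: "complex^4" by (simp add: dot_def mult.commute)
  have "dot f p = 0" "dot f q = 0" "dot g p = 0" "dot g q = 0"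
    unfolding comm[of f] comm[of g] using fr by (simp_all add: pq(2,3))
  ultimately show ?thesis by (rule that)
qed

section \<open>Bounds for the Krull dimension\<close>

lemma krull_dim_ge:
  assumes "\<And>i. i \<le> n \<Longrightarrow> closedin zariski (Z i)" "\<And>i. i \<le> n \<Longrightarrow> Z i \<subseteq> X"
    "\<And>i. i \<le> n \<Longrightarrow> irreducible_space (subtopology zariski (Z i))"
    "\<And>i. i < n \<Longrightarrow> Z i \<subset> Z (Suc i)"
  shows "enat n \<le> krull_dim (subtopology zariski X)"
  unfolding krull_dim_def
proof (rule Sup_upper, rule CollectI, intro exI conjI allI impI)
  show "enat n = enat n" ..
  fix i assume i: "i \<le> n"
  have "Z i = Z i \<inter> X" using assms(2)[OF i] by blast
  then show "closedin (subtopology zariski X) (Z i)"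
    using assms(1)[OF i] unfolding closedin_subtopology by blast
  have "X \<inter> Z i = Z i" using assms(2)[OF i] by blast
  then show "irreducible_space (subtopology (subtopology zariski X) (Z i))"
    using assms(3)[OF i] by (simp add: subtopology_subtopology)
next
  fix i assume "i < n"
  then show "Z i \<subset> Z (Suc i)" by (rule assms(4))
qed

lemma krull_dim_param_le:
  fixes \<psi> :: "complex^'r::finite \<Rightarrow> 'm::finite \<Rightarrow> complex^'n::finite"
  assumes \<psi>: "\<And>i j. (\<lambda>t. \<psi> t i $ j) \<in> bounded_polys b"
    and Y: "\<And>d F. form d F \<Longrightarrow> (\<And>t. F (\<psi> t) = 0) \<Longrightarrow> vanishes_on F Y" "Y \<subseteq> proj_product"
  shows "krull_dim (subtopology zariski Y) \<le> enat (CARD('r))"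
  unfolding krull_dim_def
proof (rule Sup_least, clarify)
  fix n and Z :: "nat \<Rightarrow> ('m \<Rightarrow> (complex^'n) set) set"
  assume Z: "\<forall>i\<le>n. closedin (subtopology zariski Y) (Z i) \<and>
      irreducible_space (subtopology (subtopology zariski Y) (Z i))" "\<forall>i<n. Z i \<subset> Z (Suc i)"
  have sub: "Z i \<subseteq> Y" if "i \<le> n" for i
    using closedin_subset[of "subtopology zariski Y" "Z i"] Z(1) that by auto
  have "n \<le> CARD('r)"
  proof (rule chain_length_bound[OF \<psi> Y(1) Y(2)])
    fix i assume i: "i \<le> n"
    show "Z i \<subseteq> Y" by (rule sub[OF i])
    then have "Y \<inter> Z i = Z i" by blast
    then show "irreducible_space (subtopology zariski (Z i))"
      using Z(1) i by (auto simp: subtopology_subtopology)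
  next
    fix i assume i: "i < n"
    then show "Z i \<subseteq> Z (Suc i)" using Z(2) by blast
    obtain z where z: "z \<in> Z (Suc i)" "z \<notin> Z i" using Z(2) i by blast
    have "closedin (subtopology zariski Y) (Z i)" "z \<in> Y" using Z(1) sub[of "Suc i"] z i by auto
    from separating_form[OF this Y(2) z(2)] obtain d F where
      "form d F" "vanishes_on F (Z i)" "F (reps z) \<noteq> 0" by blast
    then show "\<exists>d F. form d F \<and> vanishes_on F (Z i) \<and> \<not> vanishes_on F (Z (Suc i))"
      using z(1) unfolding vanishes_on_def by blast
  qed
  then show "enat n \<le> enat (CARD('r))" by simp
qed

section \<open>Lines, pinhole cameras and the joint camera map\<close>

definition line2 :: "complex^'n::finite \<Rightarrow> complex^'n \<Rightarrow> (complex^'n) set" where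
  "line2 x y = {a *s x + b *s y |a b. True}"

lemma line2_eq_span: "line2 x y = vec.span {x, y}"
proof -
  have "v = a *s x + b *s y \<longleftrightarrow> v - a *s x = b *s y" for v a b by (auto simp: diff_eq_eq add.commute)
  then show ?thesis
    unfolding line2_def vec.span_insert[of x "{y}"] vec.span_singleton by auto
qed

lemma grassmannian_iff: "L \<in> grassmannian \<longleftrightarrow> (\<exists>x y. indep2 x y \<and> L = line2 x y)"
proof
  assume "L \<in> grassmannian"
  then have L: "vec.subspace L" "vec.dim L = 2" by (auto simp: grassmannian_def)
  obtain B where B: "B \<subseteq> L" "vec.independent B" "L \<subseteq> vec.span B" "card B = 2"
    using vec.basis_exists[of L] L(2) by metis
  obtain x y where xy: "B = {x, y}" "x \<noteq> y" using B(4) by (auto simp: card_2_iff)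
  have "vec.span B = L" using B L(1) by (simp add: vec.span_minimal subset_antisym)
  moreover have "indep2 x y"
    unfolding indep2_def
  proof (intro allI impI)
    fix a b assume ab: "a *s x + b *s y = 0"
    have "(\<Sum>v\<in>B. (if v = x then a else b) *s v) = 0" using ab xy by simp
    from vec.independentD[OF B(2) _ subset_refl this]
    show "a = 0 \<and> b = 0" using xy by (metis finite.emptyI finite.insertI insertI1 insertI2)
  qed
  ultimately show "\<exists>x y. indep2 x y \<and> L = line2 x y"
    using xy(1) by (auto simp: line2_eq_span)
next
  assume "\<exists>x y. indep2 x y \<and> L = line2 x y"
  then obtain x y where xy: "indep2 x y" "L = vec.span {x, y}" by (auto simp: line2_eq_span)
  have ne: "x \<noteq> y"
  proof
    assume "x = y"
    then have "1 *s x + (-1) *s y = 0" by simp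
    then show False using xy(1) unfolding indep2_def by fastforce
  qed
  have "vec.independent {x, y}"
  proof (rule vec.independent_if_scalars_zero)
    fix f z assume "(\<Sum>v\<in>{x, y}. f v *s v) = 0" "z \<in> {x, y}"
    then show "f z = 0" using xy(1) ne by (auto simp: indep2_def)
  qed simp
  then have "vec.dim L = 2"
    unfolding xy(2) using vec.dim_span_eq_card_independent ne by force
  then show "L \<in> grassmannian" by (simp add: grassmannian_def xy(2))
qed

lemma pinhole_transpose_inj:
  assumes "pinhole_camera C" "transpose C *v v = 0"
  shows "v = 0"
proof (rule ccontr)
  assume "v \<noteq> 0"
  then obtain k where k: "v $ k \<noteq> 0" by (auto simp: vec_eq_iff)
  \<comment> \<open>A relation between the three rows would put them into the span of two of them.\<close>
  let ?W = "(\<lambda>i. row i C) ` (- {k})"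
  have "(\<Sum>i\<in>UNIV. v $ i *s row i C) = 0"
    using assms(2) matrix_mult_sum[of "transpose C" v] by (simp add: column_transpose)
  then have "v $ k *s row k C + (\<Sum>i\<in>- {k}. v $ i *s row i C) = 0"
    by (simp add: sum.remove[of UNIV k] Compl_eq_Diff_UNIV)
  moreover have "(\<Sum>i\<in>- {k}. v $ i *s row i C) \<in> vec.span ?W"
    by (intro vec.span_sum vec.span_scale vec.span_base imageI)
  ultimately have "row k C \<in> vec.span ?W" using outside_span_coeff k by blast
  then have "row i C \<in> vec.span ?W" for i
    by (cases "i = k") (auto intro: vec.span_base)
  then have "vec.dim (rows C) \<le> card ?W"
    by (intro vec.dim_le_card) (auto simp: rows_def)
  also have "\<dots> \<le> card (- {k})" by (rule card_image_le) simp
  also have "\<dots> = 2" by (simp add: Compl_eq_Diff_UNIV)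
  finally show False using assms(1) by (simp add: pinhole_camera_def row_rank_def_gen)
qed

text \<open>
  The row space of a camera matrix is three-dimensional, and it is contained in the set of
  equations satisfied by a kernel vector \<open>c\<close>, which is three-dimensional as well. So the two
  spaces agree, and every plane through the center is the back-projection of an image line.
  This also makes the kernel one-dimensional, since the equations of a point determine it.
\<close>

lemma pinhole_center:
  assumes "pinhole_camera C"
  obtains c where "c \<noteq> 0" "\<And>x. C *v x = 0 \<longleftrightarrow> (\<exists>k. x = k *s c)"
    "\<And>h. dot c h = 0 \<Longrightarrow> \<exists>v. transpose C *v v = h"
proof -
  have dim_range: "vec.dim (range ((*v) A)) = CARD('n)"
    if "\<And>x. A *v x = 0 \<Longrightarrow> x = 0" for A :: "complex^'n::finite^'k::finite"
  proof -
    have inj: "inj ((*v) A)"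
    proof (rule injI)
      fix x y assume "A *v x = A *v y"
      then have "A *v (x - y) = 0" by (simp add: vec.diff)
      then show "x = y" using that[of "x - y"] by simp
    qed
    have "vec.dim ((*v) A ` UNIV) = vec.dim (UNIV :: (complex^'n) set)"
      by (rule vec.dim_image_eq) (use inj in \<open>auto intro: inj_on_subset\<close>)
    then show ?thesis using vec_dim_card[where 'a = complex and 'n = 'n] by argo
  qed
  have dim_le: "vec.dim S \<le> CARD('n)" for S :: "(complex^'n::finite) set"
    using vec.dim_subset[OF subset_UNIV, of S] vec_dim_card[where 'a = complex and 'n = 'n] by argo
  have "\<not> (\<forall>x. C *v x = 0 \<longrightarrow> x = 0)"
    using dim_range[of C] dim_le[of "range ((*v) C)"] by auto
  then obtain c where c: "C *v c = 0" "c \<noteq> 0" by blast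
  let ?W = "range ((*v) (transpose C))"
  have dimW: "vec.dim ?W = 3" using dim_range[of "transpose C"] pinhole_transpose_inj[OF assms] by simp
  have subW: "vec.subspace ?W"
    using vec.linear_subspace_image[OF matrix_vector_mul_linear_gen vec.subspace_UNIV] .
  let ?H = "{h. dot c h = 0}"
  have subH: "vec.subspace ?H" by (auto simp: vec.subspace_def)
  have "?H \<noteq> UNIV"
  proof
    assume "?H = UNIV"
    then have "dot c h = 0" for h by auto
    then have "dot h c = dot h 0" for h by (simp add: dot_def mult.commute[of "h $ _"])
    then show False using dot_eq_all[of c 0] c(2) by simp
  qed
  then have "vec.dim ?H < vec.dim (UNIV :: (complex^4) set)"
    using subH by (intro vec.dim_psubset) (auto simp: vec.span_eq_iff[THEN iffD2, OF subH])
  then have "vec.dim ?H \<le> 3" unfolding vec_dim_card by simp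
  moreover have "?W \<subseteq> ?H" using c(1) by (auto simp: dot_transpose simp del: transpose_matrix_vector)
  ultimately have W: "?W = ?H" using vec.subspace_dim_equal[OF subW subH] dimW by simp
  show ?thesis
  proof (rule that[OF c(2)])
    show "\<exists>v. transpose C *v v = h" if "dot c h = 0" for h
      using that W by (auto simp: set_eq_iff image_iff) metis
    fix x
    show "C *v x = 0 \<longleftrightarrow> (\<exists>k. x = k *s c)"
    proof
      assume x: "C *v x = 0"
      obtain j where j: "c $ j \<noteq> 0" using c(2) by (auto simp: vec_eq_iff)
      have dot_axis: "dot u (axis k 1) = u $ k" for u :: "complex^4" and k
        by (simp add: dot_def axis_def if_distrib[of "(*) _"] cong: if_cong)
      have dot_diff: "dot u (h - k) = dot u h - dot u k" for u h k :: "complex^4"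
        by (simp add: dot_def algebra_simps sum_subtractf)
      have "x $ k = x $ j / c $ j * c $ k" for k
      proof -
        let ?h = "c $ j *s axis k 1 - c $ k *s axis j 1"
        have "dot c ?h = 0" by (simp add: dot_diff dot_axis)
        then have "?h \<in> ?W" using W by simp
        then obtain v where "?h = transpose C *v v" by blast
        then have "dot x ?h = 0" by (simp add: dot_transpose x del: transpose_matrix_vector)
        then show ?thesis using j by (simp add: dot_diff dot_axis field_simps)
      qed
      then have "x = (x $ j / c $ j) *s c" unfolding vec_eq_iff vector_smult_component by blast
      then show "\<exists>k. x = k *s c" by blast
    next
      assume "\<exists>k. x = k *s c"
      then show "C *v x = 0" using c(1) by (auto simp: vec.scale)
    qed
  qed
qed

text \<open>
  The equations of the images of the line through \<open>t False\<close> and \<open>t True\<close>. They are polynomial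
  in the two points, and they vanish if the line passes through the center.
\<close>

definition line_images :: "('m \<Rightarrow> complex^4^3) \<Rightarrow> (bool \<Rightarrow> complex^4) \<Rightarrow> 'm \<Rightarrow> complex^3" where
  "line_images C t i = cross_product (C i *v t False) (C i *v t True)"

lemma pol_matrix: "polynomial_on_lines (\<lambda>t. (A *v t i) $ j)"
  unfolding matrix_vector_mult_def by (auto intro!: pol_sum pol_mult pol_const pol_coord)

lemma pol_line_images: "polynomial_on_lines (\<lambda>t. line_images C t i $ j)"
proof -
  have "\<forall>j. polynomial_on_lines (\<lambda>t. line_images C t i $ j)"
    unfolding forall_3 line_images_def cross_product_nth
    by (auto intro!: pol_diff pol_mult pol_matrix)
  then show ?thesis by blast
qed

text \<open>
  The vectors \<open>c i\<close> represent the centers, and the assumptions are the consequences of the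
  rank condition that the geometry uses: image lines have back-projections, and these are
  exactly the planes through the center.
\<close>

locale cameras =
  fixes C :: "'m::finite \<Rightarrow> complex^4^3" and c :: "'m \<Rightarrow> complex^4"
  assumes transpose_inj: "transpose (C i) *v v = 0 \<Longrightarrow> v = 0"
    and c_nz: "c i \<noteq> 0"
    and ker: "C i *v x = 0 \<longleftrightarrow> (\<exists>k. x = k *s c i)"
    and range_transpose: "dot (c i) h = 0 \<Longrightarrow> \<exists>v. transpose (C i) *v v = h"
    and distinct: "i \<noteq> j \<Longrightarrow> c i \<noteq> k *s c j"
begin

lemma C_c [simp]: "C i *v c i = 0"
  unfolding ker by (rule exI[of _ 1]) simp

lemma center_subset_iff: "vec.subspace L \<Longrightarrow> center (C i) \<subseteq> L \<longleftrightarrow> c i \<in> L"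
proof
  assume "center (C i) \<subseteq> L"
  then show "c i \<in> L" by (auto simp: center_def)
next
  assume "vec.subspace L" "c i \<in> L"
  then show "center (C i) \<subseteq> L" by (auto simp: center_def ker vec.subspace_scale)
qed

lemma combination_cross:
  assumes "C i *v (a *s x + b *s y) = 0" "a \<noteq> 0 \<or> b \<noteq> 0"
  shows "cross_product (C i *v x) (C i *v y) = 0"
proof -
  let ?X = "C i *v x" and ?Y = "C i *v y"
  have 0: "a *s ?X + b *s ?Y = 0" using assms(1) by (simp add: vec.add vec.scale)
  have "b *s cross_product ?X ?Y = cross_product ?X (a *s ?X + b *s ?Y)"
    by (simp add: cross_product_bilinear)
  moreover have "a *s cross_product ?X ?Y = cross_product (a *s ?X + b *s ?Y) ?Y"
    by (simp add: cross_product_bilinear)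
  ultimately show ?thesis using 0 assms(2) by auto
qed

lemma cross_nonzero_indep2:
  assumes "cross_product (C i *v x) (C i *v y) \<noteq> 0"
  shows "indep2 x y"
  unfolding indep2_def using combination_cross[of i _ x _ y] assms
  by (metis matrix_vector_mult_0_right)

lemma cross_eq_0_iff:
  assumes "indep2 x y"
  shows "cross_product (C i *v x) (C i *v y) = 0 \<longleftrightarrow> c i \<in> line2 x y"
proof
  assume 0: "cross_product (C i *v x) (C i *v y) = 0"
  have "\<exists>a b. (a \<noteq> 0 \<or> b \<noteq> 0) \<and> C i *v (a *s x + b *s y) = 0"
  proof (cases "C i *v x = 0")
    case True
    then show ?thesis by (intro exI[of _ 1] exI[of _ 0]) simp
  next
    case False
    then obtain k where "C i *v y = k *s (C i *v x)" using cross_product_eq_0[OF 0] by blast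
    then have "C i *v ((- k) *s x + 1 *s y) = 0"
      unfolding vec.add vec.scale by (simp add: vec_eq_iff)
    then show ?thesis using zero_neq_one by metis
  qed
  then obtain a b k where ab: "a \<noteq> 0 \<or> b \<noteq> 0" "a *s x + b *s y = k *s c i"
    unfolding ker by blast
  have k: "k \<noteq> 0" using ab assms unfolding indep2_def by (metis vec.scale_zero_left)
  have "c i = (1 / k) *s (k *s c i)" using k by simp
  also have "\<dots> = (a / k) *s x + (b / k) *s y" using k by (simp flip: ab(2) add: vec_eq_iff field_simps)
  finally show "c i \<in> line2 x y" by (auto simp: line2_def)
next
  assume "c i \<in> line2 x y"
  then obtain a b where ab: "c i = a *s x + b *s y" by (auto simp: line2_def)
  then have "a \<noteq> 0 \<or> b \<noteq> 0" using c_nz[of i] by auto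
  then show "cross_product (C i *v x) (C i *v y) = 0"
    using combination_cross[of i a x b y] ab C_c[of i] by simp
qed

text \<open>
  A line does not pass through a center if it is contained in a plane that does not contain
  the center.
\<close>

lemma cross_nonzero_witness:
  assumes "indep2 x y" "dot x h = 0" "dot y h = 0" "dot (c i) h \<noteq> 0"
  shows "cross_product (C i *v x) (C i *v y) \<noteq> 0"
proof
  assume "cross_product (C i *v x) (C i *v y) = 0"
  then obtain a b where "c i = a *s x + b *s y"
    using cross_eq_0_iff[OF assms(1)] by (auto simp: line2_def)
  then show False using assms by simp
qed

lemma camera_line_line2:
  assumes "cross_product (C i *v x) (C i *v y) \<noteq> 0"
  shows "camera_line (C i) (line2 x y) = vec.span {cross_product (C i *v x) (C i *v y)}"
proof -
  let ?X = "C i *v x" and ?Y = "C i *v y"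
  have "l \<in> camera_line (C i) (line2 x y) \<longleftrightarrow> dot ?X l = 0 \<and> dot ?Y l = 0" for l
  proof -
    have "l \<in> camera_line (C i) (line2 x y) \<longleftrightarrow> (\<forall>a b. dot (C i *v (a *s x + b *s y)) l = 0)"
      unfolding camera_line_def line_equation_def line2_def dot_def by auto
    also have "\<dots> \<longleftrightarrow> (\<forall>a b. a * dot ?X l + b * dot ?Y l = 0)"
      by (simp add: vec.add vec.scale)
    also have "\<dots> \<longleftrightarrow> dot ?X l = 0 \<and> dot ?Y l = 0"
    proof
      assume *: "\<forall>a b. a * dot ?X l + b * dot ?Y l = 0"
      show "dot ?X l = 0 \<and> dot ?Y l = 0"
        using *[THEN spec[of _ 1], THEN spec[of _ 0]] *[THEN spec[of _ 0], THEN spec[of _ 1]] by simp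
    qed simp
    finally show ?thesis .
  qed
  moreover have "dot ?X l = 0 \<and> dot ?Y l = 0 \<longleftrightarrow> l \<in> vec.span {cross_product ?X ?Y}" for l
    using orthogonal_to_both[OF assms, of l] by (auto simp: vec.span_singleton)
  ultimately show ?thesis by blast
qed

lemma joint_camera_image:
  "joint_camera_map C ` joint_camera_domain C = param_set (line_images C) UNIV"
proof (intro equalityI subsetI)
  fix l assume "l \<in> joint_camera_map C ` joint_camera_domain C"
  then obtain L where L: "L \<in> grassmannian" "\<forall>i. \<not> center (C i) \<subseteq> L" "l = joint_camera_map C L"
    by (auto simp: joint_camera_domain_def)
  obtain x y where xy: "indep2 x y" "L = line2 x y" using L(1) grassmannian_iff by blast
  have "vec.subspace L" using L(1) by (simp add: grassmannian_def)
  then have nz: "cross_product (C i *v x) (C i *v y) \<noteq> 0" for i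
    using L(2) center_subset_iff cross_eq_0_iff[OF xy(1)] xy(2) by blast
  let ?t = "\<lambda>b. if b then y else x"
  have "l = pt (line_images C ?t)"
    by (simp add: L(3) xy(2) joint_camera_map_def pt_def line_images_def camera_line_line2[OF nz])
  moreover have "line_images C ?t i \<noteq> 0" for i using nz by (simp add: line_images_def)
  ultimately show "l \<in> param_set (line_images C) UNIV"
    unfolding param_set_def by blast
next
  fix l assume "l \<in> param_set (line_images C) UNIV"
  then obtain t where t: "l = pt (line_images C t)" "\<And>i. line_images C t i \<noteq> 0"
    by (auto simp: param_set_def)
  let ?x = "t False" and ?y = "t True"
  have nz: "cross_product (C i *v ?x) (C i *v ?y) \<noteq> 0" for i
    using t(2)[of i] by (simp add: line_images_def)
  then have ind: "indep2 ?x ?y" by (rule cross_nonzero_indep2)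
  have G: "line2 ?x ?y \<in> grassmannian" using ind grassmannian_iff by blast
  then have "vec.subspace (line2 ?x ?y)" by (simp add: grassmannian_def)
  then have "line2 ?x ?y \<in> joint_camera_domain C"
    using G nz center_subset_iff cross_eq_0_iff[OF ind] by (simp add: joint_camera_domain_def)
  moreover have "l = joint_camera_map C (line2 ?x ?y)"
    by (simp add: t(1) joint_camera_map_def pt_def line_images_def camera_line_line2[OF nz])
  ultimately show "l \<in> joint_camera_map C ` joint_camera_domain C" by blast
qed

lemma line_multiview_variety_eq:
  "line_multiview_variety C = zariski closure_of param_set (line_images C) UNIV"
  by (simp add: line_multiview_variety_def joint_camera_image)

end

section \<open>Irreducibility and dimension of the line multiview variety\<close>

lemma form_dot: "form (\<lambda>k. if k = i then 1 else 0) (\<lambda>x. dot a (x i))"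
  unfolding dot_def by (rule form_linear)

lemma affine_closed_UNIV: "affine_closed UNIV"
  by (simp add: affine_closed_def)

lemma affine_closed_subspaces:
  assumes "\<And>i. vec.subspace (V i)"
  shows "affine_closed {t. \<forall>i. t i \<in> V i}"
  unfolding affine_closed_def
  by (auto intro!: vec.subspace_add vec.subspace_scale vec.subspace_diff assms)

lemma param_closure_psubset:
  fixes \<psi> :: "('i \<Rightarrow> complex^'k::finite) \<Rightarrow> 'm::finite \<Rightarrow> complex^'n::finite"
  assumes "S \<subseteq> T" "affine_closed T" "\<And>i j. polynomial_on_lines (\<lambda>t. \<psi> t i $ j)"
    "t0 \<in> T" "\<And>i. \<psi> t0 i \<noteq> 0" "form d F" "\<And>t. t \<in> S \<Longrightarrow> F (\<psi> t) = 0" "u \<in> T" "F (\<psi> u) \<noteq> 0"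
  shows "zariski closure_of param_set \<psi> S \<subset> zariski closure_of param_set \<psi> T"
proof -
  have sub: "zariski closure_of param_set \<psi> S \<subseteq> zariski closure_of param_set \<psi> T"
    by (intro closure_of_mono param_set_mono assms)
  have "\<exists>t\<in>T. \<psi> t i \<noteq> 0" for i using assms(4) assms(5)[of i] by blast
  from common_nonvanishing[of T \<psi>, OF assms(2,3) this pol_form[OF assms(6,3)] assms(8,9)]
  obtain t where t: "t \<in> T" "\<And>i. \<psi> t i \<noteq> 0" "F (\<psi> t) \<noteq> 0" by blast
  have "vanishes_on F (zariski closure_of param_set \<psi> S)"
    using assms(6,7) by (intro vanishes_on_closure param_set_proj) (auto simp: vanishes_on_param_set)
  moreover have "pt (\<psi> t) \<in> zariski closure_of param_set \<psi> T"
    using t closure_of_subset[of "param_set \<psi> T" zariski] param_set_proj[of \<psi> T]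
    by (auto simp: param_set_def)
  moreover have "F (reps (pt (\<psi> t))) \<noteq> 0" using form_reps_pt[OF assms(6), of "\<psi> t"] t by simp
  ultimately show ?thesis using sub by (auto simp: vanishes_on_def)
qed

text \<open>
  The affine chart of the Grassmannian in which the Plucker coordinate of the first two
  coordinates is not zero: there a line has a unique basis of this shape.
\<close>

definition chart_line :: "complex^4 \<Rightarrow> bool \<Rightarrow> complex^4" where
  "chart_line t b = (\<chi> k. if b then (if k = 1 then 0 else if k = 2 then 1 else if k = 3 then t$3 else t$4)
    else (if k = 1 then 1 else if k = 2 then 0 else if k = 3 then t$1 else t$2))"

lemma bounded_polys_diff:
  assumes "f \<in> bounded_polys B" "g \<in> bounded_polys B"
  shows "(\<lambda>t. f t - g t) \<in> bounded_polys B"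
  using bounded_polys_add[OF assms(1) bounded_polys_scale[OF assms(2), of "-1"]] by simp

lemma bounded_polys_chart:
  "(\<lambda>t. line_images C (chart_line t) i $ j) \<in> bounded_polys 2"
proof -
  have "\<forall>k. (\<lambda>t. chart_line t b $ k) \<in> bounded_polys 1" for b
    unfolding forall_4 chart_line_def
    by (cases b) (simp_all add: bounded_polys_const bounded_polys_coord[simplified])
  then have "(\<lambda>t. (A *v chart_line t b) $ j) \<in> bounded_polys 1" for A :: "complex^4^3" and b j
    unfolding matrix_vector_mult_def by (auto intro!: bounded_polys_sum bounded_polys_scale simp del: One_nat_def)
  from bounded_polys_mult[OF this this]
  have mult: "(\<lambda>t. (A *v chart_line t b) $ j * (A' *v chart_line t b') $ j') \<in> bounded_polys 2"
    for A A' :: "complex^4^3" and b j b' j'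
    by (simp add: numeral_2_eq_2)
  have "\<forall>j. (\<lambda>t. line_images C (chart_line t) i $ j) \<in> bounded_polys 2"
    unfolding forall_3 line_images_def cross_product_nth
    by (intro conjI bounded_polys_diff mult)
  then show ?thesis by blast
qed

text \<open>
  A change of basis of the line multiplies all image equations by its determinant, so outside
  the hypersurface where the Plucker coordinate vanishes every line is covered by the chart.
\<close>

lemma line_images_chart:
  assumes "t False $ 1 * t True $ 2 - t False $ 2 * t True $ 1 \<noteq> 0"
  obtains u where "line_images C t =
    (\<lambda>i. (t False $ 1 * t True $ 2 - t False $ 2 * t True $ 1) *s line_images C (chart_line u) i)"
proof -
  let ?x = "t False" and ?y = "t True"
  let ?D = "?x $ 1 * ?y $ 2 - ?x $ 2 * ?y $ 1"
  define u :: "complex^4" where "u = (\<chi> k.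
      if k = 1 then (?y$2 * ?x$3 - ?x$2 * ?y$3) / ?D
      else if k = 2 then (?y$2 * ?x$4 - ?x$2 * ?y$4) / ?D
      else if k = 3 then (?x$1 * ?y$3 - ?y$1 * ?x$3) / ?D
      else (?x$1 * ?y$4 - ?y$1 * ?x$4) / ?D)"
  let ?x' = "chart_line u False" and ?y' = "chart_line u True"
  have comb: "?x = ?x$1 *s ?x' + ?x$2 *s ?y'" "?y = ?y$1 *s ?x' + ?y$2 *s ?y'"
    using assms unfolding vec_eq_iff forall_4
    by (simp_all add: chart_line_def u_def divide_simps) (simp_all add: algebra_simps)
  have "line_images C t i = ?D *s line_images C (chart_line u) i" for i
  proof -
    let ?X = "C i *v ?x'" and ?Y = "C i *v ?y'"
    have "line_images C t i = cross_product (?x$1 *s ?X + ?x$2 *s ?Y) (?y$1 *s ?X + ?y$2 *s ?Y)"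
      unfolding line_images_def by (subst comb(1), subst comb(2)) (simp add: vec.add vec.scale)
    also have "\<dots> = ?D *s cross_product ?X ?Y"
      by (simp add: cross_simps algebra_simps)
    finally show ?thesis by (simp add: line_images_def)
  qed
  then show ?thesis by (intro that[of u]) auto
qed

context cameras begin

lemma ex_line_avoiding_center: "\<exists>t. line_images C t i \<noteq> 0"
proof -
  obtain w where w: "w \<notin> vec.span {c i}" using ex_outside_span[of "{c i}"] by auto
  have "indep2 (c i) w"
    unfolding indep2_def
  proof (intro allI impI)
    fix a b assume ab: "a *s c i + b *s w = 0"
    have "a *s c i \<in> vec.span {c i}" by (intro vec.span_scale vec.span_base) auto
    from outside_span_coeff[OF w this] have "b = 0" using ab by (simp add: add.commute)
    then show "a = 0 \<and> b = 0" using ab c_nz by simp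
  qed
  then obtain r s \<phi> f g where *: "dot (c i) \<phi> = 1" "dot r \<phi> = 0" "dot s \<phi> = 0"
      "dot r f = 1" "dot r g = 0" "dot s f = 0" "dot s g = 1"
    using adapted_basis[of "c i" w] by metis
  have "indep2 r s"
    unfolding indep2_def
  proof (intro allI impI)
    fix a b assume "a *s r + b *s s = 0"
    then have "dot (a *s r + b *s s) f = 0" "dot (a *s r + b *s s) g = 0" by simp_all
    then show "a = 0 \<and> b = 0" using * by simp
  qed
  then have "cross_product (C i *v r) (C i *v s) \<noteq> 0"
    using * by (intro cross_nonzero_witness[of r s \<phi>]) auto
  then show ?thesis by (intro exI[of _ "\<lambda>b. if b then s else r"]) (simp add: line_images_def)
qed

text \<open>
  Both being skew to a given line and avoiding a center are polynomial inequalities that can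
  be satisfied, so they can be satisfied together. The vectors \<open>a\<close>, \<open>b\<close>, \<open>x\<close>, \<open>y\<close> form a
  basis, and the functionals form its dual basis.
\<close>

lemma ex_line_skew_to:
  assumes "indep2 a b"
  obtains x y \<alpha> \<beta> \<xi> \<eta> where
    "\<And>i. cross_product (C i *v x) (C i *v y) \<noteq> 0"
    "dot a \<alpha> = 1" "dot a \<beta> = 0" "dot a \<xi> = 0" "dot a \<eta> = 0"
    "dot b \<alpha> = 0" "dot b \<beta> = 1" "dot b \<xi> = 0" "dot b \<eta> = 0"
    "dot x \<alpha> = 0" "dot x \<beta> = 0" "dot x \<xi> = 1" "dot x \<eta> = 0"
    "dot y \<alpha> = 0" "dot y \<beta> = 0" "dot y \<xi> = 0" "dot y \<eta> = 1"
proof -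
  obtain r s f g where fr: "dot a f = 0" "dot a g = 0" "dot b f = 0" "dot b g = 0"
      "dot r f = 1" "dot r g = 0" "dot s f = 0" "dot s g = 1"
    using adapted_basis[OF assms] by metis
  have pol_dot': "polynomial_on_lines (\<lambda>t. dot (t i) h)" for i and h :: "complex^4"
    unfolding dot_def by (intro pol_sum pol_mult pol_const pol_coord)
  let ?D = "\<lambda>t :: bool \<Rightarrow> complex^4. dot (t False) f * dot (t True) g - dot (t False) g * dot (t True) f"
  have D: "polynomial_on_lines ?D" by (intro pol_diff pol_mult pol_dot')
  have D1: "?D (\<lambda>b. if b then s else r) \<noteq> 0" by (simp add: fr)
  have "\<exists>t\<in>UNIV. line_images C t i \<noteq> 0" for i using ex_line_avoiding_center by simp
  from common_nonvanishing[of UNIV "line_images C" ?D "\<lambda>b. if b then s else r",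
      OF affine_closed_UNIV pol_line_images this D UNIV_I D1]
  obtain t where t: "\<And>i. line_images C t i \<noteq> 0" "?D t \<noteq> 0" by blast
  let ?x = "t False" and ?y = "t True"
  define e :: "4 \<Rightarrow> complex^4" where "e = (\<lambda>i. if i = 1 then a else if i = 2 then b else if i = 3 then ?x else ?y)"
  have ind: "\<forall>i. k i = 0" if k: "(\<Sum>i\<in>UNIV. k i *s e i) = 0" for k
  proof -
    have sum: "k 1 *s a + k 2 *s b + k 3 *s ?x + k 4 *s ?y = 0"
      using k by (simp add: sum_4 e_def)
    then have "dot (k 1 *s a + k 2 *s b + k 3 *s ?x + k 4 *s ?y) f = 0"
        "dot (k 1 *s a + k 2 *s b + k 3 *s ?x + k 4 *s ?y) g = 0" by simp_all
    then have eqs: "k 3 * dot ?x f + k 4 * dot ?y f = 0" "k 3 * dot ?x g + k 4 * dot ?y g = 0"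
      by (simp_all add: fr)
    have "k 3 * ?D t = (k 3 * dot ?x f + k 4 * dot ?y f) * dot ?y g - (k 3 * dot ?x g + k 4 * dot ?y g) * dot ?y f"
      by (simp add: algebra_simps)
    then have k3: "k 3 = 0" using eqs t(2) by simp
    have "k 4 * ?D t = (k 3 * dot ?x g + k 4 * dot ?y g) * dot ?x f - (k 3 * dot ?x f + k 4 * dot ?y f) * dot ?x g"
      by (simp add: algebra_simps)
    then have k4: "k 4 = 0" using eqs t(2) by simp
    show ?thesis using assms sum k3 k4 by (simp add: forall_4 indep2_def)
  qed
  from dual_basis[of e, OF ind]
  obtain \<beta> where \<beta>: "\<And>i j. dot (e i) (\<beta> j) = (if i = j then 1 else 0)" by blast
  show ?thesis
    by (rule that[of ?x ?y "\<beta> 1" "\<beta> 2" "\<beta> 3" "\<beta> 4"])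
      (use t(1) \<beta>[of 1] \<beta>[of 2] \<beta>[of 3] \<beta>[of 4] in \<open>auto simp: e_def line_images_def\<close>)
qed

text \<open>
  A plane through the center \<open>c i\<close> and the points \<open>x\<close> and \<open>y\<close> does not contain \<open>z\<close> if the four
  points are independent, which is witnessed by \<open>h\<close>.
\<close>

lemma triple_nonzero:
  assumes "cross_product (C i *v x) (C i *v y) \<noteq> 0"
    "dot (c i) h = 0" "dot x h = 0" "dot y h = 0" "dot z h \<noteq> 0"
  shows "dot (C i *v z) (cross_product (C i *v x) (C i *v y)) \<noteq> 0"
proof
  assume "dot (C i *v z) (cross_product (C i *v x) (C i *v y)) = 0"
  from triple_product_eq_0[OF assms(1) this] obtain k l where
    "C i *v z = k *s (C i *v x) + l *s (C i *v y)" by blast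
  then have "C i *v (z - (k *s x + l *s y)) = 0" by (simp add: vec.diff vec.add vec.scale)
  then obtain m where "z - (k *s x + l *s y) = m *s c i" unfolding ker by blast
  then have "dot (z - (k *s x + l *s y)) h = dot (m *s c i) h" by simp
  then show False using assms by simp
qed

lemma irreducible_line_family:
  assumes "affine_closed T" "t \<in> T" "\<And>i. line_images C t i \<noteq> 0"
  shows "irreducible_space (subtopology zariski (zariski closure_of param_set (line_images C) T))"
  using assms by (intro irreducible_param_closure pol_line_images)

lemma ex_line_avoiding_centers: "\<exists>t. \<forall>i. line_images C t i \<noteq> 0"
proof -
  have "\<exists>t\<in>UNIV. line_images C t i \<noteq> 0" for i using ex_line_avoiding_center by simp
  from common_nonvanishing[of UNIV "line_images C" "\<lambda>_. 1", OF affine_closed_UNIV pol_line_images this pol_const UNIV_I]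
  show ?thesis by auto
qed

lemma irreducible_line_multiview_variety:
  "irreducible_space (subtopology zariski (line_multiview_variety C))"
  using ex_line_avoiding_centers irreducible_line_family[OF affine_closed_UNIV]
  by (auto simp: line_multiview_variety_eq)

lemma line_multiview_variety_proj: "line_multiview_variety C \<subseteq> proj_product"
  using closure_of_subset_topspace[of zariski] by (simp add: line_multiview_variety_def)

lemma krull_dim_line_multiview_variety_le:
  "krull_dim (subtopology zariski (line_multiview_variety C)) \<le> 4"
proof -
  let ?D = "\<lambda>t :: bool \<Rightarrow> complex^4. t False $ 1 * t True $ 2 - t False $ 2 * t True $ 1"
  obtain t0 where t0: "\<And>i. line_images C t0 i \<noteq> 0" using ex_line_avoiding_centers by blast
  have pD: "polynomial_on_lines ?D" by (intro pol_diff pol_mult pol_coord)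
  have D1: "?D (\<lambda>b. if b then axis 2 1 else axis 1 1) \<noteq> 0" by (simp add: axis_def)
  have "vanishes_on F (line_multiview_variety C)"
    if F: "form d F" and 0: "\<And>t. F (line_images C (chart_line t)) = 0" for d F
  proof -
    have "F (line_images C t) = 0" if Dt: "?D t \<noteq> 0" for t
    proof -
      obtain u where u: "line_images C t = (\<lambda>i. ?D t *s line_images C (chart_line u) i)"
        using line_images_chart[OF Dt, of C] by blast
      show ?thesis unfolding u using form_eq_0_scale[OF F, of "\<lambda>_. ?D t"] Dt 0 by simp
    qed
    then have "F (line_images C t) = 0" for t
      using vanishes_on_generic[of UNIV "line_images C" t0 ?D "\<lambda>b. if b then axis 2 1 else axis 1 1"
          "\<lambda>t. F (line_images C t)" t, OF affine_closed_UNIV pol_line_images UNIV_I t0 pD UNIV_I D1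
          pol_form[OF F pol_line_images]] by simp
    then show ?thesis
      unfolding line_multiview_variety_eq
      by (intro vanishes_on_closure[OF param_set_proj F]) (simp add: vanishes_on_param_set[OF F])
  qed
  from krull_dim_param_le[of "\<lambda>t. line_images C (chart_line t)" 2 "line_multiview_variety C",
      OF bounded_polys_chart this line_multiview_variety_proj]
  show ?thesis by (simp add: numeral_eq_enat)
qed

lemma indep2_centers:
  assumes "i \<noteq> j"
  shows "indep2 (c i) (c j)"
  unfolding indep2_def
proof (intro allI impI)
  fix a b assume ab: "a *s c i + b *s c j = 0"
  have "a = 0"
  proof (rule ccontr)
    assume a: "a \<noteq> 0"
    have "a *s c i = - (b *s c j)" using ab by (simp add: eq_neg_iff_add_eq_0)
    then have "(1 / a) *s (a *s c i) = (1 / a) *s (- (b *s c j))" by simp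
    then have "c i = (- b / a) *s c j" using a by (simp add: vec_eq_iff)
    then show False using distinct[OF assms] by blast
  qed
  then show "a = 0 \<and> b = 0" using ab c_nz by simp
qed

text \<open>
  Let the line through \<open>x\<close> and \<open>y\<close> be skew to the line through the two centers \<open>c i\<close> and \<open>c
  j\<close>, and take the following families of lines: that line itself; the lines through \<open>x\<close> in the
  plane spanned by \<open>x\<close>, \<open>y\<close> and \<open>c i\<close>; all lines through \<open>x\<close>; all lines meeting the line
  through \<open>x\<close> and \<open>c i\<close>; all lines. They are parametrized by two points that vary in linear
  subspaces. Each inclusion of closures is strict, since the line in image \<open>i\<close> or \<open>j\<close> has to
  pass through the image of \<open>x\<close> or of \<open>y\<close> for the smaller family, but not for the larger one.
\<close>

lemma krull_dim_line_multiview_variety_ge: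
  fixes i j :: 'm
  assumes "i \<noteq> j"
  shows "4 \<le> krull_dim (subtopology zariski (line_multiview_variety C))"
proof -
  obtain x y \<alpha> \<beta> \<xi> \<eta> where nz: "\<And>k. cross_product (C k *v x) (C k *v y) \<noteq> 0"
    and d: "dot (c i) \<alpha> = 1" "dot (c i) \<beta> = 0" "dot (c i) \<xi> = 0" "dot (c i) \<eta> = 0"
    "dot (c j) \<alpha> = 0" "dot (c j) \<beta> = 1" "dot (c j) \<xi> = 0" "dot (c j) \<eta> = 0"
    "dot x \<alpha> = 0" "dot x \<beta> = 0" "dot x \<xi> = 1" "dot x \<eta> = 0"
    "dot y \<alpha> = 0" "dot y \<beta> = 0" "dot y \<xi> = 0" "dot y \<eta> = 1"
    by (rule ex_line_skew_to[OF indep2_centers[OF assms]]) (rule that)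
  define T where "T = (\<lambda>V W. {t :: bool \<Rightarrow> complex^4. \<forall>b. t b \<in> vec.span (if b then W else V)})"
  define V where "V = (\<lambda>k::nat. if k \<le> 2 then {x} else if k = 3 then {x, c i} else UNIV)"
  define W where "W = (\<lambda>k::nat. if k = 0 then {y} else if k = 1 then {y, c i}
      else if k \<le> 3 then {y, c i, c j} else UNIV)"
  define Z where "Z = (\<lambda>k. zariski closure_of param_set (line_images C) (T (V k) (W k)))"
  have aff: "affine_closed (T V W)" for V W
    unfolding T_def by (rule affine_closed_subspaces) (rule vec.subspace_span)
  let ?L = "\<lambda>x y b. if b then y else x"
  have inT: "?L u v \<in> T V W \<longleftrightarrow> u \<in> vec.span V \<and> v \<in> vec.span W" for u v V W
    by (auto simp: T_def split: if_splits)
  have base: "?L x y \<in> T (V k) (W k)" for k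
    unfolding inT by (auto simp: V_def W_def intro: vec.span_base)
  have nz': "line_images C (?L x y) k \<noteq> 0" for k using nz by (simp add: line_images_def)
  have Tmono: "T (V k) (W k) \<subseteq> T (V (Suc k)) (W (Suc k))" for k
  proof -
    have "V k \<subseteq> V (Suc k)" "W k \<subseteq> W (Suc k)" by (auto simp: V_def W_def)
    then have "vec.span (V k) \<subseteq> vec.span (V (Suc k))" "vec.span (W k) \<subseteq> vec.span (W (Suc k))"
      by (auto intro: vec.span_mono[THEN subsetD])
    then show ?thesis by (auto simp: T_def split: if_splits)
  qed
  have step: "Z k \<subset> Z (Suc k)"
    if F: "form d F" "\<And>t. t \<in> T (V k) (W k) \<Longrightarrow> F (line_images C t) = 0"
      "?L u v \<in> T (V (Suc k)) (W (Suc k))" "F (line_images C (?L u v)) \<noteq> 0" for k d F u v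
    unfolding Z_def
    using param_closure_psubset[of "T (V k) (W k)" "T (V (Suc k)) (W (Suc k))" "line_images C"
        "?L x y" d F "?L u v", OF Tmono aff pol_line_images base nz' F(1,2,3,4)] .
  have ind: "indep2 u v" if "dot u h = 1" "dot v h = 0" "dot u h' = 0" "dot v h' = 1" for u v h h' :: "complex^4"
    unfolding indep2_def
  proof (intro allI impI)
    fix a b assume "a *s u + b *s v = 0"
    then have "dot (a *s u + b *s v) h = 0" "dot (a *s u + b *s v) h' = 0" by simp_all
    then show "a = 0 \<and> b = 0" by (simp add: that)
  qed
  have cr1: "cross_product (C j *v x) (C j *v c i) \<noteq> 0"
    by (rule cross_nonzero_witness[OF ind[of x \<xi> "c i" \<alpha>], of \<beta>]) (simp_all add: d)
  have cr2: "cross_product (C i *v x) (C i *v c j) \<noteq> 0"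
    by (rule cross_nonzero_witness[OF ind[of x \<xi> "c j" \<beta>], of \<alpha>]) (simp_all add: d)
  have cr3: "cross_product (C j *v c i) (C j *v y) \<noteq> 0"
    by (rule cross_nonzero_witness[OF ind[of "c i" \<alpha> y \<eta>], of \<beta>]) (simp_all add: d)
  have cr4: "cross_product (C i *v c j) (C i *v y) \<noteq> 0"
    by (rule cross_nonzero_witness[OF ind[of "c j" \<beta> y \<eta>], of \<alpha>]) (simp_all add: d)
  have "Z 0 \<subset> Z (Suc 0)"
  proof (rule step[OF form_dot[of j "C j *v y"], of _ "y + c i" x])
    fix t assume "t \<in> T (V 0) (W 0)"
    then have "t False \<in> vec.span {x}" "t True \<in> vec.span {y}"
      by (auto simp: T_def V_def W_def all_bool_eq)
    then show "dot (C j *v y) (line_images C t j) = 0"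
      by (auto simp: vec.span_singleton line_images_def vec.scale cross_product_bilinear)
  next
    show "?L x (y + c i) \<in> T (V (Suc 0)) (W (Suc 0))"
      unfolding inT by (auto simp: V_def W_def intro: vec.span_base vec.span_add)
    show "dot (C j *v y) (line_images C (?L x (y + c i)) j) \<noteq> 0"
      using triple_nonzero[OF cr1, of \<eta> y] d
      by (simp add: line_images_def vec.add cross_product_bilinear)
  qed
  moreover have "Z 1 \<subset> Z (Suc 1)"
  proof (rule step[OF form_dot[of i "C i *v y"], of _ "y + c j" x])
    fix t assume "t \<in> T (V 1) (W 1)"
    then have "t False \<in> vec.span {x}" "t True \<in> line2 y (c i)"
      by (auto simp: T_def V_def W_def all_bool_eq line2_eq_span)
    then show "dot (C i *v y) (line_images C t i) = 0"
      by (auto simp: vec.span_singleton line2_def line_images_def vec.scale vec.add cross_product_bilinear)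
  next
    show "?L x (y + c j) \<in> T (V (Suc 1)) (W (Suc 1))"
      unfolding inT by (auto simp: V_def W_def intro: vec.span_base vec.span_add)
    show "dot (C i *v y) (line_images C (?L x (y + c j)) i) \<noteq> 0"
      using triple_nonzero[OF cr2, of \<eta> y] d
      by (simp add: line_images_def vec.add cross_product_bilinear)
  qed
  moreover have "Z 2 \<subset> Z (Suc 2)"
  proof (rule step[OF form_dot[of j "C j *v x"], of _ y "x + c i"])
    fix t assume "t \<in> T (V 2) (W 2)"
    then have "t False \<in> vec.span {x}"
      by (auto simp: T_def V_def W_def all_bool_eq)
    then show "dot (C j *v x) (line_images C t j) = 0"
      by (auto simp: vec.span_singleton line_images_def vec.scale cross_product_bilinear)
  next
    show "?L (x + c i) y \<in> T (V (Suc 2)) (W (Suc 2))"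
      unfolding inT by (auto simp: V_def W_def intro: vec.span_base vec.span_add)
    show "dot (C j *v x) (line_images C (?L (x + c i) y) j) \<noteq> 0"
      using triple_nonzero[OF cr3, of \<xi> x] d
      by (simp add: line_images_def vec.add cross_product_bilinear)
  qed
  moreover have "Z 3 \<subset> Z (Suc 3)"
  proof (rule step[OF form_dot[of i "C i *v x"], of _ y "x + c j"])
    fix t assume "t \<in> T (V 3) (W 3)"
    then have "t False \<in> line2 x (c i)"
      by (auto simp: T_def V_def W_def all_bool_eq line2_eq_span)
    then show "dot (C i *v x) (line_images C t i) = 0"
      by (auto simp: line2_def line_images_def vec.scale vec.add cross_product_bilinear)
  next
    show "?L (x + c j) y \<in> T (V (Suc 3)) (W (Suc 3))"
      unfolding inT by (auto simp: V_def W_def)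
    show "dot (C i *v x) (line_images C (?L (x + c j) y) i) \<noteq> 0"
      using triple_nonzero[OF cr4, of \<xi> x] d
      by (simp add: line_images_def vec.add cross_product_bilinear)
  qed
  moreover have four: "k = 0 \<or> k = 1 \<or> k = 2 \<or> k = 3" if "k < 4" for k :: nat using that by auto
  ultimately have strict: "Z k \<subset> Z (Suc k)" if "k < 4" for k using that four by blast
  have "enat 4 \<le> krull_dim (subtopology zariski (line_multiview_variety C))"
  proof (rule krull_dim_ge)
    fix k :: nat
    show "closedin zariski (Z k)" by (simp add: Z_def)
    show "Z k \<subseteq> line_multiview_variety C"
      unfolding Z_def line_multiview_variety_eq by (intro closure_of_mono param_set_mono) simp
    show "irreducible_space (subtopology zariski (Z k))"
      unfolding Z_def by (rule irreducible_line_family[OF aff base nz'])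
  qed (rule strict)
  then show ?thesis by (simp add: numeral_eq_enat)
qed

end

section \<open>The rank locus\<close>

lemma rank_le_2_iff:
  fixes M :: "complex^'m::finite^4"
  shows "rank M \<le> 2 \<longleftrightarrow> (\<exists>p q P Q. \<forall>i. column i M = P i *s p + Q i *s q)"
proof
  assume "rank M \<le> 2"
  then have "vec.dim (rows M) \<le> 2" by (simp add: row_rank_def_gen)
  then obtain B where B: "vec.independent B" "rows M \<subseteq> vec.span B" "card B \<le> 2"
    using vec.basis_exists[of "rows M"] by metis
  have "finite B" using B(1) by (rule vec.finiteI_independent)
  have "\<exists>P Q. B \<subseteq> {P, Q}"
  proof -
    consider "card B = 0" | "card B = 1" | "card B = 2" using B(3) by linarith
    then show ?thesis
      by cases (use \<open>finite B\<close> in \<open>auto simp: card_1_singleton_iff card_2_iff\<close>)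
  qed
  then obtain P Q where "B \<subseteq> {P, Q}" by blast
  then have "rows M \<subseteq> line2 P Q"
    using B(2) vec.span_mono unfolding line2_eq_span by blast
  then have "\<exists>a b. row r M = a *s P + b *s Q" for r
    unfolding line2_def rows_def by blast
  then obtain p q where pq: "\<And>r. row r M = p r *s P + q r *s Q" by metis
  have "M $ r $ i = p r * P $ i + q r * Q $ i" for r i
    using arg_cong[OF pq[of r], of "\<lambda>v. v $ i"] by (simp add: row_def)
  then have "column i M = P $ i *s (\<chi> r. p r) + Q $ i *s (\<chi> r. q r)" for i
    by (simp add: vec_eq_iff column_def mult.commute)
  then show "\<exists>p q P Q. \<forall>i. column i M = P i *s p + Q i *s q"
    by (intro exI[of _ "\<chi> r. p r"] exI[of _ "\<chi> r. q r"] exI[of _ "\<lambda>i. P $ i"] exI[of _ "\<lambda>i. Q $ i"]) simp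
next
  assume "\<exists>p q P Q. \<forall>i. column i M = P i *s p + Q i *s q"
  then obtain p q P Q where pq: "\<And>i. column i M = P i *s p + Q i *s q" by blast
  have "M $ r $ i = p $ r * P i + q $ r * Q i" for r i
    using arg_cong[OF pq[of i], of "\<lambda>v. v $ r"] by (simp add: column_def mult.commute)
  then have "row r M = p $ r *s (\<chi> i. P i) + q $ r *s (\<chi> i. Q i)" for r
    by (simp add: vec_eq_iff row_def)
  then have "rows M \<subseteq> line2 (\<chi> i. P i) (\<chi> i. Q i)"
    unfolding rows_def line2_def by blast
  then have "vec.dim (rows M) \<le> card {\<chi> i. P i, \<chi> i. Q i}"
    unfolding line2_eq_span by (intro vec.dim_le_card) auto
  also have "\<dots> \<le> 2" using card_length[of "[\<chi> i. P i, \<chi> i. Q i]"] by simp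
  finally show "rank M \<le> 2" by (simp add: row_rank_def_gen)
qed

text \<open>
  The planes \<open>h i\<close> belong to a pencil, which means that they contain a common line. The two
  planes \<open>p\<close> and \<open>q\<close> may coincide.
\<close>

definition pencil_family :: "('m \<Rightarrow> complex^4) \<Rightarrow> bool" where
  "pencil_family h \<longleftrightarrow> (\<exists>p q P Q. \<forall>i. h i = P i *s p + Q i *s q)"

lemma pencil_familyI: "(\<And>i. h i = P i *s p + Q i *s q) \<Longrightarrow> pencil_family h"
  unfolding pencil_family_def by blast

definition back_projections :: "('m \<Rightarrow> complex^4^3) \<Rightarrow> ('m \<Rightarrow> complex^3) \<Rightarrow> 'm \<Rightarrow> complex^4" where
  "back_projections C v i = transpose (C i) *v v i"

lemma rank_locus_iff:
  "l \<in> rank_locus C \<longleftrightarrow> l \<in> proj_product \<and> pencil_family (back_projections C (reps l))"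
proof -
  have "column i (multiview_matrix C l) = back_projections C (reps l) i" for i
    by (simp add: column_def multiview_matrix_def back_projections_def reps_def vec_eq_iff
        del: transpose_matrix_vector)
  then show ?thesis
    unfolding rank_locus_def rank_le_2_iff pencil_family_def by simp
qed

lemma pt_in_rank_locus:
  assumes "\<And>i. v i \<noteq> 0" "pencil_family (back_projections C v)"
  shows "pt v \<in> rank_locus C"
proof -
  obtain p q P Q where pq: "\<And>i. back_projections C v i = P i *s p + Q i *s q"
    using assms(2) by (auto simp: pencil_family_def)
  obtain k where k: "\<And>i. k i \<noteq> 0" "reps (pt v) = (\<lambda>i. k i *s v i)"
    using reps_pt[of v] assms(1) by blast
  have "back_projections C (reps (pt v)) i = (k i * P i) *s p + (k i * Q i) *s q" for i
  proof -
    have "back_projections C (reps (pt v)) i = k i *s back_projections C v i"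
      by (simp add: k(2) back_projections_def vec.scale del: transpose_matrix_vector)
    then show ?thesis by (simp add: pq vec_eq_iff algebra_simps)
  qed
  then have "pencil_family (back_projections C (reps (pt v)))"
    by (rule pencil_familyI)
  then show ?thesis
    using assms(1) by (simp add: rank_locus_iff pt_in_proj_product)
qed

lemma dot_commute: "dot x y = dot y x"
  by (simp add: dot_def mult.commute)

lemma form_back_projection:
  "form (\<lambda>k. if k = i then 1 else 0) (\<lambda>v. dot (back_projections C v i) a)"
proof -
  have "dot (back_projections C v i) a = dot (C i *v a) (v i)" for v
    unfolding back_projections_def dot_commute[of _ a] dot_transpose ..
  then show ?thesis using form_dot[of i "C i *v a"] by simp
qed

lemma dependent_multiple:
  assumes "\<not> indep2 x y" "x \<noteq> 0"
  shows "\<exists>k. y = k *s x"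
proof -
  obtain a b where ab: "a *s x + b *s y = 0" "a \<noteq> 0 \<or> b \<noteq> 0" using assms(1) by (auto simp: indep2_def)
  have b: "b \<noteq> 0" using ab assms(2) by auto
  have "b *s y = - (a *s x)" using ab(1) by (simp add: eq_neg_iff_add_eq_0 add.commute)
  then have "(1 / b) *s (b *s y) = (1 / b) *s (- (a *s x))" by simp
  then have "y = (- a / b) *s x" using b by (simp add: vec_eq_iff)
  then show ?thesis by blast
qed

text \<open>
  If three of the planes \<open>h i\<close> are not in a pencil, then some 3-by-3 minor of their
  coordinates is not zero, and minors are forms in the image lines. In a basis adapted to two
  of the planes the matrix of the minor is triangular.
\<close>

lemma closedin_rank_locus:
  assumes "\<And>i v. transpose (C i) *v v = 0 \<Longrightarrow> v = 0"
  shows "closedin zariski (rank_locus C)"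
proof -
  have sub: "rank_locus C \<subseteq> proj_product" by (auto simp: rank_locus_def)
  have "l \<in> rank_locus C" if l: "l \<in> zariski closure_of (rank_locus C)" for l
  proof (rule ccontr)
    assume "l \<notin> rank_locus C"
    define h where "h = back_projections C (reps l)"
    have lp: "l \<in> proj_product" using l sub by (simp add: in_zariski_closure)
    then have not: "\<not> pencil_family h" using \<open>l \<notin> rank_locus C\<close> by (simp add: rank_locus_iff h_def)
    have nz: "h i \<noteq> 0" for i
      using assms[of i "reps l i"] pt_reps(2)[OF lp, of i] unfolding h_def back_projections_def by blast
    define i where "i = (SOME i :: 'a. True)"
    have "\<exists>j. indep2 (h i) (h j)"
    proof (rule ccontr)
      assume "\<not> (\<exists>j. indep2 (h i) (h j))"
      then have "\<exists>k. h j = k *s h i" for j using dependent_multiple nz by blast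
      then have "\<forall>j. \<exists>k. h j = k *s h i" by blast
      then obtain k where k: "\<forall>j. h j = k j *s h i" by (rule choice[THEN exE])
      have "h j = k j *s h i + 0 *s 0" for j using k[THEN spec, of j] by simp
      then have "pencil_family h" by (rule pencil_familyI)
      then show False using not by blast
    qed
    then obtain j where ij: "indep2 (h i) (h j)" by blast
    obtain r s \<phi> \<eta> f g where d: "dot (h i) \<phi> = 1" "dot (h i) \<eta> = 0" "dot (h i) f = 0" "dot (h i) g = 0"
      "dot (h j) \<phi> = 0" "dot (h j) \<eta> = 1" "dot (h j) f = 0" "dot (h j) g = 0"
      and exp: "\<And>v. v = dot v \<phi> *s h i + dot v \<eta> *s h j + dot v f *s r + dot v g *s s"
      by (rule adapted_basis[OF ij]) (rule that)
    have "\<exists>k. dot (h k) f \<noteq> 0 \<or> dot (h k) g \<noteq> 0"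
    proof (rule ccontr)
      assume "\<not> (\<exists>k. dot (h k) f \<noteq> 0 \<or> dot (h k) g \<noteq> 0)"
      then have "h k = dot (h k) \<phi> *s h i + dot (h k) \<eta> *s h j" for k using exp[of "h k"] by simp
      then have "pencil_family h" by (rule pencil_familyI)
      then show False using not by blast
    qed
    then obtain k w where w: "dot (h k) w \<noteq> 0" "dot (h i) w = 0" "dot (h j) w = 0" using d by blast
    define L where "L = (\<lambda>a \<theta> v. dot (back_projections C v a) \<theta>)"
    \<comment> \<open>The determinant of the 3-by-3 matrix with entries \<open>L a \<theta> v\<close> for rows \<open>a\<close> among \<open>i\<close>, \<open>j\<close>, \<open>k\<close> and
      columns \<open>\<theta>\<close> among \<open>\<phi>\<close>, \<open>\<eta>\<close>, \<open>w\<close>, expanded along the first row.\<close>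
    define F where "F = (\<lambda>v. L i \<phi> v * (L j \<eta> v * L k w v - L j w v * L k \<eta> v)
      - L i \<eta> v * (L j \<phi> v * L k w v - L j w v * L k \<phi> v)
      + L i w v * (L j \<phi> v * L k \<eta> v - L j \<eta> v * L k \<phi> v))"
    have Lh: "L a \<theta> (reps l) = dot (h a) \<theta>" for a \<theta> by (simp add: L_def h_def)
    have formL: "form (\<lambda>b. if b = a then 1 else 0) (L a \<theta>)" for a \<theta>
      unfolding L_def by (rule form_back_projection)
    define D where "D = (\<lambda>b. (if b = i then 1 else 0) + ((if b = j then 1 else 0) + (if b = k then 1 else 0 :: nat)))"
    have "form D F"
      unfolding F_def D_def by (intro form_add form_diff form_mult formL)
    moreover have "F (reps l') = 0" if l': "l' \<in> rank_locus C" for l'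
    proof -
      obtain p q P Q where pq: "\<And>i. back_projections C (reps l') i = P i *s p + Q i *s q"
        using l' by (auto simp: rank_locus_iff pencil_family_def)
      show ?thesis
        by (simp add: F_def L_def pq algebra_simps)
    qed
    ultimately have "F (reps l) = 0"
      using l in_zariski_closure[OF sub] unfolding vanishes_on_def by blast
    then show False using w d by (simp add: F_def Lh)
  qed
  then have "zariski closure_of (rank_locus C) = rank_locus C"
    using sub closure_of_subset[of "rank_locus C" zariski] by auto
  then show ?thesis using closedin_closure_of[of zariski "rank_locus C"] by simp
qed

section \<open>Limits of images of lines\<close>

text \<open>
  A projective transformation of a line can be prescribed at up to three points: there is a
  matrix that maps \<open>(\<alpha> i, \<beta> i)\<close> to a nonzero multiple of \<open>(a i, b i)\<close>. For three
  points the multiples are determined up to a common factor by writing the third vector as a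
  combination of the other two, on both sides; they are not zero because the vectors are
  pairwise independent.
\<close>

lemma interpolate_directions:
  fixes \<alpha> \<beta> a b :: "'m \<Rightarrow> complex"
  assumes "finite S" "card S \<le> 3"
    and nz: "\<And>i. i \<in> S \<Longrightarrow> \<alpha> i \<noteq> 0 \<or> \<beta> i \<noteq> 0"
    and indep: "\<And>i j. i \<in> S \<Longrightarrow> j \<in> S \<Longrightarrow> i \<noteq> j \<Longrightarrow> \<alpha> i * \<beta> j - \<alpha> j * \<beta> i \<noteq> 0"
    and indep': "\<And>i j. i \<in> S \<Longrightarrow> j \<in> S \<Longrightarrow> i \<noteq> j \<Longrightarrow> a i * b j - a j * b i \<noteq> 0"
  shows "\<exists>u u' w w' \<kappa>. \<forall>i\<in>S. \<kappa> i \<noteq> 0 \<and> \<alpha> i * u + \<beta> i * w = \<kappa> i * a i \<and> \<alpha> i * u' + \<beta> i * w' = \<kappa> i * b i"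
proof -
  have two: "\<exists>u w. \<alpha> i * u + \<beta> i * w = A \<and> \<alpha> j * u + \<beta> j * w = B"
    if "i \<in> S" "j \<in> S" "i \<noteq> j" for i j A B
  proof -
    let ?D = "\<alpha> i * \<beta> j - \<alpha> j * \<beta> i"
    have "?D \<noteq> 0" using indep that by blast
    then have "\<alpha> i * ((A * \<beta> j - B * \<beta> i) / ?D) + \<beta> i * ((\<alpha> i * B - \<alpha> j * A) / ?D) = A"
      "\<alpha> j * ((A * \<beta> j - B * \<beta> i) / ?D) + \<beta> j * ((\<alpha> i * B - \<alpha> j * A) / ?D) = B"
      by (simp_all add: divide_simps) (simp_all add: algebra_simps)
    then show ?thesis by blast
  qed
  consider "card S = 0" | "card S = 1" | "card S = 2" | "card S = 3" using assms(2) by linarith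
  then show ?thesis
  proof cases
    case 1
    then show ?thesis using assms(1) by auto
  next
    case 2
    then obtain i where S: "S = {i}" by (auto simp: card_1_singleton_iff)
    have "\<exists>u w. \<alpha> i * u + \<beta> i * w = A" for A
    proof (cases "\<alpha> i = 0")
      case True
      then show ?thesis using nz[of i] S by (intro exI[of _ 0] exI[of _ "A / \<beta> i"]) simp
    next
      case False
      then show ?thesis by (intro exI[of _ "A / \<alpha> i"] exI[of _ 0]) simp
    qed
    then obtain u w u' w' where "\<alpha> i * u + \<beta> i * w = a i" "\<alpha> i * u' + \<beta> i * w' = b i" by metis
    then show ?thesis unfolding S
      by (intro exI[of _ u] exI[of _ u'] exI[of _ w] exI[of _ w'] exI[of _ "\<lambda>_. 1"]) simp
  next
    case 3
    then obtain i j where S: "S = {i, j}" "i \<noteq> j" by (auto simp: card_2_iff)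
    obtain u w where "\<alpha> i * u + \<beta> i * w = a i" "\<alpha> j * u + \<beta> j * w = a j"
      using two[of i j "a i" "a j"] S by blast
    moreover obtain u' w' where "\<alpha> i * u' + \<beta> i * w' = b i" "\<alpha> j * u' + \<beta> j * w' = b j"
      using two[of i j "b i" "b j"] S by blast
    ultimately show ?thesis unfolding S
      by (intro exI[of _ u] exI[of _ u'] exI[of _ w] exI[of _ w'] exI[of _ "\<lambda>_. 1"]) simp
  next
    case 4
    then obtain i j k where S: "S = {i, j, k}" "i \<noteq> j" "j \<noteq> k" "i \<noteq> k" by (auto simp: card_3_iff)
    let ?g = "\<lambda>i j. \<alpha> i * \<beta> j - \<alpha> j * \<beta> i" and ?t = "\<lambda>i j. a i * b j - a j * b i"
    have g: "?g i j \<noteq> 0" "?g k j \<noteq> 0" "?g i k \<noteq> 0" using indep S by auto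
    have t: "?t i j \<noteq> 0" "?t k j \<noteq> 0" "?t i k \<noteq> 0" using indep' S by auto
    define \<kappa> where "\<kappa> = (\<lambda>l. if l = i then ?t k j / ?g k j else if l = j then ?t i k / ?g i k else ?t i j / ?g i j)"
    have \<kappa>: "\<kappa> i = ?t k j / ?g k j" "\<kappa> j = ?t i k / ?g i k" "\<kappa> k = ?t i j / ?g i j"
      using S by (auto simp: \<kappa>_def)
    have third: "\<alpha> k * u + \<beta> k * w = \<kappa> k * e k"
      if uw: "\<alpha> i * u + \<beta> i * w = \<kappa> i * e i" "\<alpha> j * u + \<beta> j * w = \<kappa> j * e j"
        and e: "?t k j * e i + ?t i k * e j = ?t i j * e k" for u w and e :: "'m \<Rightarrow> complex"
    proof -
      have "?g i j * (\<alpha> k * u + \<beta> k * w) = ?g k j * (\<alpha> i * u + \<beta> i * w) + ?g i k * (\<alpha> j * u + \<beta> j * w)"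
        by (simp add: algebra_simps)
      also have "\<dots> = ?t k j * e i + ?t i k * e j"
        unfolding uw \<kappa> using g by simp
      also have "\<dots> = ?g i j * (\<kappa> k * e k)" unfolding e \<kappa> using g by simp
      finally show ?thesis using g(1) by simp
    qed
    obtain u w where uw: "\<alpha> i * u + \<beta> i * w = \<kappa> i * a i" "\<alpha> j * u + \<beta> j * w = \<kappa> j * a j"
      using two[of i j "\<kappa> i * a i" "\<kappa> j * a j"] S by blast
    obtain u' w' where uw': "\<alpha> i * u' + \<beta> i * w' = \<kappa> i * b i" "\<alpha> j * u' + \<beta> j * w' = \<kappa> j * b j"
      using two[of i j "\<kappa> i * b i" "\<kappa> j * b j"] S by blast
    have "\<alpha> k * u + \<beta> k * w = \<kappa> k * a k" by (rule third[OF uw]) (simp add: algebra_simps)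
    moreover have "\<alpha> k * u' + \<beta> k * w' = \<kappa> k * b k" by (rule third[OF uw']) (simp add: algebra_simps)
    moreover have "\<kappa> i \<noteq> 0" "\<kappa> j \<noteq> 0" "\<kappa> k \<noteq> 0" unfolding \<kappa> using g t by auto
    ultimately show ?thesis unfolding S using uw uw'
      by (intro exI[of _ u] exI[of _ u'] exI[of _ w] exI[of _ w'] exI[of _ \<kappa>]) simp
  qed
qed

context cameras begin

lemma param_set_subset_variety: "param_set (line_images C) UNIV \<subseteq> line_multiview_variety C"
  unfolding line_multiview_variety_eq by (simp add: closure_of_subset param_set_proj)

lemma closedin_line_multiview_variety: "closedin zariski (line_multiview_variety C)"
  by (simp add: line_multiview_variety_def)

text \<open>
  The back-projected planes of the images of a line contain that line, hence they are in a
  pencil.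
\<close>

lemma line_multiview_variety_subset_rank_locus: "line_multiview_variety C \<subseteq> rank_locus C"
  unfolding line_multiview_variety_eq
proof (rule closure_of_minimal)
  show "closedin zariski (rank_locus C)" by (rule closedin_rank_locus[OF transpose_inj])
  show "param_set (line_images C) UNIV \<subseteq> rank_locus C"
  proof
    fix l assume "l \<in> param_set (line_images C) UNIV"
    then obtain t where t: "l = pt (line_images C t)" "\<And>i. line_images C t i \<noteq> 0"
      by (auto simp: param_set_def)
    let ?h = "back_projections C (line_images C t)"
    have ind: "indep2 (t False) (t True)"
      using t(2) cross_nonzero_indep2 unfolding line_images_def by blast
    have 0: "dot (t False) (?h i) = 0" "dot (t True) (?h i) = 0" for i
      unfolding back_projections_def dot_transpose line_images_def by simp_all
    obtain r s \<phi> \<eta> f g where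
      "\<And>h. h = dot (t False) h *s \<phi> + dot (t True) h *s \<eta> + dot r h *s f + dot s h *s g"
      by (rule adapted_basis[OF ind]) (rule that)
    then have "?h i = dot (t False) (?h i) *s \<phi> + dot (t True) (?h i) *s \<eta> + dot r (?h i) *s f + dot s (?h i) *s g"
      for i by blast
    then have "?h i = dot r (?h i) *s f + dot s (?h i) *s g" for i
      unfolding 0 by simp
    then have "pencil_family ?h" by (rule pencil_familyI)
    then show "l \<in> rank_locus C" unfolding t(1) by (intro pt_in_rank_locus t(2))
  qed
qed

text \<open>
  If the line through \<open>x\<close> and \<open>y\<close> passes through the center \<open>c i\<close>, then the image equation of
  the moved line through \<open>x + \<sigma> u\<close> and \<open>y + \<sigma> w\<close> vanishes for \<open>\<sigma> = 0\<close>.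
  Divided by \<open>\<sigma>\<close>, it has the limit \<open>v i\<close>, which may be used as soon as it is not zero.
\<close>

lemma first_order_limit:
  assumes S: "\<And>i. i \<in> S \<longleftrightarrow> cross_product (C i *v x) (C i *v y) = 0"
    and v: "\<And>i. v i \<noteq> 0"
    and "\<And>i. i \<in> S \<Longrightarrow> v i = cross_product (C i *v x) (C i *v w) + cross_product (C i *v u) (C i *v y)"
    and "\<And>i. i \<notin> S \<Longrightarrow> v i = cross_product (C i *v x) (C i *v y)"
  shows "pt v \<in> line_multiview_variety C"
proof -
  let ?E0 = "\<lambda>i. cross_product (C i *v x) (C i *v y)"
    and ?E1 = "\<lambda>i. cross_product (C i *v x) (C i *v w) + cross_product (C i *v u) (C i *v y)"
    and ?E2 = "\<lambda>i. cross_product (C i *v u) (C i *v w)"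
  define \<psi> where "\<psi> = (\<lambda>\<sigma> i. if i \<in> S then ?E1 i + \<sigma> *s ?E2 i else ?E0 i + \<sigma> *s ?E1 i + (\<sigma> * \<sigma>) *s ?E2 i)"
  have \<psi>0: "\<psi> 0 = v" using assms(3,4) by (auto simp: \<psi>_def)
  have "pt (\<psi> 0) \<in> line_multiview_variety C"
  proof (rule closed_limit[where B = "{0}"])
    show "closedin zariski (line_multiview_variety C)" by (rule closedin_line_multiview_variety)
    show "\<psi> 0 i \<noteq> 0" for i using v \<psi>0 by simp
    fix i j
    show "\<exists>p. \<forall>\<sigma>. \<psi> \<sigma> i $ j = poly p \<sigma>"
    proof (cases "i \<in> S")
      case True
      then show ?thesis
        by (intro exI[of _ "[:?E1 i $ j, ?E2 i $ j:]"]) (simp add: \<psi>_def)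
    next
      case False
      then show ?thesis
        by (intro exI[of _ "[:?E0 i $ j, ?E1 i $ j, ?E2 i $ j:]"]) (simp add: \<psi>_def algebra_simps)
    qed
  next
    fix \<sigma> assume \<sigma>: "\<sigma> \<notin> {0 :: complex}" "\<And>i. \<psi> \<sigma> i \<noteq> 0"
    let ?t = "\<lambda>b. if b then y + \<sigma> *s w else x + \<sigma> *s u"
    have expand: "line_images C ?t i = ?E0 i + \<sigma> *s ?E1 i + (\<sigma> * \<sigma>) *s ?E2 i" for i
      by (simp add: line_images_def vec.add vec.scale cross_product_bilinear vec.scale_right_distrib)
    have *: "line_images C ?t i = (if i \<in> S then \<sigma> else 1) *s \<psi> \<sigma> i" for i
      unfolding expand using S[of i] by (auto simp: \<psi>_def vec.scale_right_distrib)
    then have "line_images C ?t i \<noteq> 0" for i using \<sigma> by (cases "i \<in> S") (auto simp del: vec.scale_left_distrib)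
    then have "pt (line_images C ?t) \<in> line_multiview_variety C"
      using param_set_subset_variety by (auto simp: param_set_def)
    moreover have "pt (line_images C ?t) = pt (\<psi> \<sigma>)"
      by (rule pt_eqI) (use * \<sigma>(1) in \<open>auto intro!: exI[of _ "if _ \<in> S then \<sigma> else 1"]\<close>)
    ultimately show "pt (\<psi> \<sigma>) \<in> line_multiview_variety C" by simp
  qed simp
  then show ?thesis by (simp add: \<psi>0)
qed

text \<open>
  Choose a line in all back-projected planes. At a center \<open>c i = \<alpha> i x + \<beta> i y\<close>
  on the line both \<open>C i *v x\<close> and \<open>C i *v y\<close> are multiples of one vector \<open>\<xi> i\<close>, the image
  of the line. The first-order limit for a deformation given by \<open>u\<close> and \<open>w\<close> is then the line
  through \<open>\<xi> i\<close> and the image of \<open>\<alpha> i u + \<beta> i w\<close>. The latter vector is taken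
  in the complement spanned by \<open>r\<close> and \<open>s\<close>, with coordinates proportional to \<open>a i\<close> and \<open>b i\<close>.
\<close>

lemma rank_locus_subset_variety:
  assumes "no_four_collinear C"
  shows "rank_locus C \<subseteq> line_multiview_variety C"
proof
  fix l assume l: "l \<in> rank_locus C"
  define v where "v = reps l"
  define h where "h = back_projections C v"
  have lp: "l \<in> proj_product" using l by (simp add: rank_locus_iff)
  have v_nz: "v i \<noteq> 0" for i unfolding v_def by (rule pt_reps(2)[OF lp])
  have h_nz: "h i \<noteq> 0" for i
    using transpose_inj[of i "v i"] v_nz[of i] unfolding h_def back_projections_def by blast
  obtain p q P Q where pq: "\<And>i. h i = P i *s p + Q i *s q"
    using l by (auto simp: rank_locus_iff pencil_family_def h_def v_def)
  obtain x y where xy: "indep2 x y" "dot x p = 0" "dot x q = 0" "dot y p = 0" "dot y q = 0"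
    by (rule two_equations_in_four_unknowns[of p q]) (rule that)
  have hx: "dot x (h i) = 0" and hy: "dot y (h i) = 0" for i by (simp_all add: pq xy)
  have dot_h: "dot z (h i) = dot (C i *v z) (v i)" for z i
    unfolding h_def back_projections_def by (rule dot_transpose)
  obtain r s \<phi> \<eta> f g where d: "dot x f = 0" "dot x g = 0" "dot y f = 0" "dot y g = 0"
    "dot r f = 1" "dot r g = 0" "dot s f = 0" "dot s g = 1"
    and exp: "\<And>k. k = dot x k *s \<phi> + dot y k *s \<eta> + dot r k *s f + dot s k *s g"
    by (rule adapted_basis[OF xy(1)]) (rule that)
  define S where "S = {i. cross_product (C i *v x) (C i *v y) = 0}"
  have S_iff: "i \<in> S \<longleftrightarrow> c i \<in> line2 x y" for i
    by (simp add: S_def cross_eq_0_iff[OF xy(1)])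
  have card_S: "card S \<le> 3"
  proof (rule ccontr)
    assume "\<not> card S \<le> 3"
    then obtain I where I: "I \<subseteq> S" "card I = 4"
      using obtain_subset_with_card_n[of 4 S] by auto
    have L: "line2 x y \<in> grassmannian" using xy(1) grassmannian_iff by blast
    then have "vec.subspace (line2 x y)" by (simp add: grassmannian_def)
    then have "\<forall>i\<in>I. center (C i) \<subseteq> line2 x y"
      using I(1) S_iff center_subset_iff by blast
    then show False using assms L I(2) unfolding no_four_collinear_def by blast
  qed
  define \<alpha> where "\<alpha> = (\<lambda>i. SOME a. \<exists>b. c i = a *s x + b *s y)"
  define \<beta> where "\<beta> = (\<lambda>i. SOME b. c i = \<alpha> i *s x + b *s y)"
  have c_eq: "c i = \<alpha> i *s x + \<beta> i *s y" if "i \<in> S" for i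
  proof -
    have "\<exists>a b. c i = a *s x + b *s y" using that by (auto simp: S_iff line2_def)
    then have "\<exists>b. c i = \<alpha> i *s x + b *s y" unfolding \<alpha>_def by (rule someI_ex)
    then show ?thesis unfolding \<beta>_def by (rule someI_ex)
  qed
  have \<alpha>\<beta>: "\<alpha> i \<noteq> 0 \<or> \<beta> i \<noteq> 0" if "i \<in> S" for i
    using c_eq[OF that] c_nz[of i] by auto
  have indep_\<alpha>\<beta>: "\<alpha> i * \<beta> j - \<alpha> j * \<beta> i \<noteq> 0" if ij: "i \<in> S" "j \<in> S" "i \<noteq> j" for i j
  proof
    assume 0: "\<alpha> i * \<beta> j - \<alpha> j * \<beta> i = 0"
    have "\<beta> j *s c i + (- \<beta> i) *s c j = (\<alpha> i * \<beta> j - \<alpha> j * \<beta> i) *s x"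
      "\<alpha> j *s c i + (- \<alpha> i) *s c j = (- (\<alpha> i * \<beta> j - \<alpha> j * \<beta> i)) *s y"
      unfolding c_eq[OF ij(1)] c_eq[OF ij(2)] by (simp_all add: vec_eq_iff algebra_simps)
    then have "\<beta> j = 0" "\<alpha> j = 0"
      using indep2_centers[OF ij(3)] unfolding 0 indep2_def by (metis vec.scale_zero_left neg_0_equal_iff_equal)+
    then show False using \<alpha>\<beta>[OF ij(2)] by simp
  qed
  have "\<exists>\<xi>. C i *v x = \<beta> i *s \<xi> \<and> C i *v y = (- \<alpha> i) *s \<xi>" if i: "i \<in> S" for i
  proof -
    have 0: "\<alpha> i *s (C i *v x) + \<beta> i *s (C i *v y) = 0"
      using C_c[of i] unfolding c_eq[OF i] by (simp add: vec.add vec.scale)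
    show ?thesis
    proof (cases "\<beta> i = 0")
      case True
      then have a: "\<alpha> i \<noteq> 0" using \<alpha>\<beta>[OF i] by simp
      then have "C i *v x = 0" using 0 True by simp
      then show ?thesis using True a by (intro exI[of _ "(- 1 / \<alpha> i) *s (C i *v y)"]) (simp add: vec_eq_iff)
    next
      case False
      have "\<beta> i *s (C i *v y) = (- \<alpha> i) *s (C i *v x)"
        using 0 by (simp add: eq_neg_iff_add_eq_0 add.commute)
      then have "(1 / \<beta> i) *s (\<beta> i *s (C i *v y)) = (1 / \<beta> i) *s ((- \<alpha> i) *s (C i *v x))" by simp
      then have "C i *v y = (- \<alpha> i) *s ((1 / \<beta> i) *s (C i *v x))" using False by (simp add: vec_eq_iff)
      then show ?thesis using False by (intro exI[of _ "(1 / \<beta> i) *s (C i *v x)"]) simp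
    qed
  qed
  then have "\<forall>i. \<exists>\<xi>. i \<in> S \<longrightarrow> C i *v x = \<beta> i *s \<xi> \<and> C i *v y = (- \<alpha> i) *s \<xi>" by blast
  then obtain \<xi> where \<xi>': "\<forall>i. i \<in> S \<longrightarrow> C i *v x = \<beta> i *s \<xi> i \<and> C i *v y = (- \<alpha> i) *s \<xi> i"
    by (rule choice[THEN exE])
  then have \<xi>: "C i *v x = \<beta> i *s \<xi> i" "C i *v y = (- \<alpha> i) *s \<xi> i" if "i \<in> S" for i
    using that by blast+
  define dir where "dir = (\<lambda>a b :: complex. a *s r + b *s s)"
  define \<psi> where "\<psi> = (\<lambda>a b i. if i \<in> S then cross_product (\<xi> i) (C i *v dir (a i) (b i))
      else cross_product (C i *v x) (C i *v y))"
  have dir_not_in: "a = 0 \<and> b = 0" if "dir a b = k *s x + m *s y" for a b k m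
  proof -
    have "dot (dir a b) f = dot (k *s x + m *s y) f" "dot (dir a b) g = dot (k *s x + m *s y) g"
      using that by simp_all
    then show ?thesis by (simp add: dir_def d)
  qed
  have cross_dir: "cross_product (\<xi> i) (C i *v dir a b) \<noteq> 0" if i: "i \<in> S" and ab: "a \<noteq> 0 \<or> b \<noteq> 0" for i a b
  proof
    assume 0: "cross_product (\<xi> i) (C i *v dir a b) = 0"
    have "\<xi> i \<noteq> 0"
    proof
      assume "\<xi> i = 0"
      then have "C i *v x = 0" "C i *v y = 0" using \<xi>[OF i] by simp_all
      then obtain k k' where k: "x = k *s c i" "y = k' *s c i" unfolding ker by blast
      have "k' *s x + (- k) *s y = 0" unfolding k by (simp add: vec_eq_iff)
      then have "k = 0" using xy(1) unfolding indep2_def by (metis neg_equal_0_iff_equal)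
      then have "1 *s x + 0 *s y = 0" using k by simp
      then show False using xy(1) unfolding indep2_def by (metis zero_neq_one)
    qed
    then obtain k where k: "C i *v dir a b = k *s \<xi> i" using cross_product_eq_0[OF 0] by blast
    have "\<exists>m n. C i *v (m *s x + n *s y) = k *s \<xi> i"
    proof (cases "\<beta> i = 0")
      case True
      then have "\<alpha> i \<noteq> 0" using \<alpha>\<beta>[OF i] by simp
      have "C i *v (0 *s x + (- k / \<alpha> i) *s y) = (- k / \<alpha> i) *s ((- \<alpha> i) *s \<xi> i)"
        unfolding vec.add vec.scale \<xi>[OF i] by simp
      also have "\<dots> = k *s \<xi> i" using \<open>\<alpha> i \<noteq> 0\<close> by simp
      finally show ?thesis by blast
    next
      case False
      then show ?thesis
        by (intro exI[of _ "k / \<beta> i"] exI[of _ 0]) (simp add: vec.add vec.scale \<xi>[OF i])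
    qed
    then obtain m n where "C i *v (m *s x + n *s y) = C i *v dir a b" using k by metis
    then have "C i *v (dir a b - (m *s x + n *s y)) = 0" by (simp add: vec.diff)
    then obtain e where "dir a b - (m *s x + n *s y) = e *s c i" unfolding ker by blast
    then have "dir a b = (m + e * \<alpha> i) *s x + (n + e * \<beta> i) *s y"
      unfolding c_eq[OF i] by (simp add: vec_eq_iff algebra_simps)
    then show False using dir_not_in ab by blast
  qed
  have generic: "pt (\<psi> a b) \<in> line_multiview_variety C"
    if nz: "\<And>i. i \<in> S \<Longrightarrow> a i \<noteq> 0 \<or> b i \<noteq> 0"
      and ind: "\<And>i j. i \<in> S \<Longrightarrow> j \<in> S \<Longrightarrow> i \<noteq> j \<Longrightarrow> a i * b j - a j * b i \<noteq> 0" for a b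
  proof -
    obtain u u' w w' \<kappa> where \<kappa>: "\<And>i. i \<in> S \<Longrightarrow> \<kappa> i \<noteq> 0"
        "\<And>i. i \<in> S \<Longrightarrow> \<alpha> i * u + \<beta> i * w = \<kappa> i * a i" "\<And>i. i \<in> S \<Longrightarrow> \<alpha> i * u' + \<beta> i * w' = \<kappa> i * b i"
      using interpolate_directions[of S \<alpha> \<beta> a b, OF finite card_S \<alpha>\<beta> indep_\<alpha>\<beta> ind] by blast
    \<comment> \<open>The limits are only prescribed up to the factors \<open>\<kappa> i\<close>, which do not change the point.\<close>
    let ?v = "\<lambda>i. (if i \<in> S then \<kappa> i else 1) *s \<psi> a b i"
    have \<psi>_nz: "\<psi> a b i \<noteq> 0" for i
      using cross_dir[of i] nz[of i] by (auto simp: \<psi>_def S_def)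
    have "pt ?v \<in> line_multiview_variety C"
    proof (rule first_order_limit[where S = S and x = x and y = y and u = "dir u u'" and w = "dir w w'"])
      fix i
      show "?v i \<noteq> 0" using \<psi>_nz \<kappa>(1) by simp
      assume i: "i \<in> S"
      have "\<alpha> i *s dir u u' + \<beta> i *s dir w w' = dir (\<alpha> i * u + \<beta> i * w) (\<alpha> i * u' + \<beta> i * w')"
        by (simp add: dir_def vec_eq_iff algebra_simps)
      also have "\<dots> = \<kappa> i *s dir (a i) (b i)"
        unfolding \<kappa>(2,3)[OF i] by (simp add: dir_def vec_eq_iff algebra_simps)
      finally have eq: "\<alpha> i *s dir u u' + \<beta> i *s dir w w' = \<kappa> i *s dir (a i) (b i)" .
      have "cross_product (C i *v x) (C i *v dir w w') + cross_product (C i *v dir u u') (C i *v y)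
          = cross_product (\<xi> i) (C i *v (\<alpha> i *s dir u u' + \<beta> i *s dir w w'))"
        unfolding \<xi>[OF i] vec.add vec.scale by (simp add: cross_simps algebra_simps)
      also have "\<dots> = ?v i" unfolding eq using i by (simp add: \<psi>_def vec.scale cross_product_bilinear)
      finally show "?v i = cross_product (C i *v x) (C i *v dir w w') + cross_product (C i *v dir u u') (C i *v y)" ..
    qed (simp_all add: S_def \<psi>_def)
    moreover have "pt ?v = pt (\<psi> a b)" by (rule pt_scale) (simp add: \<kappa>(1))
    ultimately show ?thesis by simp
  qed
  have all_dirs: "pt (\<psi> a b) \<in> line_multiview_variety C"
    if nz: "\<And>i. i \<in> S \<Longrightarrow> a i \<noteq> 0 \<or> b i \<noteq> 0" for a b
  proof -
    obtain \<theta>' :: "'m \<Rightarrow> nat" where \<theta>': "inj \<theta>'"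
      using finite_imp_inj_to_nat_seg[of "UNIV :: 'm set"] by auto
    \<comment> \<open>Adding \<open>\<sigma>\<close> times the pairwise independent directions \<open>(1, \<theta> i)\<close> makes the given directions
      pairwise independent for all but finitely many \<open>\<sigma>\<close>.\<close>
    define \<theta> :: "'m \<Rightarrow> complex" where "\<theta> = (\<lambda>i. of_nat (\<theta>' i))"
    let ?a = "\<lambda>\<sigma> i. a i + \<sigma>" and ?b = "\<lambda>\<sigma> i. b i + \<sigma> * \<theta> i"
    define D where "D = (\<lambda>(i, j). [:a i * b j - a j * b i, a i * \<theta> j + b j - a j * \<theta> i - b i, \<theta> j - \<theta> i:])"
    have D: "poly (D (i, j)) \<sigma> = ?a \<sigma> i * ?b \<sigma> j - ?a \<sigma> j * ?b \<sigma> i" for i j \<sigma>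
      by (simp add: D_def algebra_simps)
    have Dnz: "D (i, j) \<noteq> 0" if "i \<noteq> j" for i j
      using that \<theta>' by (auto simp: D_def \<theta>_def inj_eq)
    define B where "B = (\<Union>q\<in>{q. fst q \<noteq> snd q}. {\<sigma>. poly (D q) \<sigma> = 0})"
    have "finite B"
      unfolding B_def using Dnz by (intro finite_UN_I) (auto intro: poly_roots_finite)
    have "pt (\<psi> (?a 0) (?b 0)) \<in> line_multiview_variety C"
    proof (rule closed_limit[where B = B and \<psi> = "\<lambda>\<sigma>. \<psi> (?a \<sigma>) (?b \<sigma>)"])
      show "closedin zariski (line_multiview_variety C)" by (rule closedin_line_multiview_variety)
      show "finite B" by fact
      show "\<psi> (?a 0) (?b 0) i \<noteq> 0" for i
        using cross_dir[of i] nz[of i] by (auto simp: \<psi>_def S_def)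
      fix i j
      show "\<exists>p. \<forall>\<sigma>. \<psi> (?a \<sigma>) (?b \<sigma>) i $ j = poly p \<sigma>"
      proof (cases "i \<in> S")
        case True
        have "dir (?a \<sigma> i) (?b \<sigma> i) = dir (a i) (b i) + \<sigma> *s dir 1 (\<theta> i)" for \<sigma>
          by (simp add: dir_def vec_eq_iff algebra_simps)
        then have "\<psi> (?a \<sigma>) (?b \<sigma>) i = cross_product (\<xi> i) (C i *v dir (a i) (b i)) +
            \<sigma> *s cross_product (\<xi> i) (C i *v dir 1 (\<theta> i))" for \<sigma>
          using True by (simp add: \<psi>_def vec.add vec.scale cross_product_bilinear)
        then show ?thesis
          by (intro exI[of _ "[:cross_product (\<xi> i) (C i *v dir (a i) (b i)) $ j,
              cross_product (\<xi> i) (C i *v dir 1 (\<theta> i)) $ j:]"]) simp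
      next
        case False
        then show ?thesis
          by (intro exI[of _ "[:cross_product (C i *v x) (C i *v y) $ j:]"]) (simp add: \<psi>_def)
      qed
    next
      fix \<sigma> assume \<sigma>: "\<sigma> \<notin> B" "\<And>i. \<psi> (?a \<sigma>) (?b \<sigma>) i \<noteq> 0"
      show "pt (\<psi> (?a \<sigma>) (?b \<sigma>)) \<in> line_multiview_variety C"
      proof (rule generic)
        fix i assume i: "i \<in> S"
        show "?a \<sigma> i \<noteq> 0 \<or> ?b \<sigma> i \<noteq> 0"
        proof (rule ccontr)
          assume "\<not> ?thesis"
          then have "dir (?a \<sigma> i) (?b \<sigma> i) = 0" by (simp add: dir_def)
          then have "\<psi> (?a \<sigma>) (?b \<sigma>) i = 0" using i by (simp add: \<psi>_def)
          then show False using \<sigma>(2) by blast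
        qed
        fix j assume "j \<in> S" "i \<noteq> j"
        then have "(i, j) \<in> {q. fst q \<noteq> snd q}" by simp
        then show "?a \<sigma> i * ?b \<sigma> j - ?a \<sigma> j * ?b \<sigma> i \<noteq> 0"
          using \<sigma>(1) unfolding D[symmetric] B_def by blast
      qed
    qed
    then show ?thesis by simp
  qed
  \<comment> \<open>The direction in the complement that is contained in the plane \<open>h i\<close>.\<close>
  let ?a = "\<lambda>i. dot s (h i)" and ?b = "\<lambda>i. - dot r (h i)"
  have ab: "?a i \<noteq> 0 \<or> ?b i \<noteq> 0" for i
  proof (rule ccontr)
    assume "\<not> ?thesis"
    then have "h i = 0" using exp[of "h i"] by (simp add: hx hy)
    then show False using h_nz by blast
  qed
  have "pt v = pt (\<psi> ?a ?b)"
  proof (rule pt_eqI)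
    fix i
    have "\<exists>k. v i = k *s \<psi> ?a ?b i"
    proof (cases "i \<in> S")
      case True
      have "\<beta> i * dot (\<xi> i) (v i) = 0" "\<alpha> i * dot (\<xi> i) (v i) = 0"
        using dot_h[of x i] dot_h[of y i] hx[of i] hy[of i] unfolding \<xi>[OF True] dot_scale_left by simp_all
      then have "dot (\<xi> i) (v i) = 0" using \<alpha>\<beta>[OF True] by auto
      moreover have "dot (C i *v dir (?a i) (?b i)) (v i) = 0"
        unfolding dot_h[symmetric] dir_def by (simp add: algebra_simps)
      ultimately show ?thesis
        using orthogonal_to_both[OF cross_dir[OF True ab]] True by (simp add: \<psi>_def)
    next
      case False
      then have "cross_product (C i *v x) (C i *v y) \<noteq> 0" by (simp add: S_def)
      from orthogonal_to_both[OF this, of "v i"] show ?thesis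
        using False hx[of i] hy[of i] by (simp add: \<psi>_def dot_h)
    qed
    then obtain k where k: "v i = k *s \<psi> ?a ?b i" by blast
    moreover have "k \<noteq> 0" using v_nz[of i] unfolding k by auto
    ultimately show "\<exists>k. k \<noteq> 0 \<and> v i = k *s \<psi> ?a ?b i" by blast
  qed
  then show "l \<in> line_multiview_variety C"
    using all_dirs[of ?a ?b] ab pt_reps(1)[OF lp] by (simp add: v_def)
qed

end

section \<open>Four collinear centers\<close>

context cameras begin

text \<open>
  Let \<open>I\<close> be the set of the four cameras, and let \<open>f\<close> and \<open>g\<close> be equations of the line through
  their centers. Any choice of planes in the pencil of \<open>f\<close> and \<open>g\<close> through the centers is a
  point of the rank locus. For \<open>J\<close> contained in \<open>I\<close>, let the plane at camera \<open>i\<close> vary in the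
  whole pencil if \<open>i\<close> is in \<open>J\<close>, and be fixed otherwise. For increasing \<open>J\<close> this gives a chain
  of length 4. A line skew to the given one has an image outside the largest of these sets, so
  the rank locus itself can be added at the top of the chain.
\<close>

lemma four_collinear_dim:
  assumes "\<not> no_four_collinear C"
    and irr: "irreducible_space (subtopology zariski (rank_locus C))"
  shows "5 \<le> krull_dim (subtopology zariski (rank_locus C))"
proof -
  obtain I :: "'m set" and L where I: "card I = 4" "L \<in> grassmannian" "\<And>i. i \<in> I \<Longrightarrow> center (C i) \<subseteq> L"
    using assms(1) unfolding no_four_collinear_def by blast
  obtain x y where xy: "indep2 x y" "L = line2 x y" using I(2) grassmannian_iff by blast
  have "vec.subspace L" using I(2) by (simp add: grassmannian_def)
  then have c_in: "c i \<in> line2 x y" if "i \<in> I" for i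
    using I(3)[OF that] center_subset_iff xy(2) by blast
  obtain r s \<phi> \<eta> f g where d: "dot x f = 0" "dot x g = 0" "dot y f = 0" "dot y g = 0"
    "dot r f = 1" "dot r g = 0" "dot s f = 0" "dot s g = 1"
    by (rule adapted_basis[OF xy(1)]) (rule that)
  have c0: "dot (c i) f = 0" "dot (c i) g = 0" if "i \<in> I" for i
    using c_in[OF that] by (auto simp: line2_def d)
  have "\<forall>i. \<exists>v a b. transpose (C i) *v v = a *s f + b *s g \<and> v \<noteq> 0"
  proof
    fix i
    \<comment> \<open>Some plane of the pencil contains the center \<open>c i\<close>; it is unique unless the center is on the line.\<close>
    obtain a b where ab: "a \<noteq> 0 \<or> b \<noteq> 0" "dot (c i) (a *s f + b *s g) = 0"
    proof (cases "dot (c i) f = 0")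
      case True
      then show ?thesis by (intro that[of 1 0]) auto
    next
      case False
      then show ?thesis
        by (intro that[of "dot (c i) g" "- dot (c i) f"])
          (auto simp only: dot_add_right dot_scale_right neg_equal_0_iff_equal, simp)
    qed
    obtain v where v: "transpose (C i) *v v = a *s f + b *s g" using range_transpose[OF ab(2)] by blast
    have "v \<noteq> 0"
    proof
      assume "v = 0"
      then have 0: "a *s f + b *s g = 0" using v by simp
      have "dot r (a *s f + b *s g) = a" "dot s (a *s f + b *s g) = b" by (simp_all add: d)
      then show False using ab(1) unfolding 0 by simp
    qed
    then show "\<exists>v a b. transpose (C i) *v v = a *s f + b *s g \<and> v \<noteq> 0" using v by blast
  qed
  then obtain K where K: "\<And>i. \<exists>a b. transpose (C i) *v K i = a *s f + b *s g" "\<And>i. K i \<noteq> 0"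
    by metis
  have "\<forall>i. \<exists>v. i \<in> I \<longrightarrow> transpose (C i) *v v = f" using range_transpose c0(1) by blast
  then obtain F where F': "\<forall>i. i \<in> I \<longrightarrow> transpose (C i) *v F i = f" by (rule choice[THEN exE])
  have "\<forall>i. \<exists>v. i \<in> I \<longrightarrow> transpose (C i) *v v = g" using range_transpose c0(2) by blast
  then obtain G where G': "\<forall>i. i \<in> I \<longrightarrow> transpose (C i) *v G i = g" by (rule choice[THEN exE])
  have FG: "transpose (C i) *v F i = f" "transpose (C i) *v G i = g" if "i \<in> I" for i
    using F' G' that by blast+
  have FG_nz: "F i \<noteq> 0" "G i \<noteq> 0" if "i \<in> I" for i
    using FG[OF that] d(5,8) by auto
  define N where "N = (\<lambda>i. if i \<in> I then F i else K i)"
  define V where "V = (\<lambda>J i. if i \<in> J then vec.span {F i, G i} else vec.span {N i})"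
  define T where "T = (\<lambda>J. {t. \<forall>i. t i \<in> V J i})"
  define Z where "Z = (\<lambda>J. zariski closure_of param_set (\<lambda>t. t) (T J))"
  have N_nz: "N i \<noteq> 0" for i using FG_nz K(2) by (simp add: N_def)
  have aff: "affine_closed (T J)" for J
    unfolding T_def by (rule affine_closed_subspaces) (simp add: V_def)
  have base: "N \<in> T J" if "J \<subseteq> I" for J
    using that by (auto simp: T_def V_def N_def intro: vec.span_base)
  have TD: "t i \<in> V J i" if "t \<in> T J" for t i J using that by (simp add: T_def)
  have in_pencil: "\<exists>a b. transpose (C i) *v t i = a *s f + b *s g" if t: "t \<in> T J" "J \<subseteq> I" for t i J
  proof (cases "i \<in> J")
    case True
    then have i: "i \<in> I" using t(2) by blast
    have "t i \<in> line2 (F i) (G i)" using TD[OF t(1), of i] True by (simp add: V_def line2_eq_span)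
    then obtain a b where "t i = a *s F i + b *s G i" by (auto simp: line2_def)
    then have "transpose (C i) *v t i = a *s f + b *s g" by (simp add: vec.add vec.scale FG[OF i] del: transpose_matrix_vector)
    then show ?thesis by blast
  next
    case False
    then have "t i \<in> vec.span {N i}" using TD[OF t(1), of i] by (simp add: V_def)
    then obtain k where k: "t i = k *s N i" by (auto simp: vec.span_singleton)
    have "\<exists>a b. transpose (C i) *v N i = a *s f + b *s g"
    proof (cases "i \<in> I")
      case True
      then have "transpose (C i) *v N i = 1 *s f + 0 *s g" by (simp add: N_def FG del: transpose_matrix_vector)
      then show ?thesis by blast
    next
      case False
      then show ?thesis using K(1)[of i] by (simp add: N_def del: transpose_matrix_vector)
    qed
    then obtain a b where "transpose (C i) *v N i = a *s f + b *s g" by blast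
    then have "transpose (C i) *v t i = (k * a) *s f + (k * b) *s g"
      unfolding k by (simp add: vec.scale vec.scale_right_distrib del: transpose_matrix_vector)
    then show ?thesis by blast
  qed
  have closed: "closedin zariski (rank_locus C)" by (rule closedin_rank_locus[OF transpose_inj])
  have ZX: "Z J \<subseteq> rank_locus C" if J: "J \<subseteq> I" for J
    unfolding Z_def
  proof (rule closure_of_minimal[OF _ closed], rule subsetI)
    fix l assume "l \<in> param_set (\<lambda>t. t) (T J)"
    then obtain t where t: "t \<in> T J" "\<And>i. t i \<noteq> 0" "l = pt t" by (auto simp: param_set_def)
    have "\<forall>i. \<exists>a b. back_projections C t i = a *s f + b *s g"
      using in_pencil[OF t(1) J] by (simp add: back_projections_def del: transpose_matrix_vector)
    then obtain a b where "\<And>i. back_projections C t i = a i *s f + b i *s g" by metis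
    then have "pencil_family (back_projections C t)" by (rule pencil_familyI)
    then show "l \<in> rank_locus C" unfolding t(3) by (intro pt_in_rank_locus t(2))
  qed
  have ZZ: "Z J \<subset> Z (insert i J)" if J: "J \<subseteq> I" "i \<in> I" "i \<notin> J" for J i
    unfolding Z_def
  proof (rule param_closure_psubset[where ?t0.0 = N and u = "N(i := G i)" and F = "\<lambda>v. dot (C i *v s) (v i)"])
    have "V J k \<subseteq> V (insert i J) k" for k
      using J by (auto simp: V_def N_def intro: vec.span_mono[THEN subsetD, of "{F i}"])
    then show "T J \<subseteq> T (insert i J)" by (auto simp: T_def)
    show "affine_closed (T (insert i J))" by (rule aff)
    show "N \<in> T (insert i J)" using J by (intro base) auto
    show "form (\<lambda>k. if k = i then 1 else 0) (\<lambda>v. dot (C i *v s) (v i))" by (rule form_dot)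
    show "polynomial_on_lines (\<lambda>t. t i $ j)" for i :: 'm and j :: 3 by (rule pol_coord)
    show "N k \<noteq> 0" for k by (rule N_nz)
    have "N k \<in> V (insert i J) k" for k
      using TD[OF base, of "insert i J" k] J by blast
    moreover have "G i \<in> V (insert i J) i" by (simp add: V_def vec.span_base)
    ultimately show "N(i := G i) \<in> T (insert i J)"
      unfolding T_def by simp
    have dot_s: "dot (C i *v s) v = dot s (transpose (C i) *v v)" for v by (simp add: dot_transpose del: transpose_matrix_vector)
    show "dot (C i *v s) ((N(i := G i)) i) \<noteq> 0"
      unfolding dot_s using FG(2)[OF J(2)] d(8) by (simp del: transpose_matrix_vector)
    fix t assume "t \<in> T J"
    then have "t i \<in> V J i" by (rule TD)
    then have "t i \<in> vec.span {F i}" using J by (simp add: V_def N_def)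
    then obtain k where "t i = k *s F i" by (auto simp: vec.span_singleton)
    then show "dot (C i *v s) (t i) = 0"
      unfolding dot_s using FG(1)[OF J(2)] d(7) by (simp add: vec.scale del: transpose_matrix_vector)
  qed
  have ZI: "Z I \<subset> rank_locus C"
  proof -
    obtain i where i: "i \<in> I" using I(1) by (metis card.empty ex_in_conv zero_neq_numeral)
    obtain a b where ab: "c i = a *s x + b *s y" using c_in[OF i] by (auto simp: line2_def)
    obtain u w \<alpha> \<beta> where cr: "\<And>k. cross_product (C k *v u) (C k *v w) \<noteq> 0"
      and dd: "dot x \<alpha> = 1" "dot x \<beta> = 0" "dot y \<alpha> = 0" "dot y \<beta> = 1"
        "dot u \<alpha> = 0" "dot u \<beta> = 0" "dot w \<alpha> = 0" "dot w \<beta> = 0"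
      by (rule ex_line_skew_to[OF xy(1)]) (rule that)
    \<comment> \<open>A plane through \<open>c i\<close> and the skew line that does not contain both \<open>x\<close> and \<open>y\<close>.\<close>
    define h where "h = b *s \<alpha> + (- a) *s \<beta>"
    have h: "dot z h = b * dot z \<alpha> + (- a) * dot z \<beta>" for z
      by (simp only: h_def dot_add_right dot_scale_right)
    have "\<exists>z\<in>{x, y}. dot z h \<noteq> 0"
      using ab c_nz[of i] by (cases "b = 0") (auto simp: dd h)
    then obtain z where z: "z \<in> {x, y}" "dot z h \<noteq> 0" by blast
    have "dot (C i *v z) (cross_product (C i *v u) (C i *v w)) \<noteq> 0"
      by (rule triple_nonzero[OF cr, of _ h]) (use z(2) in \<open>simp_all add: ab dd h\<close>)
    let ?t = "\<lambda>b. if b then w else u"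
    let ?P = "\<lambda>v :: 'm \<Rightarrow> complex^3. dot (C i *v z) (v i)"
    have li: "line_images C ?t k \<noteq> 0" for k using cr by (simp add: line_images_def)
    have "pt (line_images C ?t) \<in> rank_locus C"
      using li param_set_subset_variety line_multiview_variety_subset_rank_locus by (auto simp: param_set_def)
    moreover have "?P (reps (pt (line_images C ?t))) \<noteq> 0"
      using form_reps_pt[OF form_dot[of i "C i *v z"], of "line_images C ?t"] li
        \<open>dot (C i *v z) (cross_product (C i *v u) (C i *v w)) \<noteq> 0\<close> by (simp add: line_images_def)
    moreover have "vanishes_on ?P (Z I)"
      unfolding Z_def
    proof (rule vanishes_on_closure[OF param_set_proj form_dot])
      have "dot (C i *v z) (t i) = 0" if tT: "t \<in> T I" for t
      proof -
        obtain a b where "transpose (C i) *v t i = a *s f + b *s g" using in_pencil[OF tT subset_refl, of i] by blast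
        moreover have "dot z (a *s f + b *s g) = 0" using z(1) by (auto simp: d)
        ultimately show ?thesis using dot_transpose[of z "C i" "t i"] by (simp del: transpose_matrix_vector)
      qed
      then show "vanishes_on ?P (param_set (\<lambda>t. t) (T I))"
        by (simp add: vanishes_on_param_set[OF form_dot])
    qed
    ultimately show ?thesis using ZX[of I] unfolding vanishes_on_def by blast
  qed
  obtain e where e: "bij_betw e {0..<4::nat} I"
    using ex_bij_betw_nat_finite[of I] I(1) by auto
  define J where "J = (\<lambda>k. e ` {0..<k})"
  have J: "J k \<subseteq> I" if "k \<le> 4" for k
    using e that by (auto simp: J_def bij_betw_def)
  have J4: "J 4 = I" using e by (simp add: J_def bij_betw_def)
  have J_Suc: "J (Suc k) = insert (e k) (J k)" for k
    by (auto simp: J_def atLeast0_lessThan_Suc)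
  have J_new: "e k \<in> I" "e k \<notin> J k" if "k < 4" for k
    using e that inj_on_image_mem_iff[of e "{0..<4}" k "{0..<k}"] by (auto simp: J_def bij_betw_def)
  define ZZ where "ZZ = (\<lambda>k. if k \<le> 4 then Z (J k) else rank_locus C)"
  have "enat 5 \<le> krull_dim (subtopology zariski (rank_locus C))"
  proof (rule krull_dim_ge)
    fix k :: nat assume "k \<le> 5"
    show "closedin zariski (ZZ k)" using closed by (simp add: ZZ_def Z_def)
    show "ZZ k \<subseteq> rank_locus C" using ZX[OF J] by (simp add: ZZ_def)
    have "irreducible_space (subtopology zariski (Z (J k)))" if "k \<le> 4"
      unfolding Z_def by (rule irreducible_param_closure[OF aff pol_coord base[OF J[OF that]] N_nz])
    then show "irreducible_space (subtopology zariski (ZZ k))" using irr by (simp add: ZZ_def)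
  next
    fix k :: nat assume "k < 5"
    then consider "k < 4" | "k = 4" by linarith
    then show "ZZ k \<subset> ZZ (Suc k)"
    proof cases
      case 1
      then show ?thesis using ZZ[OF J[of k] J_new[of k]] by (simp add: ZZ_def J_Suc)
    next
      case 2
      then show ?thesis using ZI by (simp add: ZZ_def J4)
    qed
  qed
  then show ?thesis by (simp add: numeral_eq_enat)
qed

end

lemma pinhole_cameras_interpretation:
  fixes C :: "'m::finite \<Rightarrow> complex^4^3"
  assumes "\<And>i. pinhole_camera (C i)" "inj (\<lambda>i. center (C i))"
  shows "\<exists>c. cameras C c"
proof -
  have "\<forall>i. \<exists>c. c \<noteq> 0 \<and> (\<forall>x. C i *v x = 0 \<longleftrightarrow> (\<exists>k. x = k *s c)) \<and>
      (\<forall>h. dot c h = 0 \<longrightarrow> (\<exists>v. transpose (C i) *v v = h))"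
  proof
    fix i
    obtain c where "c \<noteq> 0" "\<And>x. C i *v x = 0 \<longleftrightarrow> (\<exists>k. x = k *s c)"
        "\<And>h. dot c h = 0 \<Longrightarrow> \<exists>v. transpose (C i) *v v = h"
      by (rule pinhole_center[OF assms(1)[of i]]) (rule that)
    then show "\<exists>c. c \<noteq> 0 \<and> (\<forall>x. C i *v x = 0 \<longleftrightarrow> (\<exists>k. x = k *s c)) \<and>
      (\<forall>h. dot c h = 0 \<longrightarrow> (\<exists>v. transpose (C i) *v v = h))" by blast
  qed
  then obtain c where c: "\<forall>i. c i \<noteq> 0 \<and> (\<forall>x. C i *v x = 0 \<longleftrightarrow> (\<exists>k. x = k *s c i)) \<and>
      (\<forall>h. dot (c i) h = 0 \<longrightarrow> (\<exists>v. transpose (C i) *v v = h))" by (rule choice[THEN exE])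
  have "cameras C c"
  proof
    show "v = 0" if "transpose (C i) *v v = 0" for i v
      using pinhole_transpose_inj[OF assms(1) that] .
    show "c i \<noteq> 0" for i using c by blast
    show "C i *v x = 0 \<longleftrightarrow> (\<exists>k. x = k *s c i)" for i x using c by blast
    show "\<exists>v. transpose (C i) *v v = h" if "dot (c i) h = 0" for i h using c that by blast
    show "c i \<noteq> k *s c j" if "i \<noteq> j" for i j k
    proof
      assume k: "c i = k *s c j"
      have "c i \<noteq> 0" using c by blast
      then have "k \<noteq> 0" using k by auto
      have "x \<in> center (C i) \<longleftrightarrow> x \<in> center (C j)" for x
      proof -
        have "(\<exists>m. x = m *s c i) \<longleftrightarrow> (\<exists>m. x = m *s c j)"
        proof
          assume "\<exists>m. x = m *s c j"
          then obtain m where "x = m *s c j" by blast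
          then have "x = (m / k) *s c i" using \<open>k \<noteq> 0\<close> by (simp add: k)
          then show "\<exists>m. x = m *s c i" by blast
        qed (auto simp: k)
        then show ?thesis using c by (simp add: center_def)
      qed
      then have "center (C i) = center (C j)" by blast
      then show False using assms(2) that by (auto dest: injD)
    qed
  qed
  then show ?thesis by blast
qed

theorem theorem2p5:
  fixes C :: "'m::finite \<Rightarrow> complex^4^3"
  assumes "CARD('m) \<ge> 2"
    and "\<And>i. pinhole_camera (C i)"
    and "inj (\<lambda>i. center (C i))"
  shows "(line_multiview_variety C = rank_locus C \<longleftrightarrow> no_four_collinear C) \<and>
         (no_four_collinear C \<longleftrightarrow>
            irreducible_space (subtopology zariski (rank_locus C)) \<and>
            krull_dim (subtopology zariski (rank_locus C)) = 4)"
proof -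
  obtain c where "cameras C c" using pinhole_cameras_interpretation[OF assms(2,3)] by blast
  then interpret cameras C c .
  have "\<exists>i j :: 'm. i \<noteq> j"
  proof (rule ccontr)
    assume "\<not> ?thesis"
    then have "UNIV = {SOME i :: 'm. True}" by auto
    then have "CARD('m) = 1" by (metis card_1_singleton_iff One_nat_def)
    then show False using assms(1) by simp
  qed
  then obtain i j :: 'm where ij: "i \<noteq> j" by blast
  have dim: "krull_dim (subtopology zariski (line_multiview_variety C)) = 4"
    using krull_dim_line_multiview_variety_le krull_dim_line_multiview_variety_ge[OF ij]
    by (rule antisym)
  have eq: "line_multiview_variety C = rank_locus C" if "no_four_collinear C"
    using rank_locus_subset_variety[OF that] line_multiview_variety_subset_rank_locus by blast
  have conv: "no_four_collinear C" if irr: "irreducible_space (subtopology zariski (rank_locus C))"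
    and d: "krull_dim (subtopology zariski (rank_locus C)) = 4"
  proof (rule ccontr)
    assume "\<not> no_four_collinear C"
    from four_collinear_dim[OF this irr] have "(5 :: enat) \<le> 4" unfolding d .
    then show False by simp
  qed
  have "irreducible_space (subtopology zariski (rank_locus C)) \<and>
      krull_dim (subtopology zariski (rank_locus C)) = 4" if "line_multiview_variety C = rank_locus C"
    using irreducible_line_multiview_variety dim unfolding that by blast
  then show ?thesis using eq conv by blast
qed

end
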